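(* Let $\{X_{st}: s,t\in\mathbb{Z}\}$ be a stationary Gaussian process with spectral density function $f(x,y,\theta_0)$, where $$f(x,y,\theta)=\frac{\sigma^2}{4\pi^2}\,\frac{|1-e^{-ix}|^{-2d_1}\,|1-e^{-iy}|^{-2d_2}}{|(1-\alpha e^{-ix})(1-\beta e^{-iy})|^2},\qquad \theta=(\alpha,\beta,d_1,d_2),$$ $\sigma^2>0$, and the true parameter $\theta_0=(\alpha_0,\beta_0,d_{10},d_{20})$ satisfies $|\alpha_0|<1$, $|\beta_0|<1$ and $0<d_{10},d_{20}<\tfrac12$. Let $0<r<1$ and $0<s<\tfrac12$ be such that $\theta_0\in\Theta_{r,s}=\{(\alpha,\beta,d_1,d_2): |\alpha|\le r,\ |\beta|\le r,\ |d_1|\le s,\ |d_2|\le s\}$, and for each $N$ let $\hat\theta_N$ be a point of $\Theta_{r,s}$ at which $$\sigma_N^2(\theta)=\int_{I^2}\frac{I_N(x,y)}{f(x,y,\theta)}\,dx\,dy$$ attains its minimum over $\Theta_{r,s}$, where $I_N$ is the periodogram of the process. Then $\hat\theta_N\to\theta_0$ almost surely as $N\to\infty$.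
   Context: $I=[-\pi,\pi]$ and $I^2=I\times I$. A second-order process $\{X_{st}:s,t\in\mathbb{Z}\}$ is stationary if $E(X_{st})=\mu$ for all $s,t$ and $\operatorname{cov}(X_{s+k,t+\ell},X_{st})=:\gamma(k,\ell)$ does not depend on $s,t$. It has spectral density $h$ if $\gamma(k,\ell)=\int_{I^2}e^{i(kx+\ell y)}h(x,y)\,dx\,dy$ for all $k,\ell\in\mathbb{Z}$. With $\overline{X}_N=\frac1{N^2}\sum_{k,\ell=1}^N X_{k\ell}$, the periodogram is $$I_N(x,y)=\frac1{N^2}\left|\sum_{k,\ell=1}^N e^{i(kx+\ell y)}(X_{k\ell}-\overline{X}_N)\right|^2.$$ *)

theory Defs
  imports "HOL-Probability.Probability"
begin

definition covar :: "'a measure \<Rightarrow> ('a \<Rightarrow> real) \<Rightarrow> ('a \<Rightarrow> real) \<Rightarrow> real" where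
  "covar M U V =
     (\<integral>\<omega>. (U \<omega> - (\<integral>\<omega>'. U \<omega>' \<partial>M)) * (V \<omega> - (\<integral>\<omega>'. V \<omega>' \<partial>M)) \<partial>M)"

(* Almost surely constant variables count as (degenerate) Gaussian. *)
definition gaussian_rv :: "'a measure \<Rightarrow> ('a \<Rightarrow> real) \<Rightarrow> bool" where
  "gaussian_rv M U \<longleftrightarrow>
     (\<exists>m s. 0 < s \<and> distributed M lborel U (normal_density m s)) \<or>
     (U \<in> borel_measurable M \<and> (\<exists>m. AE \<omega> in M. U \<omega> = m))"

(* Joint Gaussianity of all finite-dimensional marginals: every finite linear
   combination of the variables is a Gaussian random variable. *)
definition gaussian_process :: "'a measure \<Rightarrow> ('i \<Rightarrow> 'a \<Rightarrow> real) \<Rightarrow> bool" where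
  "gaussian_process M Y \<longleftrightarrow>
     (\<forall>F c. finite F \<longrightarrow> gaussian_rv M (\<lambda>\<omega>. \<Sum>i\<in>F. c i * Y i \<omega>))"

definition autocov :: "'a measure \<Rightarrow> (int \<Rightarrow> int \<Rightarrow> 'a \<Rightarrow> real) \<Rightarrow> int \<Rightarrow> int \<Rightarrow> real" where
  "autocov M X k l = covar M (X k l) (X 0 0)"

definition stationary :: "'a measure \<Rightarrow> (int \<Rightarrow> int \<Rightarrow> 'a \<Rightarrow> real) \<Rightarrow> bool" where
  "stationary M X \<longleftrightarrow>
     (\<forall>s t. X s t \<in> borel_measurable M \<and> integrable M (\<lambda>\<omega>. (X s t \<omega>)\<^sup>2)) \<and>
     (\<exists>\<mu>. \<forall>s t. (\<integral>\<omega>. X s t \<omega> \<partial>M) = \<mu>) \<and>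
     (\<forall>k l s t. covar M (X (s + k) (t + l)) (X s t) = autocov M X k l)"

definition I2 :: "(real \<times> real) set" where
  "I2 = {-pi..pi} \<times> {-pi..pi}"

definition has_spectral_density ::
  "'a measure \<Rightarrow> (int \<Rightarrow> int \<Rightarrow> 'a \<Rightarrow> real) \<Rightarrow> (real \<Rightarrow> real \<Rightarrow> real) \<Rightarrow> bool" where
  "has_spectral_density M X h \<longleftrightarrow>
     set_integrable lborel I2 (\<lambda>(x, y). h x y) \<and>
     (\<forall>k l. complex_of_real (autocov M X k l) =
        set_lebesgue_integral lborel I2
          (\<lambda>(x, y). exp (\<i> * complex_of_real (of_int k * x + of_int l * y)) * complex_of_real (h x y)))"

definition sample_mean :: "(int \<Rightarrow> int \<Rightarrow> 'a \<Rightarrow> real) \<Rightarrow> nat \<Rightarrow> 'a \<Rightarrow> real" where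
  "sample_mean X N \<omega> = (1 / (real N)\<^sup>2) * (\<Sum>k=1..int N. \<Sum>l=1..int N. X k l \<omega>)"

definition periodogram ::
  "(int \<Rightarrow> int \<Rightarrow> 'a \<Rightarrow> real) \<Rightarrow> nat \<Rightarrow> 'a \<Rightarrow> real \<Rightarrow> real \<Rightarrow> real" where
  "periodogram X N \<omega> x y = (1 / (real N)\<^sup>2) *
     (cmod (\<Sum>k=1..int N. \<Sum>l=1..int N.
        exp (\<i> * complex_of_real (of_int k * x + of_int l * y)) *
        complex_of_real (X k l \<omega> - sample_mean X N \<omega>)))\<^sup>2"

(* The parameter is (\<alpha>, \<beta>, d1, d2). On the null set where x or y is a multiple
   of 2 pi, the conventions 0 powr a = 0 and a / 0 = 0 give both this function and
   its reciprocal the value 0; no integral below is affected. *)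
type_synonym param = "real \<times> real \<times> real \<times> real"

fun farima_density :: "real \<Rightarrow> param \<Rightarrow> real \<Rightarrow> real \<Rightarrow> real" where
  "farima_density \<sigma> (\<alpha>, \<beta>, d1, d2) x y =
     \<sigma>\<^sup>2 / (4 * pi\<^sup>2) *
     ((cmod (1 - exp (- (\<i> * complex_of_real x)))) powr (- 2 * d1) *
      (cmod (1 - exp (- (\<i> * complex_of_real y)))) powr (- 2 * d2) /
      (cmod ((1 - complex_of_real \<alpha> * exp (- (\<i> * complex_of_real x))) *
             (1 - complex_of_real \<beta> * exp (- (\<i> * complex_of_real y)))))\<^sup>2)"

definition Theta :: "real \<Rightarrow> real \<Rightarrow> param set" where
  "Theta r s = {(\<alpha>, \<beta>, d1, d2). \<bar>\<alpha>\<bar> \<le> r \<and> \<bar>\<beta>\<bar> \<le> r \<and> \<bar>d1\<bar> \<le> s \<and> \<bar>d2\<bar> \<le> s}"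

(* For N > 0 and \<theta> in Theta r s with r < 1 and s < 1/2 the integrand is integrable. *)
definition sigma2_N ::
  "(int \<Rightarrow> int \<Rightarrow> 'a \<Rightarrow> real) \<Rightarrow> real \<Rightarrow> nat \<Rightarrow> 'a \<Rightarrow> param \<Rightarrow> real" where
  "sigma2_N X \<sigma> N \<omega> \<theta> =
     set_lebesgue_integral lborel I2
       (\<lambda>(x, y). periodogram X N \<omega> x y / farima_density \<sigma> \<theta> x y)"

end

theory Submission
  imports Defs
begin

text \<open>
The argument is Hannan's for Whittle estimates, carried out for the product density \<open>f\<close> of
the theorem. Write \<open>\<theta>\<^sub>0\<close> for the true parameter.

The periodogram is a nonnegative trigonometric polynomial whose Fourier coefficients are
\<open>4 \<pi>\<^sup>2\<close> times the sample autocovariances (\<open>integral_chi_periodogram\<close>). If these converge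
almost surely to the autocovariances, then, on one event of probability one, the measures with
densities \<open>I\<^sub>N\<close> converge weakly on the torus to \<open>4 \<pi>\<^sup>2 f(\<theta>\<^sub>0)\<close>: trigonometric polynomials are
dense among the continuous functions on the torus and the total masses stay bounded
(\<open>continuous_limit\<close>). From there on the proof is deterministic.

The sample autocovariances converge because squares are nonnegative: after polarization each
one is a difference of sums of squares, and these sums increase with \<open>N\<close>. Convergence along the
subsequence \<open>j ^ p\<close> therefore implies convergence (\<open>strong_law_monotone\<close>), and any polynomial
rate for the variances makes that subsequence summable once \<open>p\<close> is large. For Gaussian variables
the variance of a sum of squares is a double sum of squared covariances
(\<open>variance_sum_shifted_squares\<close>), and long memory allows such a rate: the part of the density
near the axes has small mass, and the rest is bounded and obeys Bessel's inequality
(\<open>spectral_l2_rate\<close>).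

In the deterministic part the limiting contrast \<open>\<integral> f(\<theta>\<^sub>0) / f(\<theta>)\<close> is minimal only at
\<open>\<theta>\<^sub>0\<close>. Up to the common factor \<open>\<sigma>\<^sup>2 / 4 \<pi>\<^sup>2\<close> the logarithm of every \<open>f(\<theta>)\<close> integrates to zero,
because \<open>log \<bar>1 - \<rho> exp(ix)\<bar>\<close> has mean zero for \<open>\<bar>\<rho>\<bar> \<le> 1\<close>; hence the inequality
\<open>u - 1 \<ge> log u\<close> for the quotient \<open>u = f(\<theta>\<^sub>0) / f(\<theta>)\<close> gives the minimum, with equality only if
\<open>u = 1\<close>, and \<open>f\<close> determines its parameter (\<open>phi_identifiable\<close>). The contrast may be infinite and
\<open>1 / f(\<theta>)\<close> is not continuous at the axes when a memory parameter is not positive. For a lower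
bound it is enough to multiply \<open>1 / f(\<theta>)\<close> by a cutoff that vanishes near the axes, which makes it
jointly continuous in the parameter and the frequency; by \<open>contrast_gap\<close> a fine enough cutoff
already separates \<open>\<theta>\<close> from \<open>\<theta>\<^sub>0\<close>. For the upper bound only \<open>1 / f(\<theta>\<^sub>0)\<close> is needed, and this is
continuous because the true memory parameters are positive. A limit point \<open>\<theta> \<noteq> \<theta>\<^sub>0\<close> of the
estimates would violate these two bounds (\<open>whittle_consistency\<close>).
\<close>

section \<open>Fourier analysis on the square\<close>

abbreviation J :: "real measure" where "J \<equiv> restrict_space lborel {-pi..pi}"
abbreviation T :: "(real \<times> real) measure" where "T \<equiv> restrict_space lborel I2"

lemma I2_sets [measurable, simp]: "I2 \<in> sets borel"
  unfolding I2_def by (simp add: borel_Times)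

lemma space_T [simp]: "space T = I2" by (simp add: space_restrict_space)

lemma finite_J: "finite_measure J"
  by (intro finite_measureI) (simp add: emeasure_restrict_space space_restrict_space)

lemma emeasure_I2: "emeasure lborel I2 = ennreal (4 * pi\<^sup>2)"
proof -
  have "emeasure lborel I2 = emeasure (lborel \<Otimes>\<^sub>M lborel) ({-pi..pi} \<times> {-pi..pi})"
    by (simp add: lborel_prod I2_def)
  also have "\<dots> = ennreal (2*pi) * ennreal (2*pi)"
    by (subst lborel.emeasure_pair_measure_Times) auto
  finally show ?thesis by (simp add: ennreal_mult'[symmetric] power2_eq_square)
qed

lemma finite_T: "finite_measure T"
  by (intro finite_measureI) (simp add: emeasure_restrict_space emeasure_I2)

interpretation T: finite_measure T by (rule finite_T)
interpretation J: finite_measure J by (rule finite_J)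

lemma measure_T: "measure T I2 = 4 * pi\<^sup>2"
  by (simp add: measure_def emeasure_restrict_space emeasure_I2)

lemma borel_measurable_T: "f \<in> borel_measurable borel \<Longrightarrow> f \<in> borel_measurable T"
  by (simp add: measurable_restrict_space1)

lemma
  fixes F G :: "real \<Rightarrow> 'b::{banach,real_normed_field,second_countable_topology}"
  assumes F: "integrable J F" and G: "integrable J G"
  shows integrable_T_product: "integrable T (\<lambda>p. F (fst p) * G (snd p))"
    and integral_T_product: "integral\<^sup>L T (\<lambda>p. F (fst p) * G (snd p)) = integral\<^sup>L J F * integral\<^sup>L J G"
proof -
  define F' where "F' = (\<lambda>x. indicator {-pi..pi} x *\<^sub>R F x)"
  define G' where "G' = (\<lambda>x. indicator {-pi..pi} x *\<^sub>R G x)"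
  have F': "integrable lborel F'" and G': "integrable lborel G'"
    using F G by (simp_all add: integrable_restrict_space F'_def G'_def)
  have [measurable]: "F' \<in> borel_measurable lborel" "G' \<in> borel_measurable lborel"
    using F' G' by (auto dest: borel_measurable_integrable)
  have e: "(\<lambda>p. indicator I2 p *\<^sub>R (F (fst p) * G (snd p))) = (\<lambda>p. F' (fst p) * G' (snd p))"
    by (auto simp: fun_eq_iff F'_def G'_def I2_def indicator_def)
  have i: "integrable (lborel \<Otimes>\<^sub>M lborel) (\<lambda>p. F' (fst p) * G' (snd p))"
    by (rule lborel_pair.Fubini_integrable) (auto simp: norm_mult intro: F' G')
  have "integral\<^sup>L (lborel \<Otimes>\<^sub>M lborel) (\<lambda>p. F' (fst p) * G' (snd p))
      = integral\<^sup>L lborel F' * integral\<^sup>L lborel G'"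
    using lborel_pair.integral_fst'[OF i] by (simp add: F' G')
  with i show "integrable T (\<lambda>p. F (fst p) * G (snd p))" 
    and "integral\<^sup>L T (\<lambda>p. F (fst p) * G (snd p)) = integral\<^sup>L J F * integral\<^sup>L J G"
    by (simp_all add: integrable_restrict_space integral_restrict_space e lborel_prod
        F'_def[symmetric] G'_def[symmetric])
qed

lemma continuous_integrable_J:
  fixes f :: "real \<Rightarrow> 'b::{banach,second_countable_topology}"
  assumes "continuous_on UNIV f"
  shows "integrable J f"
  using borel_integrable_compact[of "{-pi..pi}" f] continuous_on_subset[OF assms]
  by (auto simp: integrable_restrict_space indicator_def if_distrib cong: if_cong)

lemma continuous_integrable_T:
  fixes f :: "real \<times> real \<Rightarrow> 'b::{banach,second_countable_topology}"
  assumes "continuous_on UNIV f"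
  shows "integrable T f"
proof -
  have "compact I2" unfolding I2_def by (intro compact_Times) auto
  then show ?thesis using borel_integrable_compact[of "I2" f] continuous_on_subset[OF assms]
  by (auto simp: integrable_restrict_space indicator_def if_distrib cong: if_cong)
qed

lemma integral_cis_J: "integral\<^sup>L J (\<lambda>x. cis (of_int k * x)) = (if k = 0 then 2 * of_real pi else 0)"
proof (cases "k = 0")
  case True
  then show ?thesis by (simp add: measure_restrict_space scaleR_conv_of_real)
next
  case False
  have "(\<integral>x. indicator {-pi..pi} x *\<^sub>R cis (of_int k * x) \<partial>lborel) = 
     (- \<i> / of_int k) * cis (of_int k * pi) - (- \<i> / of_int k) * cis (of_int k * (- pi))"
  proof (rule integral_FTC_Icc)
    fix x assume "-pi \<le> x" "x \<le> pi"
    show "((\<lambda>x. (- \<i> / of_int k) * cis (of_int k * x)) has_vector_derivative cis (of_int k * x))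
        (at x within {- pi..pi})"
      unfolding cis_conv_exp of_real_mult of_real_of_int_eq using False
      by (intro has_vector_derivative_real_field[where f
          = "\<lambda>w. (- \<i> / of_int k) * exp (\<i> * (of_int k * w))"])
         (auto intro!: derivative_eq_intros)
  qed (auto intro!: continuous_intros)
  also have "cis (of_int k * (-pi)) = cis (of_int k * pi)"
    by (simp add: complex_eq_iff sin_npi_int mult.commute)
  finally show ?thesis using False by (simp add: integral_restrict_space)
qed

text \<open>
The characters of the torus. Frequencies are pairs, so that translation of the index set is
addition of pairs and multiplication of characters.
\<close>

definition chi :: "int \<times> int \<Rightarrow> real \<times> real \<Rightarrow> complex" where
  "chi h p = cis (of_int (fst h) * fst p + of_int (snd h) * snd p)"

lemma chi_add: "chi (g + h) p = chi g p * chi h p"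
  by (simp add: chi_def cis_mult algebra_simps)
lemma chi_0 [simp]: "chi 0 p = 1" by (simp add: chi_def)
lemma chi_uminus: "chi (- h) p = cnj (chi h p)" by (simp add: chi_def cis_cnj)
lemma norm_chi [simp]: "norm (chi h p) = 1" by (simp add: chi_def)
lemma continuous_chi [continuous_intros]: "continuous_on A (chi h)"
  unfolding chi_def by (intro continuous_intros)
lemma chi_measurable [measurable]: "chi h \<in> borel_measurable borel"
  by (intro borel_measurable_continuous_onI continuous_intros)

lemma integral_chi: "integral\<^sup>L T (chi h) = (if h = 0 then of_real (4 * pi\<^sup>2) else 0)"
proof -
  have c: "integrable J (\<lambda>x. cis (of_int k * x))" for k :: int
    by (intro continuous_integrable_J continuous_intros)
  have "integral\<^sup>L T (chi h) = integral\<^sup>L T (\<lambda>p. cis (of_int (fst h) * fst p) * cis (of_int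
      (snd h) * snd p))"
    by (simp add: chi_def[abs_def] cis_mult)
  also have "\<dots> = integral\<^sup>L J (\<lambda>x. cis (of_int (fst h) * x)) * integral\<^sup>L J (\<lambda>x. cis (of_int
      (snd h) * x))"
    by (rule integral_T_product[OF c c])
  finally show ?thesis by (auto simp: integral_cis_J prod_eq_iff power2_eq_square)
qed

text \<open>
By orthogonality only the index pairs at distance \<open>h\<close> contribute. For \<open>h = 0\<close> this is Parseval's
identity for trigonometric polynomials; for general \<open>h\<close> it turns the Fourier coefficients of a
periodogram into sample autocovariances.
\<close>

lemma integral_chi_norm_square:
  fixes z :: "int \<times> int \<Rightarrow> complex"
  assumes "finite B"
  shows "integral\<^sup>L T (\<lambda>p. chi h p * of_real ((cmod (\<Sum>u\<in>B. chi u p * z u))\<^sup>2)) =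
    of_real (4 * pi\<^sup>2) * (\<Sum>u\<in>B. if u + h \<in> B then z u * cnj (z (u + h)) else 0)"
proof -
  have 1: "chi h p * of_real ((cmod (\<Sum>u\<in>B. chi u p * z u))\<^sup>2) =
     (\<Sum>u\<in>B. \<Sum>v\<in>B. (z u * cnj (z v)) * chi (u + h - v) p)" for p
    by (simp only: complex_norm_square cnj_sum sum_product complex_cnj_mult diff_conv_add_uminus
        chi_add chi_uminus)
       (simp add: sum_distrib_left mult_ac)
  have c: "integrable T (chi h)" for h by (intro continuous_integrable_T continuous_intros)
  have "integral\<^sup>L T (\<lambda>p. chi h p * of_real ((cmod (\<Sum>u\<in>B. chi u p * z u))\<^sup>2)) =
     (\<Sum>u\<in>B. \<Sum>v\<in>B. (z u * cnj (z v)) * integral\<^sup>L T (chi (u + h - v)))"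
    unfolding 1 by (subst Bochner_Integration.integral_sum,
        (intro Bochner_Integration.integrable_sum integrable_mult_right c))+
       (simp add: c)
  also have "\<dots> = (\<Sum>u\<in>B. \<Sum>v\<in>B. if v = u + h then of_real (4 * pi\<^sup>2) * (z u * cnj (z (u + h))) else 0)"
    by (intro sum.cong refl) (auto simp: integral_chi)
  also have "\<dots> = (\<Sum>u\<in>B. of_real (4 * pi\<^sup>2) * (if u + h \<in> B then z u * cnj (z (u + h)) else 0))"
    using assms by (intro sum.cong refl) (auto simp: sum.delta)
  finally show ?thesis by (simp add: sum_distrib_left)
qed

text \<open>
Let \<open>S\<close> be the left-hand side. It equals the integral of \<open>g\<close> against the trigonometric polynomial
\<open>P\<close> whose coefficients are the conjugate Fourier coefficients of \<open>g\<close>, and \<open>P\<close> has squared norm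
\<open>4 \<pi>\<^sup>2 S\<close>. The arithmetic-geometric mean inequality for \<open>P g\<close>, with weights chosen such
that the \<open>P\<close>-part is \<open>S / 2\<close>, can then be solved for \<open>S\<close>.
\<close>

lemma Bessel_T:
  fixes g :: "real \<times> real \<Rightarrow> real"
  assumes fin: "finite F" and g: "integrable T g" and g2: "integrable T (\<lambda>p. (g p)\<^sup>2)"
  shows "(\<Sum>h\<in>F. (cmod (integral\<^sup>L T (\<lambda>p. chi h p * of_real (g p))))\<^sup>2)
      \<le> 4 * pi\<^sup>2 * integral\<^sup>L T (\<lambda>p. (g p)\<^sup>2)"
proof -
  define a where "a h = integral\<^sup>L T (\<lambda>p. chi h p * of_real (g p))" for h
  define P where "P p = (\<Sum>h\<in>F. chi h p * cnj (a h))" for p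
  define S where "S = (\<Sum>h\<in>F. (cmod (a h))\<^sup>2)"
  have cP: "continuous_on UNIV P" unfolding P_def by (intro continuous_intros)
  have iP: "integrable T (\<lambda>p. (cmod (P p))\<^sup>2)"
    by (intro continuous_integrable_T continuous_intros cP)
  have ig: "integrable T (\<lambda>p. chi h p * of_real (g p))" for h
  proof (rule Bochner_Integration.integrable_bound[OF g])
    show "(\<lambda>p. chi h p * of_real (g p)) \<in> borel_measurable T"
      using borel_measurable_integrable[OF g] borel_measurable_T[OF chi_measurable] by measurable
  qed (simp add: norm_mult)
  have "of_real (integral\<^sup>L T (\<lambda>p. (cmod (P p))\<^sup>2))
      = integral\<^sup>L T (\<lambda>p. chi 0 p * of_real ((cmod (P p))\<^sup>2))"
    by (simp add: integral_complex_of_real[symmetric] del: of_real_power integral_complex_of_real)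
  also have "\<dots> = of_real (4 * pi\<^sup>2 * S)"
    unfolding P_def integral_chi_norm_square[OF fin] S_def
    by (simp add: complex_norm_square mult.commute del: of_real_power)
  finally have PS: "integral\<^sup>L T (\<lambda>p. (cmod (P p))\<^sup>2) = 4 * pi\<^sup>2 * S"
    using of_real_eq_iff by blast
  have "of_real S = (\<Sum>h\<in>F. integral\<^sup>L T (\<lambda>p. chi h p * of_real (g p) * cnj (a h)))"
    unfolding S_def of_real_sum by (intro sum.cong refl)
        (simp add: ig a_def[symmetric] complex_norm_square[symmetric] del: of_real_power)
  also have "\<dots> = integral\<^sup>L T (\<lambda>p. P p * of_real (g p))"
    by (subst Bochner_Integration.integral_sum[symmetric])
       (rule integrable_mult_left, rule ig, simp only: P_def sum_distrib_right mult.assoc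
           mult.commute[of "cnj _"])
  finally have SP: "of_real S = integral\<^sup>L T (\<lambda>p. P p * of_real (g p))" .
  have "0 \<le> S" unfolding S_def by (intro sum_nonneg) auto
  then have "S = cmod (integral\<^sup>L T (\<lambda>p. P p * of_real (g p)))"
    unfolding SP[symmetric] by simp
  also have "\<dots> \<le> integral\<^sup>L T (\<lambda>p. cmod (P p * of_real (g p)))"
    by (rule integral_norm_bound)
  also have "\<dots> \<le> integral\<^sup>L T (\<lambda>p. (4 * pi\<^sup>2 * (g p)\<^sup>2 + (cmod (P p))\<^sup>2 / (4 * pi\<^sup>2)) / 2)"
  proof (rule integral_mono')
    show "integrable T (\<lambda>p. (4 * pi\<^sup>2 * (g p)\<^sup>2 + (cmod (P p))\<^sup>2 / (4 * pi\<^sup>2)) / 2)"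
      using g2 iP by simp
    fix p
    have "0 \<le> (2 * pi * \<bar>g p\<bar> - cmod (P p) / (2 * pi))\<^sup>2" by simp
    also have "\<dots> = 4 * pi\<^sup>2 * (g p)\<^sup>2 + (cmod (P p))\<^sup>2 / (4 * pi\<^sup>2) - 2 * (cmod (P p) * \<bar>g p\<bar>)"
      by (simp add: power2_diff power_mult_distrib power_divide) 
    finally show "cmod (P p * of_real (g p)) \<le> (4 * pi\<^sup>2 * (g p)\<^sup>2 + (cmod (P p))\<^sup>2 / (4 * pi\<^sup>2)) / 2"
      by (simp add: norm_mult)
  qed simp
  also have "\<dots> = (4 * pi\<^sup>2 * integral\<^sup>L T (\<lambda>p. (g p)\<^sup>2) + S) / 2"
    using g2 iP by (simp add: PS)
  finally show ?thesis by (simp add: S_def a_def)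
qed

section \<open>Integrals of the modulus of 1 - exp(ix)\<close>

text \<open>
All singularities of the densities are powers of this chord length.
\<close>

definition chord :: "real \<Rightarrow> real" where "chord x = cmod (1 - cis x)"

lemma chord_nonneg [simp]: "0 \<le> chord x" by (simp add: chord_def)

lemma chord_le_2: "chord x \<le> 2"
  using norm_triangle_ineq4[of 1 "cis x"] by (simp add: chord_def)

lemma chord_eq_sin: "chord x = 2 * \<bar>sin (x / 2)\<bar>"
proof -
  have "(chord x)\<^sup>2 = (1 - cos x)\<^sup>2 + (sin x)\<^sup>2"
    by (simp add: chord_def cmod_power2)
  also have "\<dots> = 2 - 2 * cos x"
    using sin_cos_squared_add[of x] by (simp add: power2_diff)
  also have "\<dots> = (2 * \<bar>sin (x / 2)\<bar>)\<^sup>2"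
    using cos_double_sin[of "x / 2"] by (simp add: power_mult_distrib)
  finally show ?thesis by (rule power2_eq_imp_eq) auto
qed

text \<open>
A crude form of Jordan's inequality: the third order Taylor bound is enough on an interval that
contains \<open>\<pi> / 2\<close>, and it makes the chord comparable with \<open>\<bar>x\<bar>\<close>.
\<close>

lemma sin_ge_third:
  fixes y :: real
  assumes "0 \<le> y" "y \<le> 2" shows "y / 3 \<le> sin y"
proof -
  have "\<bar>sin y - (\<Sum>m<3. sin_coeff m * y ^ m)\<bar> \<le> inverse (fact 3) * \<bar>y\<bar> ^ 3"
    by (rule Maclaurin_sin_bound)
  moreover have "(\<Sum>m<3. sin_coeff m * y ^ m) = y"
    by (simp add: numeral_3_eq_3 sin_coeff_def)
  ultimately have "\<bar>sin y - y\<bar> \<le> y ^ 3 / 6"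
    using assms by (simp add: fact_numeral)
  then have "y - y ^ 3 / 6 \<le> sin y"
    unfolding abs_le_iff by linarith
  moreover have "y ^ 3 \<le> 4 * y"
    using mult_right_mono[OF power_mono[OF assms(2,1), of 2] assms(1)]
        by (simp add: power3_eq_cube power2_eq_square)
  ultimately show ?thesis by simp
qed

lemma chord_ge:
  assumes "\<bar>x\<bar> \<le> pi" shows "\<bar>x\<bar> / 3 \<le> chord x"
proof -
  have "\<bar>x\<bar> / 2 / 3 \<le> sin (\<bar>x\<bar> / 2)"
    using assms pi_less_4 by (intro sin_ge_third) auto
  also have "\<dots> \<le> \<bar>sin (x / 2)\<bar>"
    by (cases "x \<ge> 0") auto
  finally show ?thesis by (simp add: chord_eq_sin)
qed

lemma continuous_chord [continuous_intros]: "continuous_on A chord"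
  unfolding chord_def by (intro continuous_intros)

lemma chord_measurable [measurable]: "chord \<in> borel_measurable borel"
  by (intro borel_measurable_continuous_onI continuous_intros)

lemma chord_pos: "x \<in> {-pi..pi} \<Longrightarrow> x \<noteq> 0 \<Longrightarrow> 0 < chord x"
  using chord_ge[of x] by (smt (verit) atLeastAtMost_iff divide_pos_pos)

lemma integrable_J_abs_powr:
  assumes "-1 < p" shows "integrable J (\<lambda>x. \<bar>x\<bar> powr p)"
proof -
  have a: "(\<lambda>x. x powr p) integrable_on {0..pi}"
    using integrable_on_powr_from_0[OF assms, of pi] by simp
  have b1: "(\<lambda>x. \<bar>x\<bar> powr p) integrable_on {0..pi}"
    by (rule integrable_eq[OF a]) auto
  have b2: "(\<lambda>x. \<bar>x\<bar> powr p) integrable_on {-pi..0}"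
    using Henstock_Kurzweil_Integration.integrable_reflect_real[of "\<lambda>x. \<bar>x\<bar> powr p" 0 "-pi"] b1 by simp
  have b3: "(\<lambda>x. \<bar>x\<bar> powr p) integrable_on {-pi..pi}"
    using Henstock_Kurzweil_Integration.integrable_combine[OF _ _ b2 b1] by simp
  have "(\<lambda>x. \<bar>x\<bar> powr p) absolutely_integrable_on {-pi..pi}"
    using b3 by (intro nonnegative_absolutely_integrable_1) auto
  then have "integrable (completion lborel) (\<lambda>x. indicator {-pi..pi} x *\<^sub>R \<bar>x\<bar> powr p)"
    by (simp add: set_integrable_def)
  then show ?thesis
    by (subst (asm) integrable_completion) (auto simp: integrable_restrict_space)
qed

lemma borel_measurable_J: "f \<in> borel_measurable borel \<Longrightarrow> f \<in> borel_measurable J"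
  by (simp add: measurable_restrict_space1)

lemma integrable_chord_powr:
  assumes "-1 < p" shows "integrable J (\<lambda>x. chord x powr p)"
proof (cases "0 \<le> p")
  case True
  show ?thesis
  proof (rule J.integrable_const_bound[of _ "2 powr p"])
    show "AE x in J. norm (chord x powr p) \<le> 2 powr p"
      using True by (auto intro!: powr_mono2 chord_le_2)
  qed (intro borel_measurable_J, measurable)
next
  case False
  show ?thesis
  proof (rule Bochner_Integration.integrable_bound)
    show "integrable J (\<lambda>x. 3 powr (- p) * \<bar>x\<bar> powr p)"
      by (intro integrable_mult_right integrable_J_abs_powr assms)
    show "AE x in J. norm (chord x powr p) \<le> norm (3 powr (- p) * \<bar>x\<bar> powr p)"
    proof (rule AE_I2)
      fix x assume x: "x \<in> space J"
      show "norm (chord x powr p) \<le> norm (3 powr (- p) * \<bar>x\<bar> powr p)"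
      proof (cases "x = 0")
        case True then show ?thesis by (simp add: chord_def)
      next
        case nz: False
        have "chord x powr p \<le> (\<bar>x\<bar> / 3) powr p"
          using nz x False by (intro powr_mono2' chord_ge) (auto simp: space_restrict_space)
        also have "\<dots> = 3 powr (- p) * \<bar>x\<bar> powr p"
          by (simp add: powr_divide powr_minus field_simps)
        finally show ?thesis by simp
      qed
    qed
  qed (intro borel_measurable_J, measurable)
qed

lemma integrable_ln_chord: "integrable J (\<lambda>x. ln (chord x))"
proof (rule Bochner_Integration.integrable_bound)
  show "integrable J (\<lambda>x. chord x powr 1 + 2 * chord x powr (-1/2))"
    by (intro Bochner_Integration.integrable_add integrable_mult_right integrable_chord_powr) auto
  show "AE x in J. norm (ln (chord x)) \<le> norm (chord x powr 1 + 2 * chord x powr (-1/2))"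
  proof (rule AE_I2)
    fix x
    show "norm (ln (chord x)) \<le> norm (chord x powr 1 + 2 * chord x powr (-1/2))"
    proof (cases "chord x = 0")
      case False
      then have p: "chord x > 0" using chord_nonneg[of x] by linarith
      have 1: "ln (chord x) \<le> chord x" using p by (rule ln_bound)
      have "ln (chord x powr (-1/2)) \<le> chord x powr (-1/2)" using p by (intro ln_bound) auto
      then have "- ln (chord x) \<le> 2 * chord x powr (-1/2)" using p by (simp add: ln_powr)
      with 1 p show ?thesis by (simp add: abs_le_iff) (smt (verit) powr_ge_zero)
    qed auto
  qed
qed (intro borel_measurable_J, measurable)

text \<open>
The function is the real part of \<open>Ln (1 - \<rho> exp(ix))\<close>, whose power series in \<open>\<rho> exp(ix)\<close> has no
constant term and converges absolutely and uniformly; each term integrates to zero.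
\<close>

lemma ln_cmod_integral:
  fixes \<rho> :: real
  assumes "\<bar>\<rho>\<bar> < 1"
  shows integrable_ln_cmod: "integrable J (\<lambda>x. ln (cmod (1 - of_real \<rho> * cis x)))"
    and integral_ln_cmod: "integral\<^sup>L J (\<lambda>x. ln (cmod (1 - of_real \<rho> * cis x))) = 0"
proof -
  define g where "g n x = - ((of_real \<rho> * cis x) ^ n) / of_nat n" for n :: nat and x :: real
  have s: "(\<lambda>n. g n x) sums Ln (1 - of_real \<rho> * cis x)" for x
    using Ln_series'[of "- (of_real \<rho> * cis x)"] assms unfolding g_def by (simp add: norm_mult)
  have geq: "g n x = (- (of_real \<rho> ^ n) / of_nat n) * cis (of_int (int n) * x)" for n x
    unfolding g_def by (simp add: power_mult_distrib Complex.DeMoivre)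
  have gi: "integrable J (g n)" for n
    unfolding geq[abs_def] by (intro continuous_integrable_J continuous_intros)
  have g0: "integral\<^sup>L J (g n) = 0" for n
    unfolding geq[abs_def] by (cases "n = 0") (simp_all add: integral_cis_J del: of_int_of_nat_eq)
  have ng: "norm (g n x) \<le> \<bar>\<rho>\<bar> ^ n" for n x
    by (cases "n = 0") (auto simp: g_def norm_divide norm_power norm_mult divide_le_eq
        mult_right_le_one_le
        intro!: mult_right_le_one_le order_trans[OF _ mult_left_mono[of 1 "real n" "\<bar>\<rho>\<bar>^n"]])
  have sg: "summable (\<lambda>n. \<bar>\<rho>\<bar> ^ n)" using assms by (intro summable_geometric) auto
  have A: "AE x in J. summable (\<lambda>i. norm (g i x))"
    by (intro AE_I2 summable_comparison_test'[OF sg, of 0]) (use ng in auto)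
  have B: "summable (\<lambda>i. \<integral>x. norm (g i x) \<partial>J)"
  proof (rule summable_comparison_test'[of _ 0])
    show "summable (\<lambda>n. 2 * pi * \<bar>\<rho>\<bar> ^ n)" using sg by (rule summable_mult)
    fix n :: nat
    have "(\<integral>x. norm (g n x) \<partial>J) \<le> (\<integral>x. \<bar>\<rho>\<bar> ^ n \<partial>J)"
      using ng gi by (intro integral_mono) auto
    then show "norm (\<integral>x. norm (g n x) \<partial>J) \<le> 2 * pi * \<bar>\<rho>\<bar> ^ n"
      by (simp add: measure_restrict_space)
  qed
  have e: "(\<Sum>n. g n x) = Ln (1 - of_real \<rho> * cis x)" for x
    using s[of x] by (simp add: sums_iff)
  have i: "integrable J (\<lambda>x. Ln (1 - of_real \<rho> * cis x))"
    using integrable_suminf[OF gi A B] by (simp add: e)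
  have v: "integral\<^sup>L J (\<lambda>x. Ln (1 - of_real \<rho> * cis x)) = 0"
    using integral_suminf[OF gi A B] by (simp add: e g0)
  have r: "Re (Ln (1 - of_real \<rho> * cis x)) = ln (cmod (1 - of_real \<rho> * cis x))" for x
  proof -
    have "cmod (of_real \<rho> * cis x) < 1" using assms by (simp add: norm_mult)
    then have "1 - of_real \<rho> * cis x \<noteq> 0" by auto
    then show ?thesis by simp
  qed
  show "integrable J (\<lambda>x. ln (cmod (1 - of_real \<rho> * cis x)))"
    using integrable_Re[OF i] unfolding r .
  show "integral\<^sup>L J (\<lambda>x. ln (cmod (1 - of_real \<rho> * cis x))) = 0"
    using integral_Re[OF i] v unfolding r by simp
qed

text \<open>
The case \<open>\<rho> = 1\<close>, by dominated convergence as \<open>\<rho>\<close> increases to \<open>1\<close>. The distance from \<open>1\<close> to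
\<open>\<rho> exp(ix)\<close> is at least half the chord, so \<open>\<bar>log chord\<bar> + log 2\<close> dominates.
\<close>

lemma integral_ln_chord: "integral\<^sup>L J (\<lambda>x. ln (chord x)) = 0"
proof -
  define \<rho> where "\<rho> n = 1 - 1 / real (n + 2)" for n
  have \<rho>: "0 \<le> \<rho> n" "\<rho> n < 1" for n by (auto simp: \<rho>_def field_simps)
  have \<rho>1: "\<rho> \<longlonglongrightarrow> 1" unfolding \<rho>_def by real_asymp
  have "(\<lambda>n. integral\<^sup>L J (\<lambda>x. ln (cmod (1 - of_real (\<rho> n) * cis x)))) \<longlonglongrightarrow> integral\<^sup>L J (\<lambda>x. ln (chord x))"
  proof (rule integral_dominated_convergence[where w = "\<lambda>x. \<bar>ln (chord x)\<bar> + ln 2"])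
    have nz: "AE x in J. x \<noteq> 0"
      using AE_lborel_singleton[of "0::real"] by (simp add: AE_restrict_space_iff)
          (auto elim: eventually_mono)
    show "AE x in J. (\<lambda>n. ln (cmod (1 - of_real (\<rho> n) * cis x))) \<longlonglongrightarrow> ln (chord x)"
      using nz AE_space
    proof eventually_elim
      case (elim x)
      then have "chord x > 0" by (intro chord_pos) (auto simp: space_restrict_space)
      moreover have "(\<lambda>n. cmod (1 - of_real (\<rho> n) * cis x)) \<longlonglongrightarrow> cmod (1 - of_real 1 * cis x)"
        by (intro tendsto_intros \<rho>1)
      ultimately show ?case by (intro tendsto_ln) (auto simp: chord_def)
    qed
    fix n
    show "AE x in J. norm (ln (cmod (1 - of_real (\<rho> n) * cis x))) \<le> \<bar>ln (chord x)\<bar> + ln 2"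
      using nz AE_space
    proof eventually_elim
      case (elim x)
      then have c: "chord x > 0" by (intro chord_pos) (auto simp: space_restrict_space)
      let ?m = "cmod (1 - of_real (\<rho> n) * cis x)"
      have u: "?m \<le> 2"
        using norm_triangle_ineq4[of 1 "of_real (\<rho> n) * cis x"] \<rho>[of n] by (simp add: norm_mult)
      have "1 - \<rho> n \<le> ?m"
        using norm_triangle_ineq2[of 1 "of_real (\<rho> n) * cis x"] \<rho>[of n] by (simp add: norm_mult)
      moreover have "chord x \<le> ?m + (1 - \<rho> n)"
      proof -
        have "1 - cis x = (1 - of_real (\<rho> n) * cis x) - of_real (1 - \<rho> n) * cis x"
          by (simp add: algebra_simps)
        then show ?thesis
          using norm_triangle_ineq4[of "1 - of_real (\<rho> n) * cis x" "of_real (1 - \<rho> n) * cis x"] \<rho>[of n]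
          unfolding chord_def by (metis abs_of_nonneg diff_ge_0_iff_ge less_imp_le
              mult.right_neutral norm_cis norm_mult norm_of_real)
      qed
      ultimately have l: "chord x / 2 \<le> ?m" by simp
      have m0: "?m > 0" using l c by linarith
      have "ln (chord x / 2) \<le> ln ?m" using l c m0 by (subst ln_le_cancel_iff) auto
      then have "ln (chord x) - ln 2 \<le> ln ?m" using c by (simp add: ln_div)
      moreover have "ln ?m \<le> ln 2" using u m0 by (subst ln_le_cancel_iff) auto
      ultimately show ?case using ln_gt_zero[of 2] by (simp only: real_norm_def)
    qed
  qed (auto intro!: integrable_ln_chord Bochner_Integration.integrable_add integrable_abs
      borel_measurable_J J.integrable_const
      borel_measurable_ln borel_measurable_norm borel_measurable_continuous_onI continuous_intros)
  then show ?thesis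
    using integral_ln_cmod \<rho> by (simp add: LIMSEQ_const_iff abs_of_nonneg)
qed

section \<open>A strong law for monotone sums\<close>

lemma AE_tendsto_zero_if_summable_second_moments:
  fixes D :: "nat \<Rightarrow> 'a \<Rightarrow> real"
  assumes i: "\<And>j. integrable M (\<lambda>\<omega>. (D j \<omega>)\<^sup>2)"
    and s: "summable (\<lambda>j. \<integral>\<omega>. (D j \<omega>)\<^sup>2 \<partial>M)"
  shows "AE \<omega> in M. (\<lambda>j. D j \<omega>) \<longlonglongrightarrow> 0"
proof -
  have [measurable]: "(\<lambda>\<omega>. (D j \<omega>)\<^sup>2) \<in> borel_measurable M" for j
    using i by (rule borel_measurable_integrable)
  have "(\<integral>\<^sup>+\<omega>. (\<Sum>j. ennreal ((D j \<omega>)\<^sup>2)) \<partial>M) = (\<Sum>j. \<integral>\<^sup>+\<omega>. ennreal ((D j \<omega>)\<^sup>2) \<partial>M)"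
    by (rule nn_integral_suminf) measurable
  also have "\<dots> = (\<Sum>j. ennreal (\<integral>\<omega>. (D j \<omega>)\<^sup>2 \<partial>M))"
    by (intro arg_cong[where f = suminf] ext nn_integral_eq_integral i) auto
  also have "\<dots> \<noteq> \<infinity>"
    using s by (simp add: ennreal_suminf_neq_top)
  finally have "AE \<omega> in M. (\<Sum>j. ennreal ((D j \<omega>)\<^sup>2)) \<noteq> \<infinity>"
    by (intro nn_integral_PInf_AE) auto
  then show ?thesis
  proof eventually_elim
    case (elim \<omega>)
    then have "summable (\<lambda>j. (D j \<omega>)\<^sup>2)"
      by (intro summable_suminf_not_top) auto
    then have "(\<lambda>j. (D j \<omega>)\<^sup>2) \<longlonglongrightarrow> 0" by (rule summable_LIMSEQ_zero)
    from tendsto_real_sqrt[OF this] show ?case by (simp add: tendsto_rabs_zero_iff)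
  qed
qed

text \<open>
Between \<open>j ^ p\<close> and \<open>(j + 1) ^ p\<close> a monotone sequence is squeezed by its values at the ends, and
the ratio of the two normalizations tends to \<open>1\<close>.
\<close>

lemma LIMSEQ_interpolate_powers:
  fixes S :: "nat \<Rightarrow> real"
  assumes mono: "mono S" and nn: "\<And>n. 0 \<le> S n" and p: "0 < p"
    and lim: "(\<lambda>j. S (j ^ p) / real j ^ (2 * p)) \<longlonglongrightarrow> w"
  shows "(\<lambda>N. S N / (real N)\<^sup>2) \<longlonglongrightarrow> w"
proof -
  define j where "j N = nat \<lfloor>root p (real N)\<rfloor>" for N
  have jr: "real (j N) \<le> root p (real N)" "root p (real N) < real (j N + 1)" for N
    unfolding j_def by (simp_all add: real_root_ge_zero) linarith
  have jN: "j N ^ p \<le> N" for N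
  proof -
    have "real (j N) ^ p \<le> root p (real N) ^ p"
      using jr by (intro power_mono) auto
    then show ?thesis using p by (simp flip: of_nat_power)
  qed
  have Nj: "N < (j N + 1) ^ p" for N
  proof -
    have "root p (real N) ^ p < real (j N + 1) ^ p"
      using jr p by (intro power_strict_mono) (auto simp: real_root_ge_zero)
    then show ?thesis using p by (simp flip: of_nat_power del: of_nat_add of_nat_Suc)
  qed
  have jlim: "filterlim j at_top at_top"
  proof -
    have "filterlim (\<lambda>N. j N) sequentially sequentially"
      unfolding filterlim_at_top
    proof (intro allI)
      fix Z :: nat
      show "\<forall>\<^sub>F N in sequentially. Z \<le> j N"
        using eventually_ge_at_top[of "(Z + 1) ^ p"]
      proof eventually_elim
        case (elim N)
        then have "(Z + 1) ^ p < (j N + 1) ^ p" using Nj[of N] by linarith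
        then show ?case by (metis power_less_imp_less_base zero_le add_less_cancel_right less_imp_le)
      qed
    qed
    then show ?thesis .
  qed
  define a where "a k = S (k ^ p) / real k ^ (2 * p)" for k
  have "(\<lambda>k. a k * (real k / real (k + 1)) ^ (2 * p)) \<longlonglongrightarrow> w * 1 ^ (2 * p)"
    unfolding a_def by (intro tendsto_mult lim tendsto_power) real_asymp
  then have lo: "(\<lambda>N. a (j N) * (real (j N) / real (j N + 1)) ^ (2 * p)) \<longlonglongrightarrow> w"
    using filterlim_compose[OF _ jlim] by simp
  have "(\<lambda>k. a (k + 1) * (real (k + 1) / real k) ^ (2 * p)) \<longlonglongrightarrow> w * 1 ^ (2 * p)"
    unfolding a_def by (intro tendsto_mult tendsto_power LIMSEQ_ignore_initial_segment[OF lim])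
        real_asymp
  then have hi: "(\<lambda>N. a (j N + 1) * (real (j N + 1) / real (j N)) ^ (2 * p)) \<longlonglongrightarrow> w"
    using filterlim_compose[OF _ jlim] by simp
  have j1: "\<forall>\<^sub>F N in sequentially. 1 \<le> j N"
    using jlim by (simp add: filterlim_at_top)
  have Np: "real (j N) ^ (2 * p) \<le> (real N)\<^sup>2 \<and> (real N)\<^sup>2 \<le> real (j N + 1) ^ (2 * p)" for N
  proof -
    have "(real (j N ^ p))\<^sup>2 \<le> (real N)\<^sup>2" using jN by (intro power_mono) auto
    moreover have "(real N)\<^sup>2 \<le> (real ((j N + 1) ^ p))\<^sup>2" using Nj[of N] by (intro power_mono) linarith+
    ultimately show ?thesis by (simp add: power_mult[symmetric] mult.commute)
  qed
  show ?thesis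
  proof (rule tendsto_sandwich[OF _ _ lo hi])
    show "\<forall>\<^sub>F N in sequentially. a (j N) * (real (j N) / real (j N + 1)) ^ (2 * p) \<le> S N / (real N)\<^sup>2"
      using j1 eventually_ge_at_top[of 1]
    proof eventually_elim
      case (elim N)
      have "a (j N) * (real (j N) / real (j N + 1)) ^ (2 * p) = S (j N ^ p) / real (j N + 1) ^ (2 * p)"
        using elim by (simp add: a_def power_divide)
      also have "\<dots> \<le> S N / (real N)\<^sup>2"
        using Np[of N] elim nn by (intro frac_le monoD[OF mono] jN) auto
      finally show ?case .
    qed
    show "\<forall>\<^sub>F N in sequentially. S N / (real N)\<^sup>2 \<le> a (j N + 1) * (real (j N + 1) / real (j N)) ^
        (2 * p)"
      using j1 eventually_ge_at_top[of 1]
    proof eventually_elim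
      case (elim N)
      have "S N / (real N)\<^sup>2 \<le> S ((j N + 1) ^ p) / real (j N) ^ (2 * p)"
        using Np[of N] elim nn less_imp_le[OF Nj[of N]] by (intro frac_le monoD[OF mono]) auto
      also have "\<dots> = a (j N + 1) * (real (j N + 1) / real (j N)) ^ (2 * p)"
        using elim by (simp add: a_def power_divide)
      finally show ?case .
    qed
  qed
qed

text \<open>
Along \<open>N = j ^ p\<close> with \<open>p \<ge> 2 / \<eta>\<close> the second moments of the normalized errors are of order
\<open>j powr (-2)\<close>, hence summable; monotonicity fills the gaps. The free
exponent \<open>p\<close> is what adapts the argument to slow decay of the variances, as under long memory.
\<close>

lemma strong_law_monotone:
  fixes S :: "nat \<Rightarrow> 'a \<Rightarrow> real"
  assumes mono: "\<And>\<omega>. \<omega> \<in> space M \<Longrightarrow> mono (\<lambda>N. S N \<omega>)"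
    and nn: "\<And>N \<omega>. \<omega> \<in> space M \<Longrightarrow> 0 \<le> S N \<omega>"
    and int: "\<And>N. integrable M (\<lambda>\<omega>. (S N \<omega> - e N)\<^sup>2)"
    and e: "(\<lambda>N. e N / (real N)\<^sup>2) \<longlonglongrightarrow> w"
    and \<eta>: "0 < \<eta>"
    and var: "\<And>N. 1 \<le> N \<Longrightarrow> (\<integral>\<omega>. (S N \<omega> - e N)\<^sup>2 \<partial>M) \<le> C * real N powr (4 - \<eta>)"
  shows "AE \<omega> in M. (\<lambda>N. S N \<omega> / (real N)\<^sup>2) \<longlonglongrightarrow> w"
proof -
  define p where "p = nat \<lceil>2 / \<eta>\<rceil>"
  have p: "0 < p" using \<eta> by (simp add: p_def)
  have "2 / \<eta> \<le> real p" unfolding p_def by (rule real_nat_ceiling_ge)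
  then have p\<eta>: "2 \<le> real p * \<eta>" using \<eta> by (simp add: field_simps)
  have C: "0 \<le> C"
    using order_trans[OF _ var[of 1]] by (auto intro: integral_nonneg_AE)
  define D where "D j \<omega> = (S (j ^ p) \<omega> - e (j ^ p)) / real j ^ (2 * p)" for j \<omega>
  have "AE \<omega> in M. (\<lambda>j. D j \<omega>) \<longlonglongrightarrow> 0"
  proof (rule AE_tendsto_zero_if_summable_second_moments)
    show "integrable M (\<lambda>\<omega>. (D j \<omega>)\<^sup>2)" for j
      unfolding D_def power_divide by (intro integrable_divide int)
    show "summable (\<lambda>j. \<integral>\<omega>. (D j \<omega>)\<^sup>2 \<partial>M)"
    proof (rule summable_comparison_test')
      show "summable (\<lambda>j. C * real j powr (-2))"
        by (intro summable_mult) (simp add: summable_real_powr_iff)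
      fix j :: nat assume j: "1 \<le> j"
      have "(\<integral>\<omega>. (D j \<omega>)\<^sup>2 \<partial>M) = (\<integral>\<omega>. (S (j ^ p) \<omega> - e (j ^ p))\<^sup>2 \<partial>M) / (real j ^ (2 * p))\<^sup>2"
        unfolding D_def power_divide by simp
      also have "\<dots> \<le> C * real (j ^ p) powr (4 - \<eta>) / (real j ^ (2 * p))\<^sup>2"
        using j by (intro divide_right_mono var) auto
      also have "\<dots> = C * (real j powr (real p * (4 - \<eta>)) / real j powr (real p * 4))"
        using j by (simp add: powr_powr powr_realpow[symmetric] mult_ac)
      also have "\<dots> = C * real j powr (- (real p * \<eta>))"
        by (simp add: powr_diff[symmetric] algebra_simps)
      also have "\<dots> \<le> C * real j powr (-2)"
        using j p\<eta> C by (intro mult_left_mono powr_mono) auto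
      finally show "norm (\<integral>\<omega>. (D j \<omega>)\<^sup>2 \<partial>M) \<le> C * real j powr (-2)"
        by simp
    qed
  qed
  then show ?thesis using AE_space
  proof eventually_elim
    case (elim \<omega>)
    have "filterlim (\<lambda>j::nat. j ^ p) at_top at_top"
      using p by (intro filterlim_at_top_mono[OF filterlim_ident] eventually_mono[OF
          eventually_ge_at_top[of 1]] self_le_power) auto 
    from filterlim_compose[OF e this]
    have "(\<lambda>j. D j \<omega> + e (j ^ p) / (real (j ^ p))\<^sup>2) \<longlonglongrightarrow> 0 + w"
      by (intro tendsto_add elim)
    also have "(\<lambda>j. D j \<omega> + e (j ^ p) / (real (j ^ p))\<^sup>2) = (\<lambda>j. S (j ^ p) \<omega> / real j ^ (2 * p))"
      by (simp add: D_def fun_eq_iff power_mult[symmetric] mult.commute diff_divide_distrib)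
    finally show ?case
      using elim by (intro LIMSEQ_interpolate_powers[OF mono nn p]) auto
  qed
qed

section \<open>Mean square decay of the autocovariances\<close>

abbreviation grid :: "nat \<Rightarrow> (int \<times> int) set" where
  "grid N \<equiv> {1..int N} \<times> {1..int N}"

text \<open>
The squared covariances need not be summable, but their averages over the grid decay polynomially.
Split the density at chord length \<open>\<delta>\<close>. Near the axes a small power of \<open>\<delta>\<close> can be traded for
a slightly stronger, still integrable singularity, so these Fourier coefficients are
uniformly \<open>O(\<delta> powr \<eta>)\<close>. Away from the axes the density is at most \<open>K / \<delta>\<^sup>2\<close>, and Bessel's
inequality bounds the sum over \<open>u\<close> for each \<open>v\<close>. The choice \<open>\<delta> = N powr (-1/2)\<close> makes the second
contribution \<open>N\<^sup>3\<close>.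
\<close>

lemma spectral_l2_rate:
  fixes f :: "real \<times> real \<Rightarrow> real" and \<gamma> :: "int \<times> int \<Rightarrow> real"
  assumes f: "integrable T f" and d: "0 < d1" "d1 < 1/2" "0 < d2" "d2 < 1/2" and K: "0 < K"
    and f0: "\<And>p. 0 \<le> f p"
    and fK: "\<And>p. f p \<le> K * (chord (fst p) powr (- 2 * d1) * chord (snd p) powr (- 2 * d2))"
    and \<gamma>: "\<And>h. of_real (\<gamma> h) = integral\<^sup>L T (\<lambda>p. chi h p * of_real (f p))"
  shows "\<exists>C \<eta>. 0 < \<eta> \<and> (\<forall>N\<ge>1. \<forall>h. (\<Sum>u\<in>grid N. \<Sum>v\<in>grid N. (\<gamma> (u - v + h))\<^sup>2) \<le> C * real N powr (4 - \<eta>))"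
proof -
  \<comment> \<open>Half of the room that the exponents leave below the integrability bound \<open>1\<close>.\<close>
  define \<eta> where "\<eta> = min (1 - 2 * d1) (1 - 2 * d2) / 2"
  have \<eta>: "0 < \<eta>" "\<eta> \<le> 1" "2 * d1 + \<eta> < 1" "2 * d2 + \<eta> < 1"
    using d by (auto simp: \<eta>_def min_def field_simps)
  define H where "H p = K * (chord (fst p) powr (- 2 * d1 - \<eta>) * chord (snd p) powr (- 2 * d2)
      + chord (fst p) powr (- 2 * d1) * chord (snd p) powr (- 2 * d2 - \<eta>))" for p
  have iH: "integrable T H"
    unfolding H_def
    by (intro integrable_mult_right Bochner_Integration.integrable_add integrable_T_product
        integrable_chord_powr)
       (use d \<eta> in auto)
  have H0: "0 \<le> H p" for p using K by (auto simp: H_def)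
  define K1 where "K1 = integral\<^sup>L T H"
  define G where "G = integral\<^sup>L T f"
  have G0: "0 \<le> G" unfolding G_def by (intro integral_nonneg_AE AE_I2 f0)
  have K10: "0 \<le> K1" unfolding K1_def by (intro integral_nonneg_AE AE_I2 H0)
  have [measurable]: "f \<in> borel_measurable T" using f by (rule borel_measurable_integrable)
  have [measurable]: "chi h \<in> borel_measurable T" for h by (rule borel_measurable_T) measurable
  define C where "C = 2 * K1\<^sup>2 + 8 * pi\<^sup>2 * K * G"
  have main: "(\<Sum>u\<in>grid N. \<Sum>v\<in>grid N. (\<gamma> (u - v + h))\<^sup>2) \<le> C * real N powr (4 - \<eta>)"
    if N: "1 \<le> N" for N h
  proof -
    define \<delta> where "\<delta> = real N powr (-1/2)"
    have \<delta>: "0 < \<delta>" "\<delta> \<le> 1"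
      using N powr_mono2'[of "-1/2" 1 "real N"] by (auto simp: \<delta>_def)
    define A where "A = {p. chord (fst p) \<le> \<delta> \<or> chord (snd p) \<le> \<delta>}"
    have A_b: "A \<in> sets borel"
      unfolding A_def by (intro borel_closed closed_Collect_disj closed_Collect_le continuous_intros
        continuous_on_compose2[OF continuous_chord[of UNIV]]) auto
    have [measurable]: "(indicator A :: _ \<Rightarrow> real) \<in> borel_measurable T"
      by (intro borel_measurable_T borel_measurable_indicator A_b)
    define fa where "fa p = indicator A p * f p" for p
    define fb where "fb p = (1 - indicator A p) * f p" for p
    have [measurable]: "fa \<in> borel_measurable T" "fb \<in> borel_measurable T"
      unfolding fa_def fb_def by measurable
    have fa0: "0 \<le> fa p" "fa p \<le> f p" and fb0: "0 \<le> fb p" "fb p \<le> f p" and fab: "f p = fa p + fb p" for p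
      using f0[of p] by (auto simp: fa_def fb_def indicator_def)
    have fa_i: "integrable T fa" and fb_i: "integrable T fb"
      by (rule Bochner_Integration.integrable_bound[OF f]; use fa0 fb0 in \<open>auto intro!: AE_I2
          simp: abs_le_iff\<close>;
          smt (verit) fa0 fb0 f0)+
    have small: "c powr (- 2 * d) \<le> \<delta> powr \<eta> * c powr (- 2 * d - \<eta>)" if "0 \<le> c" "c \<le> \<delta>" for c d :: real
    proof (cases "c = 0")
      case False
      have "c powr (- 2 * d) = c powr \<eta> * c powr (- 2 * d - \<eta>)"
        by (simp add: powr_add[symmetric])
      also have "\<dots> \<le> \<delta> powr \<eta> * c powr (- 2 * d - \<eta>)"
        using that \<eta> by (intro mult_right_mono powr_mono2) auto
      finally show ?thesis .
    qed simp
    have fa_H: "fa p \<le> \<delta> powr \<eta> * H p" for p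
    proof (cases "p \<in> A")
      case True
      let ?x = "chord (fst p)" and ?y = "chord (snd p)"
      consider "?x \<le> \<delta>" | "?y \<le> \<delta>" using True by (auto simp: A_def)
      then have "?x powr (- 2 * d1) * ?y powr (- 2 * d2)
          \<le> \<delta> powr \<eta> * (?x powr (- 2 * d1 - \<eta>) * ?y powr (- 2 * d2))
          + \<delta> powr \<eta> * (?x powr (- 2 * d1) * ?y powr (- 2 * d2 - \<eta>))"
      proof cases
        case 1
        have "?x powr (- 2 * d1) * ?y powr (- 2 * d2)
            \<le> (\<delta> powr \<eta> * ?x powr (- 2 * d1 - \<eta>)) * ?y powr (- 2 * d2)"
          by (intro mult_right_mono small 1) auto
        then show ?thesis by (simp add: mult_ac add_increasing2)
      next
        case 2
        have "?x powr (- 2 * d1) * ?y powr (- 2 * d2)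
            \<le> ?x powr (- 2 * d1) * (\<delta> powr \<eta> * ?y powr (- 2 * d2 - \<eta>))"
          by (intro mult_left_mono small 2) auto
        then show ?thesis by (simp add: mult_ac add_increasing)
      qed
      then have "K * (?x powr (- 2 * d1) * ?y powr (- 2 * d2)) \<le> \<delta> powr \<eta> * H p"
        using mult_left_mono[of _ _ K] K by (fastforce simp: H_def algebra_simps)
      then show ?thesis using True fK[of p] by (auto simp: fa_def)
    qed (auto simp: fa_def H0)
    have fb_K: "fb p \<le> K / \<delta>\<^sup>2" for p
    proof (cases "p \<in> A")
      case False
      have big: "c powr (- 2 * d) \<le> 1 / \<delta>" if "\<delta> < c" "0 < d" "d < 1/2" for c d :: real
      proof -
        have "c powr (- 2 * d) \<le> \<delta> powr (- 2 * d)"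
          using that \<delta> by (intro powr_mono2') auto
        also have "\<dots> \<le> \<delta> powr (- 1)"
          using that \<delta> by (intro powr_mono') auto
        finally show ?thesis using \<delta> by (simp add: powr_minus inverse_eq_divide)
      qed
      have "chord (fst p) powr (- 2 * d1) * chord (snd p) powr (- 2 * d2) \<le> 1 / \<delta> * (1 / \<delta>)"
        using False d \<delta> by (intro mult_mono big) (auto simp: A_def)
      then have "K * (chord (fst p) powr (- 2 * d1) * chord (snd p) powr (- 2 * d2))
          \<le> K * (1 / \<delta> * (1 / \<delta>))"
        using K by (intro mult_left_mono) auto
      then show ?thesis using fK[of p] False by (simp add: fb_def power2_eq_square)
    qed (use K \<delta> in \<open>auto simp: fb_def\<close>)
    have fb2: "(fb p)\<^sup>2 \<le> K / \<delta>\<^sup>2 * f p" for p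
      using mult_mono[OF fb_K[of p] fb0(2)[of p]] fb0(1)[of p] K by (simp add: power2_eq_square)
    have fb2_i: "integrable T (\<lambda>p. (fb p)\<^sup>2)"
      by (rule Bochner_Integration.integrable_bound[OF integrable_mult_right[OF f, of "K / \<delta>\<^sup>2"]])
         (use fb2 f0 K \<delta> in \<open>auto intro!: AE_I2 simp: abs_of_nonneg\<close>)
    have fb2_G: "integral\<^sup>L T (\<lambda>p. (fb p)\<^sup>2) \<le> K / \<delta>\<^sup>2 * G"
    proof -
      have "integral\<^sup>L T (\<lambda>p. (fb p)\<^sup>2) \<le> integral\<^sup>L T (\<lambda>p. K / \<delta>\<^sup>2 * f p)"
        by (intro integral_mono fb2_i integrable_mult_right f fb2)
      then show ?thesis by (simp add: G_def)
    qed
    define a where "a h = integral\<^sup>L T (\<lambda>p. chi h p * of_real (fa p))" for h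
    define b where "b h = integral\<^sup>L T (\<lambda>p. chi h p * of_real (fb p))" for h
    have ci: "integrable T (\<lambda>p. chi h p * of_real (g p))" if "integrable T g" for h g
      by (rule Bochner_Integration.integrable_bound[OF that]) 
         (use borel_measurable_integrable[OF that] in \<open>auto simp: norm_mult\<close>)
    have \<gamma>ab: "of_real (\<gamma> h) = a h + b h" for h
      unfolding \<gamma> a_def b_def fab by (simp add: distrib_left ci fa_i fb_i)
    have a_le: "cmod (a h) \<le> \<delta> powr \<eta> * K1" for h
    proof -
      have "cmod (a h) \<le> integral\<^sup>L T (\<lambda>p. cmod (chi h p * of_real (fa p)))"
        unfolding a_def by (rule integral_norm_bound)
      also have "\<dots> \<le> integral\<^sup>L T (\<lambda>p. \<delta> powr \<eta> * H p)"
        by (intro integral_mono integrable_norm ci fa_i integrable_mult_right iH)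
            (use fa_H fa0 in \<open>auto simp: norm_mult\<close>)
      finally show ?thesis by (simp add: K1_def)
    qed
    have b_le: "(\<Sum>u\<in>grid N. (cmod (b (u - v + h)))\<^sup>2) \<le> 4 * pi\<^sup>2 * (K / \<delta>\<^sup>2 * G)" for v
    proof -
      have "(\<Sum>u\<in>grid N. (cmod (b (u - v + h)))\<^sup>2) = (\<Sum>k\<in>(\<lambda>u. u - v + h) ` grid N. (cmod (b k))\<^sup>2)"
        by (subst sum.reindex) (auto simp: inj_on_def)
      also have "\<dots> \<le> 4 * pi\<^sup>2 * integral\<^sup>L T (\<lambda>p. (fb p)\<^sup>2)"
        unfolding b_def by (intro Bessel_T fb_i fb2_i) auto
      also have "\<dots> \<le> 4 * pi\<^sup>2 * (K / \<delta>\<^sup>2 * G)"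
        by (intro mult_left_mono fb2_G) auto
      finally show ?thesis .
    qed
    have \<gamma>2: "(\<gamma> h)\<^sup>2 \<le> 2 * (\<delta> powr \<eta> * K1)\<^sup>2 + 2 * (cmod (b h))\<^sup>2" for h
    proof -
      have "\<bar>\<gamma> h\<bar> \<le> cmod (a h) + cmod (b h)"
        using norm_triangle_ineq[of "a h" "b h"] unfolding \<gamma>ab[symmetric] by simp
      then have "(\<gamma> h)\<^sup>2 \<le> (cmod (a h) + cmod (b h))\<^sup>2"
        by (metis abs_ge_zero power2_abs power_mono)
      also have "\<dots> \<le> 2 * (cmod (a h))\<^sup>2 + 2 * (cmod (b h))\<^sup>2"
        by (smt (verit) sum_squares_bound power2_sum)
      also have "(cmod (a h))\<^sup>2 \<le> (\<delta> powr \<eta> * K1)\<^sup>2"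
        by (intro power_mono a_le) auto
      finally show ?thesis by simp
    qed
    have cb: "card (grid N) = N\<^sup>2" by (simp add: card_cartesian_product power2_eq_square)
    have "(\<Sum>u\<in>grid N. \<Sum>v\<in>grid N. (\<gamma> (u - v + h))\<^sup>2)
        \<le> (\<Sum>u\<in>grid N. \<Sum>v\<in>grid N. 2 * (\<delta> powr \<eta> * K1)\<^sup>2 + 2 * (cmod (b (u - v + h)))\<^sup>2)"
      by (intro sum_mono \<gamma>2)
    also have "\<dots> = 2 * (\<delta> powr \<eta> * K1)\<^sup>2 * real N ^ 4 + 2 * (\<Sum>v\<in>grid N. \<Sum>u\<in>grid N. (cmod (b (u - v
        + h)))\<^sup>2)"
      by (subst (2) sum.swap) (simp add: sum.distrib cb sum_distrib_left power4_eq_xxxx power2_eq_square)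
    also have "(\<Sum>v\<in>grid N. \<Sum>u\<in>grid N. (cmod (b (u - v + h)))\<^sup>2) \<le> (\<Sum>v\<in>grid N. 4 * pi\<^sup>2 * (K / \<delta>\<^sup>2 * G))"
      by (intro sum_mono b_le)
    also have "\<dots> = (real N)\<^sup>2 * (4 * pi\<^sup>2 * (K / \<delta>\<^sup>2 * G))"
      by (simp only: sum_constant cb) simp
    also have "2 * (\<delta> powr \<eta> * K1)\<^sup>2 * real N ^ 4 = 2 * K1\<^sup>2 * real N powr (4 - \<eta>)"
    proof -
      have "(\<delta> powr \<eta>)\<^sup>2 * real N ^ 4 = real N powr (- \<eta>) * real N powr 4"
        using N by (simp add: \<delta>_def powr_powr power2_eq_square powr_add[symmetric])
      also have "\<dots> = real N powr (4 - \<eta>)" by (simp only: powr_add[symmetric]) simp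
      finally show ?thesis by (simp add: power_mult_distrib mult_ac)
    qed
    also have "(real N)\<^sup>2 * (4 * pi\<^sup>2 * (K / \<delta>\<^sup>2 * G)) = 4 * pi\<^sup>2 * K * G * real N powr 3"
    proof -
      have "\<delta>\<^sup>2 = 1 / real N" using N
        by (simp add: \<delta>_def power2_eq_square powr_add[symmetric] powr_minus inverse_eq_divide)
      then show ?thesis using N by (simp add: power2_eq_square power3_eq_cube)
    qed
    also have "4 * pi\<^sup>2 * K * G * real N powr 3 \<le> 4 * pi\<^sup>2 * K * G * real N powr (4 - \<eta>)"
      using N \<eta> K G0 by (intro mult_left_mono powr_mono) auto
    finally show ?thesis by (simp add: C_def algebra_simps)
  qed
  show ?thesis using main \<eta>(1) by blast
qed

section \<open>Fourth moments of Gaussian families\<close>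

text \<open>
The only consequence of Gaussianity that is used later. It holds trivially for the almost surely
constant variables that count as Gaussian.
\<close>

lemma (in prob_space) gaussian_fourth_moment:
  assumes "gaussian_rv M U"
  defines "m \<equiv> expectation U"
  shows "integrable M (\<lambda>\<omega>. (U \<omega> - m) ^ 4)"
    and "expectation (\<lambda>\<omega>. (U \<omega> - m) ^ 4) = 3 * (expectation (\<lambda>\<omega>. (U \<omega> - m)\<^sup>2))\<^sup>2"
proof -
  have "integrable M (\<lambda>\<omega>. (U \<omega> - m) ^ 4) \<and>
     expectation (\<lambda>\<omega>. (U \<omega> - m) ^ 4) = 3 * (expectation (\<lambda>\<omega>. (U \<omega> - m)\<^sup>2))\<^sup>2"
    using assms(1) unfolding gaussian_rv_def
  proof (elim disjE exE conjE)
    fix \<mu> s :: real assume s: "0 < s" and D: "distributed M lborel U (normal_density \<mu> s)"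
    have m: "m = \<mu>" unfolding m_def by (rule normal_distributed_expectation[OF s D])
    have nn: "\<And>x. x \<in> space lborel \<Longrightarrow> 0 \<le> normal_density \<mu> s x" by simp
    have i: "integrable M (\<lambda>\<omega>. (U \<omega> - m) ^ 4)"
      using distributed_integrable[OF D _ nn, of "\<lambda>x.
          (x - \<mu>) ^ 4"] integrable_normal_moment[OF s, of \<mu> 4] by (simp add: m)
    have e: "expectation (\<lambda>\<omega>. (U \<omega> - m) ^ (2 * k)) = fact (2 * k) / ((2 / s\<^sup>2) ^ k * fact k)" for k
      using distributed_integral[OF D _ nn, of "\<lambda>x. (x - \<mu>) ^
          (2 * k)"] integral_normal_moment_even[OF s, of \<mu> k]
      by (simp add: m)
    show ?thesis using i e[of 1] e[of 2] s
      by (simp add: fact_numeral power_divide power2_eq_square power4_eq_xxxx)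
  next
    fix c assume [measurable]: "U \<in> borel_measurable M" and c: "AE \<omega> in M. U \<omega> = c"
    have "m = expectation (\<lambda>_. c)" unfolding m_def by (intro integral_cong_AE) (use c in auto)
    then have m: "m = c" by (simp add: prob_space)
    have z: "AE \<omega> in M. (U \<omega> - m) ^ k = 0" if "0 < k" for k 
      by (rule eventually_mono[OF c]) (use that in \<open>simp add: m\<close>)
    have "expectation (\<lambda>\<omega>. (U \<omega> - m) ^ k) = 0" if "0 < k" for k
      using integral_cong_AE[of "\<lambda>\<omega>. (U \<omega> - m) ^ k" M "\<lambda>_. 0"] z[OF that] by simp
    moreover have "integrable M (\<lambda>\<omega>. (U \<omega> - m) ^ 4)"
      using integrable_cong_AE[of "\<lambda>\<omega>. (U \<omega> - m) ^ 4" M "\<lambda>_. 0"] z[of 4] by simp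
    ultimately show ?thesis by simp
  qed
  then show "integrable M (\<lambda>\<omega>. (U \<omega> - m) ^ 4)"
    and "expectation (\<lambda>\<omega>. (U \<omega> - m) ^ 4) = 3 * (expectation (\<lambda>\<omega>. (U \<omega> - m)\<^sup>2))\<^sup>2" by auto
qed

definition lincomb :: "('i \<Rightarrow> 'a \<Rightarrow> real) \<Rightarrow> ('a \<Rightarrow> real) \<Rightarrow> bool" where
  "lincomb Y U \<longleftrightarrow> (\<exists>F c. finite F \<and> U = (\<lambda>\<omega>. \<Sum>u\<in>F. c u * Y u \<omega>))"

lemma lincomb_base: "lincomb Y (Y u)"
  unfolding lincomb_def by (intro exI[of _ "{u}"] exI[of _ "\<lambda>_. 1"]) auto

lemma lincomb_scale: "lincomb Y U \<Longrightarrow> lincomb Y (\<lambda>\<omega>. a * U \<omega>)"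
  unfolding lincomb_def
proof (elim exE conjE)
  fix F c assume "finite F" "U = (\<lambda>\<omega>. \<Sum>u\<in>F. c u * Y u \<omega>)"
  then show "\<exists>F c. finite F \<and> (\<lambda>\<omega>. a * U \<omega>) = (\<lambda>\<omega>. \<Sum>u\<in>F. c u * Y u \<omega>)"
    by (intro exI[of _ F] exI[of _ "\<lambda>u. a * c u"]) (auto simp: sum_distrib_left mult.assoc)
qed

lemma lincomb_add:
  assumes "lincomb Y U" "lincomb Y V" shows "lincomb Y (\<lambda>\<omega>. U \<omega> + V \<omega>)"
proof -
  obtain F c where F: "finite F" "U = (\<lambda>\<omega>. \<Sum>u\<in>F. c u * Y u \<omega>)" using assms(1)
      unfolding lincomb_def by blast
  obtain G d where G: "finite G" "V = (\<lambda>\<omega>. \<Sum>u\<in>G. d u * Y u \<omega>)" using assms(2)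
      unfolding lincomb_def by blast
  have "U \<omega> + V \<omega> = (\<Sum>u\<in>F \<union> G. ((if u \<in> F then c u else 0) + (if u \<in> G then d u else 0)) * Y u \<omega>)" for \<omega>
  proof -
    have "U \<omega> = (\<Sum>u\<in>F \<union> G. (if u \<in> F then c u else 0) * Y u \<omega>)"
      unfolding F(2) using F(1) G(1) by (intro sum.mono_neutral_cong_left) auto
    moreover have "V \<omega> = (\<Sum>u\<in>F \<union> G. (if u \<in> G then d u else 0) * Y u \<omega>)"
      unfolding G(2) using F(1) G(1) by (intro sum.mono_neutral_cong_left) auto
    ultimately show ?thesis by (simp add: sum.distrib[symmetric] distrib_right)
  qed
  then show ?thesis unfolding lincomb_def
    using F(1) G(1) by (intro exI[of _ "F \<union> G"] exI conjI) auto
qed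

text \<open>
Gaussianity enters only through the fourth moment identity for all linear combinations; by
polarization this already determines the mixed moments that occur in variances of sums of squares.
\<close>

locale centred_gaussian = prob_space M for M :: "'a measure" +
  fixes Y :: "'i \<Rightarrow> 'a \<Rightarrow> real"
  assumes Y_measurable [measurable]: "\<And>u. Y u \<in> borel_measurable M"
    and fourth: "\<And>U. lincomb Y U \<Longrightarrow> integrable M (\<lambda>\<omega>. U \<omega> ^ 4)"
      "\<And>U. lincomb Y U \<Longrightarrow> expectation (\<lambda>\<omega>. U \<omega> ^ 4) = 3 * (expectation (\<lambda>\<omega>. (U \<omega>)\<^sup>2))\<^sup>2"
begin

lemma lincomb_measurable: "lincomb Y U \<Longrightarrow> U \<in> borel_measurable M"
  unfolding lincomb_def by auto

lemma integrable_square: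
  assumes "lincomb Y U" shows "integrable M (\<lambda>\<omega>. (U \<omega>)\<^sup>2)"
proof (rule Bochner_Integration.integrable_bound)
  show "integrable M (\<lambda>\<omega>. 1 + U \<omega> ^ 4)" by (intro Bochner_Integration.integrable_add fourth assms) auto
  have "x\<^sup>2 \<le> 1 + x ^ 4" for x :: real
  proof -
    have "y \<le> 1 + y\<^sup>2" if "0 \<le> y" for y :: real
      using sum_squares_bound[of y 1] that by simp
    from this[of "x\<^sup>2"] show ?thesis by simp
  qed
  then show "AE \<omega> in M. norm ((U \<omega>)\<^sup>2) \<le> norm (1 + U \<omega> ^ 4)"
      by (auto intro: order_trans[OF _ abs_ge_self])
qed (use lincomb_measurable[OF assms] in measurable)

lemma integrable_lincomb_mult:
  assumes "lincomb Y U" "lincomb Y V" shows "integrable M (\<lambda>\<omega>. U \<omega> * V \<omega>)"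
proof -
  have "integrable M (\<lambda>\<omega>. ((U \<omega> + V \<omega>)\<^sup>2 - (U \<omega>)\<^sup>2 - (V \<omega>)\<^sup>2) / 2)"
    by (intro integrable_divide Bochner_Integration.integrable_diff integrable_square lincomb_add assms)
  then show ?thesis by (simp add: power2_sum)
qed

text \<open>
Polarization: \<open>12 u\<^sup>2 v\<^sup>2 = (u + v)\<^sup>4 + (u - v)\<^sup>4 - 2 u\<^sup>4 - 2 v\<^sup>4\<close>, and the fourth moment of each of
the four linear combinations is three times its squared variance.
\<close>

lemma isserlis:
  assumes U: "lincomb Y U" and V: "lincomb Y V"
  shows "integrable M (\<lambda>\<omega>. (U \<omega>)\<^sup>2 * (V \<omega>)\<^sup>2)"
    and "expectation (\<lambda>\<omega>. (U \<omega>)\<^sup>2 * (V \<omega>)\<^sup>2) = expectation (\<lambda>\<omega>. (U \<omega>)\<^sup>2) * expectation (\<lambda>\<omega>. (V \<omega>)\<^sup>2)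
       + 2 * (expectation (\<lambda>\<omega>. U \<omega> * V \<omega>))\<^sup>2"
proof -
  have P: "lincomb Y (\<lambda>\<omega>. U \<omega> + V \<omega>)" by (intro lincomb_add U V)
  have N: "lincomb Y (\<lambda>\<omega>. U \<omega> - V \<omega>)" using lincomb_add[OF U lincomb_scale[OF V, of "-1"]] by simp
  have e: "(u\<^sup>2 * v\<^sup>2) = ((u + v) ^ 4 + (u - v) ^ 4 - 2 * u ^ 4 - 2 * v ^ 4) / 12" for u v :: real
    by (simp add: field_simps power4_eq_xxxx power2_eq_square)
  have e2: "(u + v)\<^sup>2 = u\<^sup>2 + 2 * (u * v) + v\<^sup>2" "(u - v)\<^sup>2 = u\<^sup>2 - 2 * (u * v) + v\<^sup>2" for u v :: real
    by (simp_all add: power2_sum power2_diff)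
  show "integrable M (\<lambda>\<omega>. (U \<omega>)\<^sup>2 * (V \<omega>)\<^sup>2)"
    unfolding e by (intro integrable_divide Bochner_Integration.integrable_diff
        Bochner_Integration.integrable_add integrable_mult_right fourth U V P N)
  define a b c where "a = expectation (\<lambda>\<omega>. (U \<omega>)\<^sup>2)" and "b = expectation (\<lambda>\<omega>. (V \<omega>)\<^sup>2)"
    and "c = expectation (\<lambda>\<omega>. U \<omega> * V \<omega>)"
  have p: "expectation (\<lambda>\<omega>. (U \<omega> + V \<omega>)\<^sup>2) = a + 2 * c + b" 
    unfolding e2 a_def b_def c_def using U V by (simp add: integrable_square integrable_lincomb_mult)
  have n: "expectation (\<lambda>\<omega>. (U \<omega> - V \<omega>)\<^sup>2) = a - 2 * c + b" 
    unfolding e2 a_def b_def c_def using U V by (simp add: integrable_square integrable_lincomb_mult)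
  have "expectation (\<lambda>\<omega>. (U \<omega>)\<^sup>2 * (V \<omega>)\<^sup>2) = 
    (3 * (a + 2 * c + b)\<^sup>2 + 3 * (a - 2 * c + b)\<^sup>2 - 2 * (3 * a\<^sup>2) - 2 * (3 * b\<^sup>2)) / 12"
    unfolding e using fourth[OF U] fourth[OF V] fourth[OF P] fourth[OF N] 
    by (simp add: p n a_def[symmetric] b_def[symmetric])
  also have "\<dots> = a * b + 2 * c\<^sup>2"
    by (simp add: field_simps power2_eq_square)
  finally show "expectation (\<lambda>\<omega>. (U \<omega>)\<^sup>2 * (V \<omega>)\<^sup>2) = a * b + 2 * c\<^sup>2" .
qed

text \<open>
Without the shift \<open>c\<close> the variance is exactly \<open>2 \<Sum> \<rho>\<^sup>2\<close> by Isserlis' formula. The shift adds the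
linear term \<open>2 c \<Sum> U\<close>; it is present because \<open>(U + 1)\<^sup>2 - U\<^sup>2 - 1 = 2 U\<close> reduces laws of large
numbers for the variables themselves to nonnegative summands.
\<close>

lemma variance_sum_shifted_squares:
  fixes U :: "'k \<Rightarrow> 'a \<Rightarrow> real" and c :: real
  assumes U: "\<And>u. u \<in> R \<Longrightarrow> lincomb Y (U u)"
  defines "S \<equiv> \<lambda>\<omega>. \<Sum>u\<in>R. (U u \<omega> + c)\<^sup>2" and "e \<equiv> \<Sum>u\<in>R. (expectation (\<lambda>\<omega>. (U u \<omega>)\<^sup>2) + c\<^sup>2)"
    and "\<rho> \<equiv> \<lambda>u v. expectation (\<lambda>\<omega>. U u \<omega> * U v \<omega>)"
  shows "integrable M (\<lambda>\<omega>. (S \<omega> - e)\<^sup>2)"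
    and "expectation (\<lambda>\<omega>. (S \<omega> - e)\<^sup>2) \<le> 4 * (\<Sum>u\<in>R. \<Sum>v\<in>R. (\<rho> u v)\<^sup>2) + 8 * c\<^sup>2 * (\<Sum>u\<in>R. \<Sum>v\<in>R. \<rho> u v)"
proof -
  define s where "s u = expectation (\<lambda>\<omega>. (U u \<omega>)\<^sup>2)" for u
  define A where "A \<omega> = (\<Sum>u\<in>R. (U u \<omega>)\<^sup>2 - s u)" for \<omega>
  define B where "B \<omega> = (\<Sum>u\<in>R. U u \<omega>)" for \<omega>
  have mU [measurable]: "u \<in> R \<Longrightarrow> U u \<in> borel_measurable M" for u by (intro lincomb_measurable U)
  have Se: "S \<omega> - e = A \<omega> + 2 * c * B \<omega>" for \<omega>
    unfolding S_def e_def A_def B_def s_def[symmetric]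
    by (simp add: sum_distrib_left sum_subtractf[symmetric] sum.distrib[symmetric])
       (intro sum.cong refl, simp add: power2_sum)
  have A2: "(A \<omega>)\<^sup>2 = (\<Sum>u\<in>R. \<Sum>v\<in>R. (U u \<omega>)\<^sup>2 * (U v \<omega>)\<^sup>2 - s u * (U v \<omega>)\<^sup>2 - s v * (U u \<omega>)\<^sup>2
      + s u * s v)" for \<omega>
    unfolding A_def power2_eq_square[of "sum _ _"] sum_product
    by (intro sum.cong refl) (simp add: algebra_simps)
  have B2: "(B \<omega>)\<^sup>2 = (\<Sum>u\<in>R. \<Sum>v\<in>R. U u \<omega> * U v \<omega>)" for \<omega>
    unfolding B_def power2_eq_square[of "sum _ _"] sum_product ..
  have t: "integrable M (\<lambda>\<omega>. (U u \<omega>)\<^sup>2 * (U v \<omega>)\<^sup>2 - s u * (U v \<omega>)\<^sup>2 - s v * (U u \<omega>)\<^sup>2 + s u * s v)"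
    if "u \<in> R" "v \<in> R" for u v
    by (intro Bochner_Integration.integrable_diff Bochner_Integration.integrable_add
        integrable_mult_right isserlis integrable_square U that) auto
  have iA: "integrable M (\<lambda>\<omega>. (A \<omega>)\<^sup>2)"
    unfolding A2 by (intro Bochner_Integration.integrable_sum t)
  have iB: "integrable M (\<lambda>\<omega>. (B \<omega>)\<^sup>2)"
    unfolding B2 by (intro Bochner_Integration.integrable_sum integrable_lincomb_mult U)
  have EA: "expectation (\<lambda>\<omega>. (A \<omega>)\<^sup>2) = (\<Sum>u\<in>R. \<Sum>v\<in>R. 2 * (\<rho> u v)\<^sup>2)"
  proof -
    have "expectation (\<lambda>\<omega>. (A \<omega>)\<^sup>2) = (\<Sum>u\<in>R. \<Sum>v\<in>R. 
       expectation (\<lambda>\<omega>. (U u \<omega>)\<^sup>2 * (U v \<omega>)\<^sup>2 - s u * (U v \<omega>)\<^sup>2 - s v * (U u \<omega>)\<^sup>2 + s u * s v))"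
      unfolding A2 by (simp add: Bochner_Integration.integral_sum t Bochner_Integration.integrable_sum)
    also have "\<dots> = (\<Sum>u\<in>R. \<Sum>v\<in>R. 2 * (\<rho> u v)\<^sup>2)"
    proof (intro sum.cong refl)
      fix u v assume u: "u \<in> R" and v: "v \<in> R"
      show "expectation (\<lambda>\<omega>. (U u \<omega>)\<^sup>2 * (U v \<omega>)\<^sup>2 - s u * (U v \<omega>)\<^sup>2 - s v * (U u \<omega>)\<^sup>2
          + s u * s v) = 2 * (\<rho> u v)\<^sup>2"
        using isserlis[OF U[OF u] U[OF v]] integrable_square[OF U[OF u]] integrable_square[OF U[OF v]]
        by (simp add: s_def[symmetric] \<rho>_def prob_space)
    qed
    finally show ?thesis .
  qed
  have EB: "expectation (\<lambda>\<omega>. (B \<omega>)\<^sup>2) = (\<Sum>u\<in>R. \<Sum>v\<in>R. \<rho> u v)"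
    unfolding B2 \<rho>_def by (simp add: Bochner_Integration.integral_sum integrable_lincomb_mult U
        Bochner_Integration.integrable_sum)
  have le: "(S \<omega> - e)\<^sup>2 \<le> 2 * (A \<omega>)\<^sup>2 + 8 * c\<^sup>2 * (B \<omega>)\<^sup>2" for \<omega>
    using zero_le_power2[of "A \<omega> - 2 * c * B \<omega>"] unfolding Se 
    by (simp add: power2_sum power2_diff power_mult_distrib)
  have ib: "integrable M (\<lambda>\<omega>. 2 * (A \<omega>)\<^sup>2 + 8 * c\<^sup>2 * (B \<omega>)\<^sup>2)" using iA iB by simp
  have mS [measurable]: "S \<in> borel_measurable M" unfolding S_def by measurable
  show i: "integrable M (\<lambda>\<omega>. (S \<omega> - e)\<^sup>2)"
    by (rule Bochner_Integration.integrable_bound[OF ib])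
        (use le in \<open>auto intro: order_trans[OF _ abs_ge_self]\<close>)
  have "expectation (\<lambda>\<omega>. (S \<omega> - e)\<^sup>2) \<le> expectation (\<lambda>\<omega>. 2 * (A \<omega>)\<^sup>2 + 8 * c\<^sup>2 * (B \<omega>)\<^sup>2)"
    by (intro integral_mono i ib le)
  also have "\<dots> = 4 * (\<Sum>u\<in>R. \<Sum>v\<in>R. (\<rho> u v)\<^sup>2) + 8 * c\<^sup>2 * (\<Sum>u\<in>R. \<Sum>v\<in>R. \<rho> u v)"
    using iA iB by (simp add: EA EB sum_distrib_left)
  finally show "expectation (\<lambda>\<omega>. (S \<omega> - e)\<^sup>2) \<le> 4 * (\<Sum>u\<in>R. \<Sum>v\<in>R. (\<rho> u v)\<^sup>2) + 8 * c\<^sup>2 *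
      (\<Sum>u\<in>R. \<Sum>v\<in>R. \<rho> u v)" .
qed

end

section \<open>Sample autocovariances of a Gaussian random field\<close>

text \<open>
The base points of the pairs at lag \<open>h\<close> inside the grid. They increase with \<open>N\<close>, and summing over
exactly these points avoids any boundary correction in the sample autocovariances.
\<close>

definition overlap :: "nat \<Rightarrow> int \<times> int \<Rightarrow> (int \<times> int) set" where
  "overlap N h = {u \<in> grid N. u + h \<in> grid N}"

lemma overlap_subset: "overlap N h \<subseteq> grid N" by (auto simp: overlap_def)
lemma finite_overlap [simp]: "finite (overlap N h)" by (rule finite_subset[OF overlap_subset]) auto
lemma overlap_0 [simp]: "overlap N 0 = grid N" by (auto simp: overlap_def)
lemma overlap_mono: "N \<le> N' \<Longrightarrow> overlap N h \<subseteq> overlap N' h" by (auto simp: overlap_def)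
lemma card_grid: "card (grid N) = N\<^sup>2" by (simp add: card_cartesian_product power2_eq_square)

lemma card_overlap_limit: "(\<lambda>N. real (card (overlap N h)) / (real N)\<^sup>2) \<longlonglongrightarrow> 1"
proof -
  define a b where "a = \<bar>fst h\<bar>" and "b = \<bar>snd h\<bar>"
  have lower: "(real N - 2 * of_int a) * (real N - 2 * of_int b) \<le> card (overlap N h)" 
    if "nat (2 * a + 2 * b) \<le> N" for N
  proof -
    have "{1 + a..int N - a} \<times> {1 + b..int N - b} \<subseteq> overlap N h"
      by (auto simp: overlap_def a_def b_def plus_prod_def)
    then have "card ({1 + a..int N - a} \<times> {1 + b..int N - b}) \<le> card (overlap N h)"
      by (intro card_mono) auto
    moreover have "real (card ({1 + a..int N - a} \<times> {1 + b..int N - b}))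
        = (real N - 2 * of_int a) * (real N - 2 * of_int b)"
      using that by (simp add: card_cartesian_product a_def b_def)
    ultimately show ?thesis by linarith
  qed
  show ?thesis
  proof (rule tendsto_sandwich)
    show "\<forall>\<^sub>F N in sequentially. (real N - 2 * of_int a) * (real N - 2 * of_int b) / (real N)\<^sup>2
        \<le> real (card (overlap N h)) / (real N)\<^sup>2"
      using eventually_ge_at_top[of "nat (2 * a + 2 * b)"]
          by eventually_elim (intro divide_right_mono lower, auto)
    show "\<forall>\<^sub>F N in sequentially. real (card (overlap N h)) / (real N)\<^sup>2 \<le> 1"
    proof (rule always_eventually, rule allI)
      fix N
      have "card (overlap N h) \<le> card (grid N)" by (intro card_mono overlap_subset) auto
      then show "real (card (overlap N h)) / (real N)\<^sup>2 \<le> 1"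
        unfolding card_grid by (simp add: divide_le_eq flip: of_nat_power)
    qed
    show "(\<lambda>N. (real N - 2 * of_int a) * (real N - 2 * of_int b) / (real N)\<^sup>2) \<longlonglongrightarrow> 1" by real_asymp
  qed auto
qed

text \<open>
A stationary Gaussian field on the planar lattice, together with the polynomial rate at which its
squared covariances average out.
\<close>

locale gaussian_field = centred_gaussian M Y for M :: "'a measure" and Y :: "int \<times> int \<Rightarrow> 'a \<Rightarrow> real" +
  fixes \<gamma> :: "int \<times> int \<Rightarrow> real" and C \<eta> :: real
  assumes cov: "\<And>u v. expectation (\<lambda>\<omega>. Y u \<omega> * Y v \<omega>) = \<gamma> (u - v)"
    and \<eta>: "0 < \<eta>"
    and rate: "\<And>N h. 1 \<le> N \<Longrightarrow> (\<Sum>u\<in>grid N. \<Sum>v\<in>grid N. (\<gamma> (u - v + h))\<^sup>2) \<le> C * real N powr (4 - \<eta>)"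
begin

lemma \<gamma>_uminus: "\<gamma> (- h) = \<gamma> h"
  using cov[of 0 h] cov[of h 0] by (simp add: mult.commute)

text \<open>
The covariances of \<open>U u = Y u + b Y (u + h)\<close> are combinations of three translates of \<open>\<gamma>\<close>, so the
rate for \<open>\<gamma>\<close>, which is uniform in the translation, carries over to \<open>U\<close>. The choice
\<open>b = 0\<close> serves the mean and the mean square, \<open>b = 1\<close> and \<open>b = -1\<close> the products by polarization.
\<close>

lemma strong_law_squares:
  assumes b: "\<bar>b\<bar> \<le> 1"
  shows "AE \<omega> in M. (\<lambda>N. (\<Sum>u\<in>overlap N h. (Y u \<omega> + b * Y (u + h) \<omega> + c)\<^sup>2) / (real N)\<^sup>2)
      \<longlonglongrightarrow> (1 + b\<^sup>2) * \<gamma> 0 + 2 * b * \<gamma> h + c\<^sup>2"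
proof -
  define U where "U u \<omega> = Y u \<omega> + b * Y (u + h) \<omega>" for u \<omega>
  define s where "s = (1 + b\<^sup>2) * \<gamma> 0 + 2 * b * \<gamma> h"
  define \<rho> where "\<rho> u v = expectation (\<lambda>\<omega>. U u \<omega> * U v \<omega>)" for u v
  have U: "lincomb Y (U u)" for u
    unfolding U_def by (intro lincomb_add lincomb_scale lincomb_base)
  have YY: "integrable M (\<lambda>\<omega>. Y u \<omega> * Y v \<omega>)" for u v
    by (intro integrable_lincomb_mult lincomb_base)
  have \<rho>: "\<rho> u v = (1 + b\<^sup>2) * \<gamma> (u - v + 0) + b * \<gamma> (u - v + (- h)) + b * \<gamma> (u - v + h)" for u v
  proof -
    have "U u \<omega> * U v \<omega> = Y u \<omega> * Y v \<omega> + b * (Y u \<omega> * Y (v + h) \<omega>) + b * (Y (u + h) \<omega> * Y v \<omega>)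
        + b\<^sup>2 * (Y (u + h) \<omega> * Y (v + h) \<omega>)" for \<omega>
      by (simp add: U_def algebra_simps power2_eq_square)
    then have "\<rho> u v = \<gamma> (u - v) + b * \<gamma> (u - (v + h)) + b * \<gamma> (u + h - v) + b\<^sup>2 * \<gamma> (u + h - (v + h))"
      unfolding \<rho>_def by (simp add: YY cov)
    moreover have "u - (v + h) = u - v + (- h)" "u + h - v = u - v + h" "u + h - (v + h) = u - v"
        by simp_all
    ultimately show ?thesis by (simp only: add_0_right) (simp add: distrib_right)
  qed
  have Us: "expectation (\<lambda>\<omega>. (U u \<omega>)\<^sup>2) = s" for u
    using \<rho>[of u u] by (simp add: \<rho>_def s_def power2_eq_square \<gamma>_uminus)
  have C0: "0 \<le> C" using order_trans[OF _ rate[of 1 0]] by (auto simp: sum_nonneg)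
  have \<rho>2: "(\<rho> u v)\<^sup>2 \<le> 12 * ((\<gamma> (u - v + 0))\<^sup>2 + (\<gamma> (u - v + (- h)))\<^sup>2 + (\<gamma> (u - v + h))\<^sup>2)" for u v
  proof -
    have b2: "b\<^sup>2 \<le> 1" using b by (simp add: abs_square_le_1)
    have q: "(x + y + z)\<^sup>2 \<le> 3 * (x\<^sup>2 + y\<^sup>2 + z\<^sup>2)" for x y z :: real
    proof -
      have "3 * (x\<^sup>2 + y\<^sup>2 + z\<^sup>2) - (x + y + z)\<^sup>2 = (x - y)\<^sup>2 + (x - z)\<^sup>2 + (y - z)\<^sup>2"
        by (simp add: power2_eq_square algebra_simps)
      then show ?thesis by (smt (verit) zero_le_power2)
    qed
    have p: "(k * x)\<^sup>2 \<le> 4 * x\<^sup>2" if "\<bar>k\<bar> \<le> 2" for k x :: real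
    proof -
      have "k\<^sup>2 \<le> 2\<^sup>2" using that by (metis abs_ge_zero power2_abs power_mono)
      then show ?thesis by (simp add: power_mult_distrib mult_right_mono)
    qed
    have "(\<rho> u v)\<^sup>2 \<le> 3 * (((1 + b\<^sup>2) * \<gamma> (u - v + 0))\<^sup>2 + (b * \<gamma> (u - v + (- h)))\<^sup>2 + (b * \<gamma>
        (u - v + h))\<^sup>2)"
      unfolding \<rho> by (rule q)
    also have "\<dots> \<le> 3 * (4 * (\<gamma> (u - v + 0))\<^sup>2 + 4 * (\<gamma> (u - v + (- h)))\<^sup>2 + 4 * (\<gamma> (u - v + h))\<^sup>2)"
      using b b2 by (intro mult_left_mono add_mono p) auto
    finally show ?thesis by simp
  qed
  have sum\<rho>2: "(\<Sum>u\<in>overlap N h. \<Sum>v\<in>overlap N h. (\<rho> u v)\<^sup>2) \<le> 36 * C * real N powr (4 - \<eta>)"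
      if N: "1 \<le> N" for N
  proof -
    have "(\<Sum>u\<in>overlap N h. \<Sum>v\<in>overlap N h. (\<rho> u v)\<^sup>2) \<le> (\<Sum>u\<in>grid N. \<Sum>v\<in>grid N. (\<rho> u v)\<^sup>2)"
      by (intro order_trans[OF sum_mono[OF sum_mono2] sum_mono2] overlap_subset sum_nonneg) auto
    also have "\<dots> \<le> (\<Sum>u\<in>grid N. \<Sum>v\<in>grid N. 12 * ((\<gamma> (u - v + 0))\<^sup>2 + (\<gamma> (u - v + (- h)))\<^sup>2 + (\<gamma>
        (u - v + h))\<^sup>2))"
      by (intro sum_mono \<rho>2)
    also have "\<dots> = 12 * ((\<Sum>u\<in>grid N. \<Sum>v\<in>grid N. (\<gamma> (u - v + 0))\<^sup>2) + (\<Sum>u\<in>grid N. \<Sum>v\<in>grid N. (\<gamma>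
        (u - v + (- h)))\<^sup>2) + (\<Sum>u\<in>grid N. \<Sum>v\<in>grid N. (\<gamma> (u - v + h))\<^sup>2))"
      by (simp only: sum.distrib sum_distrib_left[symmetric])
    also have "\<dots> \<le> 12 * (C * real N powr (4 - \<eta>) + C * real N powr (4 - \<eta>) + C * real N powr (4 - \<eta>))"
      by (intro mult_left_mono add_mono rate N) auto
    finally show ?thesis by simp
  qed
  have sum\<rho>: "(\<Sum>u\<in>overlap N h. \<Sum>v\<in>overlap N h. \<rho> u v) \<le> (1 + 36 * C) * real N powr (4 - \<eta> / 2)"
      if N: "1 \<le> N" for N
  proof -
    \<comment> \<open>The balance in \<open>x \<le> \<kappa> + x\<^sup>2 / \<kappa>\<close> between the \<open>N\<^sup>4\<close> index pairs and the sum of squares.\<close>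
    define \<kappa> where "\<kappa> = real N powr (- \<eta> / 2)"
    have \<kappa>: "0 < \<kappa>" using N by (simp add: \<kappa>_def)
    have t: "x \<le> \<kappa> + x\<^sup>2 / \<kappa>" for x :: real
    proof (cases "x \<le> \<kappa>")
      case True then show ?thesis using \<kappa> by (simp add: add_increasing2)
    next
      case False
      then have "\<kappa> * x \<le> x\<^sup>2" using \<kappa> by (simp add: power2_eq_square mult_right_mono)
      then have "x \<le> x\<^sup>2 / \<kappa>" using \<kappa> by (simp add: pos_le_divide_eq mult.commute)
      then show ?thesis using \<kappa> by simp
    qed
    have "(\<Sum>u\<in>overlap N h. \<Sum>v\<in>overlap N h. \<rho> u v) \<le> (\<Sum>u\<in>overlap N h. \<Sum>v\<in>overlap N h. \<kappa> + (\<rho> u v)\<^sup>2 / \<kappa>)"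
      by (intro sum_mono t)
    also have "\<dots> = (real (card (overlap N h)))\<^sup>2 * \<kappa> + (\<Sum>u\<in>overlap N h. \<Sum>v\<in>overlap N h. (\<rho> u v)\<^sup>2) / \<kappa>"
      by (simp add: sum.distrib sum_divide_distrib power2_eq_square)
    also have "\<dots> \<le> (real (N\<^sup>2))\<^sup>2 * \<kappa> + (36 * C * real N powr (4 - \<eta>)) / \<kappa>"
    proof (intro add_mono mult_right_mono divide_right_mono sum\<rho>2 N power_mono)
      show "real (card (overlap N h)) \<le> real (N\<^sup>2)"
        unfolding card_grid[symmetric] of_nat_le_iff by (intro card_mono overlap_subset) auto
    qed (use \<kappa> in auto)
    also have "(real (N\<^sup>2))\<^sup>2 = real N powr 4" using N by simp
    also have "real N powr 4 * \<kappa> = real N powr (4 - \<eta> / 2)"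
      unfolding \<kappa>_def powr_add[symmetric] by simp
    also have "36 * C * real N powr (4 - \<eta>) / \<kappa> = 36 * C * real N powr (4 - \<eta> / 2)"
    proof -
      have "real N powr (4 - \<eta>) / \<kappa> = real N powr (4 - \<eta> / 2)"
        unfolding \<kappa>_def powr_diff[symmetric] by (simp add: field_simps)
      then show ?thesis by (metis times_divide_eq_right)
    qed
    finally show ?thesis by (simp add: algebra_simps)
  qed
  define e where "e N = (\<Sum>u\<in>overlap N h. (expectation (\<lambda>\<omega>. (U u \<omega>)\<^sup>2) + c\<^sup>2))" for N
  have ee: "e N = real (card (overlap N h)) * (s + c\<^sup>2)" for N by (simp add: e_def Us)
  have "AE \<omega> in M. (\<lambda>N. (\<Sum>u\<in>overlap N h. (U u \<omega> + c)\<^sup>2) / (real N)\<^sup>2) \<longlonglongrightarrow> s + c\<^sup>2"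
  proof (rule strong_law_monotone[where e = e and \<eta> = "\<eta> / 2" and C
      = "144 * C + 8 * c\<^sup>2 * (1 + 36 * C)"])
    show "mono (\<lambda>N. \<Sum>u\<in>overlap N h. (U u \<omega> + c)\<^sup>2)" for \<omega>
      by (intro monoI sum_mono2 overlap_mono) auto
    show "integrable M (\<lambda>\<omega>. ((\<Sum>u\<in>overlap N h. (U u \<omega> + c)\<^sup>2) - e N)\<^sup>2)" for N
      unfolding e_def by (rule variance_sum_shifted_squares[OF U])
    show "(\<lambda>N. e N / (real N)\<^sup>2) \<longlonglongrightarrow> s + c\<^sup>2"
      using tendsto_mult_right[OF card_overlap_limit[of h], of "s + c\<^sup>2"] by (simp add: ee)
    fix N :: nat assume N: "1 \<le> N"
    have "expectation (\<lambda>\<omega>. ((\<Sum>u\<in>overlap N h. (U u \<omega> + c)\<^sup>2) - e N)\<^sup>2)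
       \<le> 4 * (\<Sum>u\<in>overlap N h. \<Sum>v\<in>overlap N h. (\<rho> u v)\<^sup>2) + 8 * c\<^sup>2 *
           (\<Sum>u\<in>overlap N h. \<Sum>v\<in>overlap N h. \<rho> u v)"
      unfolding e_def \<rho>_def by (rule variance_sum_shifted_squares[OF U])
    also have "\<dots> \<le> 4 * (36 * C * real N powr (4 - \<eta>)) + 8 * c\<^sup>2 * ((1 + 36 * C) * real N powr
        (4 - \<eta> / 2))"
      by (intro add_mono mult_left_mono sum\<rho>2 sum\<rho> N) auto
    also have "\<dots> \<le> 4 * (36 * C * real N powr (4 - \<eta> / 2)) + 8 * c\<^sup>2 * ((1 + 36 * C) * real N powr
        (4 - \<eta> / 2))"
      using \<eta> N C0 by (intro add_mono mult_left_mono powr_mono) auto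
    finally show "expectation (\<lambda>\<omega>. ((\<Sum>u\<in>overlap N h. (U u \<omega> + c)\<^sup>2) - e N)\<^sup>2)
        \<le> (144 * C + 8 * c\<^sup>2 * (1 + 36 * C)) * real N powr (4 - \<eta> / 2)"
      by (simp add: algebra_simps)
  qed (use \<eta> in \<open>auto intro: sum_nonneg\<close>)
  then show ?thesis by (simp add: U_def s_def)
qed

lemma sample_mean_null: "AE \<omega> in M. (\<lambda>N. (\<Sum>u\<in>grid N. Y u \<omega>) / (real N)\<^sup>2) \<longlonglongrightarrow> 0"
proof -
  \<comment> \<open>\<open>Y\<close> itself is not nonnegative, but \<open>2 Y = (Y + 1)\<^sup>2 - Y\<^sup>2 - 1\<close>.\<close>
  have 1: "AE \<omega> in M. (\<lambda>N. (\<Sum>u\<in>grid N. (Y u \<omega> + 1)\<^sup>2) / (real N)\<^sup>2) \<longlonglongrightarrow> \<gamma> 0 + 1"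
    using strong_law_squares[of 0 0 1] by simp
  have 0: "AE \<omega> in M. (\<lambda>N. (\<Sum>u\<in>grid N. (Y u \<omega>)\<^sup>2) / (real N)\<^sup>2) \<longlonglongrightarrow> \<gamma> 0"
    using strong_law_squares[of 0 0 0] by simp
  show ?thesis using 0 1
  proof eventually_elim
    case (elim \<omega>)
    have "(\<lambda>N. ((\<Sum>u\<in>grid N. (Y u \<omega> + 1)\<^sup>2) / (real N)\<^sup>2 - (\<Sum>u\<in>grid N. (Y u \<omega>)\<^sup>2) /
        (real N)\<^sup>2 - real (card (overlap N 0)) / (real N)\<^sup>2) / 2)
      \<longlonglongrightarrow> (\<gamma> 0 + 1 - \<gamma> 0 - 1) / 2"
      by (intro tendsto_intros elim card_overlap_limit) auto
    moreover have "((\<Sum>u\<in>grid N. (Y u \<omega> + 1)\<^sup>2) / (real N)\<^sup>2 - (\<Sum>u\<in>grid N. (Y u \<omega>)\<^sup>2) /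
        (real N)\<^sup>2 - real (card (overlap N 0)) / (real N)\<^sup>2) / 2
       = (\<Sum>u\<in>grid N. Y u \<omega>) / (real N)\<^sup>2" for N
      by (simp add: power2_sum sum.distrib sum_distrib_left[symmetric]
          diff_divide_distrib[symmetric] add_divide_distrib del: card_cartesian_product)
    ultimately show ?case by (simp only:) simp
  qed
qed

lemma sample_products: "AE \<omega> in M. (\<lambda>N. (\<Sum>u\<in>overlap N h. Y u \<omega> * Y (u + h) \<omega>) / (real N)\<^sup>2) \<longlonglongrightarrow> \<gamma> h"
proof -
  \<comment> \<open>Polarization: \<open>4 x y = (x + y)\<^sup>2 - (x - y)\<^sup>2\<close>.\<close>
  have p: "AE \<omega> in M. (\<lambda>N. (\<Sum>u\<in>overlap N h. (Y u \<omega> + Y (u + h) \<omega>)\<^sup>2) / (real N)\<^sup>2) \<longlonglongrightarrow> 2 * \<gamma> 0 + 2 * \<gamma> h"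
    using strong_law_squares[of 1 h 0] by simp
  have n: "AE \<omega> in M. (\<lambda>N. (\<Sum>u\<in>overlap N h. (Y u \<omega> - Y (u + h) \<omega>)\<^sup>2) / (real N)\<^sup>2) \<longlonglongrightarrow> 2 * \<gamma> 0 - 2 * \<gamma> h"
    using strong_law_squares[of "-1" h 0] by simp
  show ?thesis using p n
  proof eventually_elim
    case (elim \<omega>)
    have "(\<lambda>N. ((\<Sum>u\<in>overlap N h. (Y u \<omega> + Y (u + h) \<omega>)\<^sup>2) / (real N)\<^sup>2 - (\<Sum>u\<in>overlap N h.
        (Y u \<omega> - Y (u + h) \<omega>)\<^sup>2) / (real N)\<^sup>2) / 4)
      \<longlonglongrightarrow> (2 * \<gamma> 0 + 2 * \<gamma> h - (2 * \<gamma> 0 - 2 * \<gamma> h)) / 4"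
      by (intro tendsto_intros elim) auto
    moreover have "((\<Sum>u\<in>overlap N h. (Y u \<omega> + Y (u + h) \<omega>)\<^sup>2) / (real N)\<^sup>2 - (\<Sum>u\<in>overlap N h.
        (Y u \<omega> - Y (u + h) \<omega>)\<^sup>2) / (real N)\<^sup>2) / 4
       = (\<Sum>u\<in>overlap N h. Y u \<omega> * Y (u + h) \<omega>) / (real N)\<^sup>2" for N
      unfolding diff_divide_distrib[symmetric] sum_subtractf[symmetric]
      by (simp add: power2_sum power2_diff sum_distrib_left[symmetric] mult.assoc)
    ultimately show ?case by simp
  qed
qed

end

text \<open>
Centring at the sample mean changes the sample products by the mean times an average that is
bounded in terms of the average square, and by a multiple of the squared mean.
\<close>

lemma tendsto_sample_autocovariance:
  fixes y :: "int \<times> int \<Rightarrow> real" 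
  defines "m \<equiv> \<lambda>N. (\<Sum>u\<in>grid N. y u) / (real N)\<^sup>2"
  assumes m: "m \<longlonglongrightarrow> 0"
    and s: "(\<lambda>N. (\<Sum>u\<in>grid N. (y u)\<^sup>2) / (real N)\<^sup>2) \<longlonglongrightarrow> v"
    and p: "(\<lambda>N. (\<Sum>u\<in>overlap N h. y u * y (u + h)) / (real N)\<^sup>2) \<longlonglongrightarrow> g"
  shows "(\<lambda>N. (\<Sum>u\<in>overlap N h. (y u - m N) * (y (u + h) - m N)) / (real N)\<^sup>2) \<longlonglongrightarrow> g"
proof -
  define b where "b N = (\<Sum>u\<in>overlap N h. y u + y (u + h)) / (real N)\<^sup>2" for N
  define q where "q N = (\<Sum>u\<in>grid N. (y u)\<^sup>2) / (real N)\<^sup>2" for N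
  have bq: "\<bar>b N\<bar> \<le> 2 * (1 + q N)" for N
  proof (cases "N = 0")
    case False
    have t: "\<bar>x\<bar> \<le> 1 + x\<^sup>2" for x :: real
      using sum_squares_bound[of "\<bar>x\<bar>" 1] by (simp add: power2_abs) 
    have 1: "(\<Sum>u\<in>overlap N h. \<bar>y u\<bar>) \<le> (\<Sum>u\<in>grid N. \<bar>y u\<bar>)"
      by (intro sum_mono2 overlap_subset) auto
    have "(\<Sum>u\<in>overlap N h. \<bar>y (u + h)\<bar>) = (\<Sum>u\<in>(\<lambda>u. u + h) ` overlap N h. \<bar>y u\<bar>)"
      by (subst sum.reindex) (auto simp: inj_on_def)
    also have "\<dots> \<le> (\<Sum>u\<in>grid N. \<bar>y u\<bar>)"
      by (intro sum_mono2) (auto simp: overlap_def)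
    finally have 2: "(\<Sum>u\<in>overlap N h. \<bar>y (u + h)\<bar>) \<le> (\<Sum>u\<in>grid N. \<bar>y u\<bar>)" .
    have "\<bar>\<Sum>u\<in>overlap N h. y u + y (u + h)\<bar> \<le> (\<Sum>u\<in>overlap N h. \<bar>y u\<bar> + \<bar>y (u + h)\<bar>)"
      by (intro order_trans[OF sum_abs] sum_mono) auto
    also have "\<dots> \<le> 2 * (\<Sum>u\<in>grid N. \<bar>y u\<bar>)" using 1 2 by (simp add: sum.distrib)
    also have "\<dots> \<le> 2 * (\<Sum>u\<in>grid N. 1 + (y u)\<^sup>2)" by (intro mult_left_mono sum_mono t) auto
    also have "(\<Sum>u\<in>grid N. 1 + (y u)\<^sup>2) = (1 + q N) * (real N)\<^sup>2"
      using False by (simp only: sum.distrib sum_constant card_grid) (simp add: q_def field_simps)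
    finally show ?thesis using False by (simp add: b_def divide_le_eq algebra_simps)
  qed (simp add: b_def q_def overlap_def)
  have e: "(\<Sum>u\<in>overlap N h. (y u - m N) * (y (u + h) - m N)) / (real N)\<^sup>2 = 
     (\<Sum>u\<in>overlap N h. y u * y (u + h)) / (real N)\<^sup>2 - m N * b N + (m N)\<^sup>2 * (real (card
         (overlap N h)) / (real N)\<^sup>2)" for N
  proof -
    have "(\<Sum>u\<in>overlap N h. (y u - m N) * (y (u + h) - m N))
        = (\<Sum>u\<in>overlap N h. y u * y (u + h) - m N * (y u + y (u + h)) + (m N)\<^sup>2)"
      by (intro sum.cong refl) (simp add: algebra_simps power2_eq_square)
    also have "\<dots> = (\<Sum>u\<in>overlap N h. y u * y (u + h)) - m N * (\<Sum>u\<in>overlap N h. y u + y (u + h)) +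
        (m N)\<^sup>2 * real (card (overlap N h))"
      by (simp add: sum.distrib sum_subtractf flip: sum_distrib_left)
    finally show ?thesis by (simp add: b_def add_divide_distrib diff_divide_distrib)
  qed
  have mb: "(\<lambda>N. m N * b N) \<longlonglongrightarrow> 0"
  proof (rule tendsto_0_le[where K = 1])
    show "(\<lambda>N. m N * (2 * (1 + q N))) \<longlonglongrightarrow> 0"
      using tendsto_mult[OF m tendsto_mult[OF tendsto_const[of 2] tendsto_add[OF tendsto_const[of
          1] s]]] by (simp add: q_def)
    show "\<forall>\<^sub>F N in sequentially. norm (m N * b N) \<le> norm (m N * (2 * (1 + q N))) * 1"
      by (intro always_eventually allI) (auto simp: abs_mult intro!: mult_left_mono intro:
          order_trans[OF bq])
  qed
  have "(\<lambda>N. (\<Sum>u\<in>overlap N h. y u * y (u + h)) / (real N)\<^sup>2 - m N * b N + (m N)\<^sup>2 * (real (card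
      (overlap N h)) / (real N)\<^sup>2))
     \<longlonglongrightarrow> g - 0 + 0\<^sup>2 * 1"
    by (intro tendsto_intros p mb m card_overlap_limit)
  then show ?thesis unfolding e by simp
qed

section \<open>The periodogram as a weakly convergent family of measures\<close>

text \<open>
Stated for observations shifted by an arbitrary \<open>\<mu>\<close>: the periodogram does not see the mean of the
process because the sample mean is subtracted.
\<close>

lemma integral_chi_periodogram:
  fixes \<mu> :: real and X :: "int \<Rightarrow> int \<Rightarrow> 'a \<Rightarrow> real" and \<omega> :: "'a"
  assumes N: "1 \<le> N"
  defines "y \<equiv> \<lambda>u. X (fst u) (snd u) \<omega> - \<mu>"
  defines "m \<equiv> (\<Sum>u\<in>grid N. y u) / (real N)\<^sup>2"
  shows "integral\<^sup>L T (\<lambda>p. chi h p * of_real (periodogram X N \<omega> (fst p) (snd p))) =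
    of_real (4 * pi\<^sup>2 * ((\<Sum>u\<in>overlap N h. (y u - m) * (y (u + h) - m)) / (real N)\<^sup>2))"
proof -
  have sm: "sample_mean X N \<omega> = m + \<mu>"
  proof -
    have "sample_mean X N \<omega> = (\<Sum>u\<in>grid N. y u + \<mu>) / (real N)\<^sup>2"
      unfolding sample_mean_def sum.cartesian_product y_def by (simp add: case_prod_unfold)
    also have "\<dots> = m + (real N)\<^sup>2 * \<mu> / (real N)\<^sup>2"
      by (simp only: sum.distrib sum_constant card_grid m_def add_divide_distrib of_nat_power)
    finally show ?thesis using N by simp
  qed
  have P: "periodogram X N \<omega> (fst p) (snd p) = (1 / (real N)\<^sup>2) * (cmod
      (\<Sum>u\<in>grid N. chi u p * of_real (y u - m)))\<^sup>2" for p
  proof -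
    have ym: "y u - m = X (fst u) (snd u) \<omega> - (m + \<mu>)" for u by (simp add: y_def)
    show ?thesis
      unfolding periodogram_def sm sum.cartesian_product ym case_prod_unfold chi_def cis_conv_exp ..
  qed
  have "integral\<^sup>L T (\<lambda>p. chi h p * of_real (periodogram X N \<omega> (fst p) (snd p))) =
     integral\<^sup>L T (\<lambda>p. of_real (1 / (real N)\<^sup>2) * (chi h p * of_real ((cmod
         (\<Sum>u\<in>grid N. chi u p * of_real (y u - m)))\<^sup>2)))"
    unfolding P by (simp add: mult_ac)
  also have "\<dots> = of_real (1 / (real N)\<^sup>2) * (of_real (4 * pi\<^sup>2) * (\<Sum>u\<in>grid N.
      if u + h \<in> grid N then of_real (y u - m) * cnj (of_real (y (u + h) - m)) else 0))"
    by (subst integral_mult_right_zero, subst integral_chi_norm_square) auto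
  also have "(\<Sum>u\<in>grid N. if u + h \<in> grid N then of_real (y u - m) * cnj (of_real (y (u + h) - m)) else 0)
     = of_real (\<Sum>u\<in>overlap N h. (y u - m) * (y (u + h) - m))"
    unfolding overlap_def of_real_sum by (subst sum.inter_filter[symmetric]) auto
  finally show ?thesis by simp
qed

lemma periodogram_nonneg: "0 \<le> periodogram X N \<omega> x y"
  by (simp add: periodogram_def)

lemma continuous_periodogram: "continuous_on UNIV (\<lambda>p. periodogram X N \<omega> (fst p) (snd p))"
  unfolding periodogram_def by (intro continuous_intros)

inductive trig :: "(real \<times> real \<Rightarrow> complex) \<Rightarrow> bool" where
  trig_chi: "trig (chi h)"
| trig_scale: "trig q \<Longrightarrow> trig (\<lambda>p. c * q p)"
| trig_add: "trig q \<Longrightarrow> trig q' \<Longrightarrow> trig (\<lambda>p. q p + q' p)"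

lemma trig_const: "trig (\<lambda>p. c)"
  using trig_scale[OF trig_chi[of 0], of c] by simp

lemma trig_mult: "trig q \<Longrightarrow> trig q' \<Longrightarrow> trig (\<lambda>p. q p * q' p)"
proof (induction rule: trig.induct)
  case (trig_chi h)
  then show ?case
  proof (induction rule: trig.induct)
    case (trig_chi g)
    then show ?case using trig.trig_chi[of "h + g"] by (simp add: chi_add[abs_def])
  next
    case (trig_scale q c)
    then show ?case using trig.trig_scale[of _ c] by (fastforce simp: mult.left_commute)
  next
    case (trig_add q q')
    then show ?case using trig.trig_add by (fastforce simp: distrib_left)
  qed
next
  case (trig_scale q c)
  then show ?case using trig.trig_scale[of _ c] by (fastforce simp: mult.assoc)
next
  case (trig_add q q')
  then show ?case using trig.trig_add by (fastforce simp: distrib_right)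
qed

definition torus_point :: "real \<times> real \<Rightarrow> complex \<times> complex" where
  "torus_point p = (cis (fst p), cis (snd p))"

abbreviation torus :: "(complex \<times> complex) set" where
  "torus \<equiv> sphere 0 1 \<times> sphere 0 1"

lemma torus_point_in_torus: "torus_point p \<in> torus" by (simp add: torus_point_def)
lemma continuous_torus_point: "continuous_on A torus_point" unfolding torus_point_def
    by (intro continuous_intros)
lemma compact_torus: "compact torus" by (intro compact_Times compact_sphere)

text \<open>
Real polynomials on \<open>\<complex>\<^sup>2\<close> are the dense class of the Stone-Weierstrass theorem. On the torus the
coordinates are combinations of characters, and a product of characters is a character.
\<close>

lemma trig_real_polynomial:
  "real_polynomial_function P \<Longrightarrow> trig (\<lambda>p. of_real (P (torus_point p)))"
proof (induction rule: real_polynomial_function.induct)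
  case (linear f)
  then interpret f: bounded_linear f .
  have "f (z, w) = Re z * f (1, 0) + Im z * f (\<i>, 0) + Re w * f (0, 1) + Im w * f (0, \<i>)" for z w
  proof -
    have "(z, w) = Re z *\<^sub>R (1, 0) + Im z *\<^sub>R (\<i>, 0) + Re w *\<^sub>R (0, 1) + Im w *\<^sub>R (0, \<i>)"
      by (simp add: complex_eq_iff)
    then show ?thesis by (simp only: f.add f.scaleR real_scaleR_def)
  qed
  note f_eq = this
  have f: "of_real (f (torus_point p)) = of_real (cos (fst p)) * of_real (f (1, 0)) + of_real (sin
      (fst p)) * of_real (f (\<i>, 0))
      + of_real (cos (snd p)) * of_real (f (0, 1)) + (of_real (sin (snd p)) * of_real (f
          (0, \<i>)) :: complex)" for p
    unfolding torus_point_def f_eq[of "cis (fst p)" "cis (snd p)"] by simp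
  have half: "trig (\<lambda>p. a * chi h p + b * chi h' p)" for a b h h'
    by (intro trig_add trig_scale trig_chi)
  have "(\<lambda>p. of_real (cos (fst p))) = (\<lambda>p. (1/2) * chi (1, 0) p + (1/2) * chi (-1, 0) p)"
    "(\<lambda>p. of_real (sin (fst p))) = (\<lambda>p. (-\<i>/2) * chi (1, 0) p + (\<i>/2) * chi (-1, 0) p)"
    "(\<lambda>p. of_real (cos (snd p))) = (\<lambda>p. (1/2) * chi (0, 1) p + (1/2) * chi (0, -1) p)"
    "(\<lambda>p. of_real (sin (snd p))) = (\<lambda>p. (-\<i>/2) * chi (0, 1) p + (\<i>/2) * chi (0, -1) p)"
    by (rule ext, simp add: chi_def complex_eq_iff)+
  then have "trig (\<lambda>p. of_real (cos (fst p)))" "trig (\<lambda>p. of_real (sin (fst p)))"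
    "trig (\<lambda>p. of_real (cos (snd p)))" "trig (\<lambda>p. of_real (sin (snd p)))"
    by (simp_all only: half)
  then show ?case
    unfolding f by (intro trig_add trig_mult trig_const)
next
  case (const c)
  show ?case by (rule trig_const)
next
  case (add f g)
  then show ?case unfolding of_real_add by (intro trig_add)
next
  case (mult f g)
  then show ?case unfolding of_real_mult by (intro trig_mult)
qed

lemma integrable_T_mult_bounded:
  fixes f :: "real \<times> real \<Rightarrow> real" and g :: "real \<times> real \<Rightarrow>
      'b::{real_normed_field,banach,second_countable_topology}"
  assumes f: "integrable T f" and g: "continuous_on UNIV g"
  shows "integrable T (\<lambda>p. g p * of_real (f p))"
proof -
  have "compact (g ` I2)"
    unfolding I2_def by (intro compact_continuous_image continuous_on_subset[OF g] compact_Times) auto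
  then have "bounded (g ` I2)" by (rule compact_imp_bounded)
  then obtain B where "\<forall>z\<in>g ` I2. norm z \<le> B" unfolding bounded_iff by (rule exE)
  then have B: "norm (g p) \<le> B" if "p \<in> I2" for p using that by simp
  show ?thesis
  proof (rule Bochner_Integration.integrable_bound[OF integrable_mult_right[OF integrable_norm[OF
      f], of B]])
    show "(\<lambda>p. g p * of_real (f p)) \<in> borel_measurable T"
      using borel_measurable_T[OF borel_measurable_continuous_onI[OF g]]
          borel_measurable_integrable[OF f] by measurable
    show "AE p in T. norm (g p * of_real (f p)) \<le> norm (B * norm (f p))"
    proof (rule AE_I2)
      fix p assume "p \<in> space T"
      then have "norm (g p) * \<bar>f p\<bar> \<le> B * \<bar>f p\<bar>" using B by (intro mult_right_mono) auto
      then show "norm (g p * of_real (f p)) \<le> norm (B * norm (f p))" by (simp add: norm_mult)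
    qed
  qed
qed

lemma trig_continuous: "trig q \<Longrightarrow> continuous_on UNIV q"
  by (induction rule: trig.induct) (intro continuous_intros; assumption)+

text \<open>
Convergence of all Fourier coefficients of nonnegative functions to \<open>\<kappa>\<close> times those of \<open>f\<close>. The
intended instances are the periodograms of one sample path, with \<open>\<kappa> = 4 \<pi>\<^sup>2\<close>.
\<close>

locale weak_limit =
  fixes I :: "nat \<Rightarrow> real \<times> real \<Rightarrow> real" and f :: "real \<times> real \<Rightarrow> real" and \<kappa> :: real
  assumes I_integrable: "\<And>N. integrable T (I N)" and I_nonneg: "\<And>N p. 0 \<le> I N p"
    and f_integrable: "integrable T f" and f_nonneg: "\<And>p. 0 \<le> f p" and \<kappa>: "0 \<le> \<kappa>"
    and moments: "\<And>h. (\<lambda>N. integral\<^sup>L T (\<lambda>p. chi h p * of_real (I N p)))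
        \<longlonglongrightarrow> of_real \<kappa> * integral\<^sup>L T (\<lambda>p. chi h p * of_real (f p))"
begin

lemma trig_limit:
  "trig q \<Longrightarrow> (\<lambda>N. integral\<^sup>L T (\<lambda>p. q p * of_real (I N p)))
      \<longlonglongrightarrow> of_real \<kappa> * integral\<^sup>L T (\<lambda>p. q p * of_real (f p))"
proof (induction rule: trig.induct)
  case (trig_chi h)
  then show ?case by (rule moments)
next
  case (trig_scale q c)
  then show ?case using tendsto_mult_left[OF trig_scale.IH, of c]
      by (simp add: mult.assoc mult.left_commute)
next
  case (trig_add q q')
  have i: "integrable T (\<lambda>p. q p * of_real (g p))" "integrable T (\<lambda>p. q' p * of_real (g p))"
      if "integrable T g" for g
    using trig_add that by (auto intro!: integrable_T_mult_bounded trig_continuous)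
  show ?case
    using tendsto_add[OF trig_add.IH] by (simp add: i I_integrable f_integrable distrib_left
        distrib_right)
qed

lemma mass_limit: "(\<lambda>N. integral\<^sup>L T (I N)) \<longlonglongrightarrow> \<kappa> * integral\<^sup>L T f"
proof -
  have "(\<lambda>N. complex_of_real (integral\<^sup>L T (I N))) \<longlonglongrightarrow> of_real (\<kappa> * integral\<^sup>L T f)"
    using moments[of 0] by simp
  then show ?thesis by (rule tendsto_of_real_iff[THEN iffD1])
qed

lemma integrable_mult_torus:
  fixes G :: "complex \<times> complex \<Rightarrow> real"
  assumes "integrable T g" "continuous_on torus G"
  shows "integrable T (\<lambda>p. G (torus_point p) * g p)"
proof -
  have "continuous_on UNIV (\<lambda>p. G (torus_point p))"
    by (rule continuous_on_compose2[OF assms(2) continuous_torus_point])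
        (use torus_point_in_torus in blast)
  from integrable_T_mult_bounded[OF assms(1) this] show ?thesis by simp
qed

lemma integral_perturb:
  fixes G :: "complex \<times> complex \<Rightarrow> real"
  assumes g: "integrable T g" "\<And>p. 0 \<le> g p" and G: "continuous_on torus G" "continuous_on torus G'"
    and e: "\<And>z. z \<in> torus \<Longrightarrow> \<bar>G z - G' z\<bar> \<le> e"
  shows "\<bar>integral\<^sup>L T (\<lambda>p. G (torus_point p) * g p) - integral\<^sup>L T (\<lambda>p. G'
      (torus_point p) * g p)\<bar> \<le> e * integral\<^sup>L T g"
proof -
  have i: "integrable T (\<lambda>p. (G (torus_point p) - G' (torus_point p)) * g p)"
    unfolding left_diff_distrib by (intro Bochner_Integration.integrable_diff integrable_mult_torus g G)
  have "integral\<^sup>L T (\<lambda>p. G (torus_point p) * g p) - integral\<^sup>L T (\<lambda>p. G' (torus_point p) * g p)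
      = integral\<^sup>L T (\<lambda>p. (G (torus_point p) - G' (torus_point p)) * g p)"
    using integrable_mult_torus[OF g(1)] G by (simp add: left_diff_distrib)
  also have "\<bar>\<dots>\<bar> \<le> integral\<^sup>L T (\<lambda>p. \<bar>(G (torus_point p) - G' (torus_point p)) * g p\<bar>)"
    by (rule integral_abs_bound)
  also have "\<dots> \<le> integral\<^sup>L T (\<lambda>p. e * g p)"
    by (intro integral_mono integrable_abs i integrable_mult_right g(1))
       (auto simp: abs_mult g(2) intro!: mult_right_mono e torus_point_in_torus)
  finally show ?thesis by simp
qed

text \<open>
Approximate \<open>G\<close> uniformly by a polynomial. The error on both sides is bounded by the total masses,
which converge as the coefficient at frequency zero.
\<close>

lemma continuous_limit:
  assumes G: "continuous_on torus G"
  shows "(\<lambda>N. integral\<^sup>L T (\<lambda>p. G (torus_point p) * I N p))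
      \<longlonglongrightarrow> \<kappa> * integral\<^sup>L T (\<lambda>p. G (torus_point p) * f p)"
proof (rule LIMSEQ_I)
  fix e :: real assume e: "0 < e"
  define m where "m = integral\<^sup>L T f"
  have m0: "0 \<le> m" unfolding m_def by (intro integral_nonneg_AE AE_I2 f_nonneg)
  \<comment> \<open>Bounds for the masses of both sides, and \<open>1\<close> for the error at the polynomial.\<close>
  define K where "K = \<kappa> * m + 1 + \<kappa> * m + 1"
  have K: "0 < K" using mult_nonneg_nonneg[OF \<kappa> m0] by (simp add: K_def)
  define \<delta> where "\<delta> = e / (2 * K)"
  have \<delta>: "0 < \<delta>" using e K by (simp add: \<delta>_def)
  obtain P where P: "real_polynomial_function P" "\<And>z. z \<in> torus \<Longrightarrow> \<bar>G z - P z\<bar> < \<delta>"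
    using Stone_Weierstrass_real_polynomial_function[OF compact_torus G \<delta>] by metis
  have cP: "continuous_on torus P"
    by (rule continuous_on_polymonial_function) (use P(1) real_polynomial_function_eq in auto)
  have "(\<lambda>N. complex_of_real (integral\<^sup>L T (\<lambda>p. P (torus_point p) * I N p)))
      \<longlonglongrightarrow> of_real (\<kappa> * integral\<^sup>L T (\<lambda>p. P (torus_point p) * f p))"
    using trig_limit[OF trig_real_polynomial[OF P(1)]] by (simp flip: of_real_mult)
  then have lP: "(\<lambda>N. integral\<^sup>L T (\<lambda>p. P (torus_point p) * I N p))
      \<longlonglongrightarrow> \<kappa> * integral\<^sup>L T (\<lambda>p. P (torus_point p) * f p)"
    by (rule tendsto_of_real_iff[THEN iffD1])
  obtain n1 where n1: "\<And>N. n1 \<le> N \<Longrightarrow> \<bar>integral\<^sup>L T (\<lambda>p. P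
      (torus_point p) * I N p) - \<kappa> * integral\<^sup>L T (\<lambda>p. P (torus_point p) * f p)\<bar> < \<delta>"
    using LIMSEQ_D[OF lP \<delta>] by auto
  obtain n2 where n2: "\<And>N. n2 \<le> N \<Longrightarrow> \<bar>integral\<^sup>L T (I N) - \<kappa> * m\<bar> < 1"
    using LIMSEQ_D[OF mass_limit, of 1] by (auto simp: m_def)
  have "\<bar>integral\<^sup>L T (\<lambda>p. G (torus_point p) * I N p) - \<kappa> * integral\<^sup>L T (\<lambda>p. G
      (torus_point p) * f p)\<bar> < e" if N: "max n1 n2 \<le> N" for N
  proof -
    have a: "\<bar>integral\<^sup>L T (\<lambda>p. G (torus_point p) * I N p) - integral\<^sup>L T (\<lambda>p. P
        (torus_point p) * I N p)\<bar> \<le> \<delta> * integral\<^sup>L T (I N)"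
      by (intro integral_perturb I_integrable I_nonneg G cP less_imp_le[OF P(2)])
    also have "\<dots> \<le> \<delta> * (\<kappa> * m + 1)"
      using n2[of N] N \<delta> by (intro mult_left_mono) auto
    finally have 1: "\<bar>integral\<^sup>L T (\<lambda>p. G (torus_point p) * I N p) - integral\<^sup>L T (\<lambda>p. P
        (torus_point p) * I N p)\<bar> \<le> \<delta> * (\<kappa> * m + 1)" .
    have "\<bar>integral\<^sup>L T (\<lambda>p. G (torus_point p) * f p) - integral\<^sup>L T (\<lambda>p. P
        (torus_point p) * f p)\<bar> \<le> \<delta> * m"
      unfolding m_def by (intro integral_perturb f_integrable f_nonneg G cP less_imp_le[OF P(2)])
    then have "\<kappa> * \<bar>integral\<^sup>L T (\<lambda>p. G (torus_point p) * f p) - integral\<^sup>L T (\<lambda>p. P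
        (torus_point p) * f p)\<bar> \<le> \<kappa> * (\<delta> * m)"
      using \<kappa> by (intro mult_left_mono)
    then have 2: "\<bar>\<kappa> * integral\<^sup>L T (\<lambda>p. G (torus_point p) * f p) - \<kappa> * integral\<^sup>L T (\<lambda>p. P
        (torus_point p) * f p)\<bar> \<le> \<kappa> * (\<delta> * m)"
      using \<kappa> by (simp add: abs_mult right_diff_distrib[symmetric])
    have 3: "\<delta> * (\<kappa> * m + 1) + \<delta> + \<kappa> * (\<delta> * m) = e / 2"
    proof -
      have "\<delta> * (\<kappa> * m + 1) + \<delta> + \<kappa> * (\<delta> * m) = \<delta> * K" by (simp add: K_def algebra_simps)
      then show ?thesis using K by (simp add: \<delta>_def)
    qed
    show ?thesis using 1 2 3 n1[of N] N e by (auto simp: abs_le_iff abs_less_iff)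
  qed
  then show "\<exists>no. \<forall>n\<ge>no. norm (integral\<^sup>L T (\<lambda>p. G (torus_point p) * I n p) - \<kappa> * integral\<^sup>L T
      (\<lambda>p. G (torus_point p) * f p)) < e"
    unfolding real_norm_def by blast
qed

text \<open>
The integrand may vary with the index as long as it converges uniformly; it is applied to the
truncated reciprocal densities at a convergent sequence of estimates.
\<close>

lemma continuous_limit_subseq:
  assumes G: "continuous_on torus G" and Gj: "\<And>j. continuous_on torus (H j)"
    and u: "uniform_limit torus H G sequentially" and r: "strict_mono r"
  shows "(\<lambda>j. integral\<^sup>L T (\<lambda>p. H j (torus_point p) * I (r j) p))
      \<longlonglongrightarrow> \<kappa> * integral\<^sup>L T (\<lambda>p. G (torus_point p) * f p)"
proof -
  define m where "m = \<kappa> * integral\<^sup>L T f"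
  have m0: "0 \<le> m" unfolding m_def using \<kappa> by (intro mult_nonneg_nonneg integral_nonneg_AE AE_I2
      f_nonneg)
  have "(\<lambda>j. integral\<^sup>L T (\<lambda>p. H j (torus_point p) * I (r j) p) - integral\<^sup>L T (\<lambda>p. G
      (torus_point p) * I (r j) p)) \<longlonglongrightarrow> 0"
  proof (rule LIMSEQ_I)
    fix e :: real assume e: "0 < e"
    define \<delta> where "\<delta> = e / (2 * (m + 1))"
    have \<delta>: "0 < \<delta>" using e m0 by (simp add: \<delta>_def)
    have l: "(\<lambda>j. integral\<^sup>L T (I (r j))) \<longlonglongrightarrow> m"
      using LIMSEQ_subseq_LIMSEQ[OF mass_limit r] by (simp add: m_def o_def)
    have "\<forall>\<^sub>F j in sequentially. \<forall>z\<in>torus. dist (H j z) (G z) < \<delta>"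
      using u \<delta> by (rule uniform_limitD)
    moreover have "\<forall>\<^sub>F j in sequentially. integral\<^sup>L T (I (r j)) < m + 1"
      using order_tendstoD(2)[OF l, of "m + 1"] by simp
    ultimately have "\<forall>\<^sub>F j in sequentially. norm (integral\<^sup>L T (\<lambda>p. H j (torus_point p) * I
        (r j) p) - integral\<^sup>L T (\<lambda>p. G (torus_point p) * I (r j) p) - 0) < e"
    proof eventually_elim
      case (elim j)
      have "\<bar>integral\<^sup>L T (\<lambda>p. H j (torus_point p) * I (r j) p) - integral\<^sup>L T (\<lambda>p. G
          (torus_point p) * I (r j) p)\<bar> \<le> \<delta> * integral\<^sup>L T (I (r j))"
        by (intro integral_perturb I_integrable I_nonneg G Gj)
            (use elim in \<open>auto simp: dist_real_def less_imp_le\<close>)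
      also have "\<dots> \<le> \<delta> * (m + 1)" using elim \<delta> by (intro mult_left_mono) auto
      also have "\<dots> = e / 2" using m0 by (simp add: \<delta>_def field_simps)
      finally show ?case using e by simp
    qed
    then show "\<exists>no. \<forall>n\<ge>no. norm (integral\<^sup>L T (\<lambda>p. H n (torus_point p) * I (r n) p) - integral\<^sup>L T
        (\<lambda>p. G (torus_point p) * I (r n) p) - 0) < e"
      by (simp add: eventually_sequentially)
  qed
  from tendsto_add[OF this LIMSEQ_subseq_LIMSEQ[OF continuous_limit[OF G] r]] show ?thesis
    by (simp add: o_def)
qed

end

section \<open>The density, its identifiability and its truncated reciprocal\<close>

text \<open>
One-dimensional factor of the reciprocal density: \<open>1 / f(\<theta>)\<close> is
\<open>4 \<pi>\<^sup>2 / \<sigma>\<^sup>2\<close> times the product of \<open>phi\<close> at the two coordinates.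
\<close>

definition phi :: "real \<Rightarrow> real \<Rightarrow> real \<Rightarrow> real" where
  "phi \<rho> d x = chord x powr (2 * d) * (cmod (1 - of_real \<rho> * cis x))\<^sup>2"

lemma cmod_one_minus_exp:
  "cmod (1 - of_real \<rho> * exp (- (\<i> * of_real x))) = cmod (1 - of_real \<rho> * cis x)"
proof -
  have "1 - of_real \<rho> * exp (- (\<i> * of_real x)) = cnj (1 - of_real \<rho> * cis x)"
    by (simp add: cis_conv_exp exp_cnj)
  then show ?thesis by (simp only: complex_mod_cnj)
qed

lemma chord_exp: "cmod (1 - exp (- (\<i> * of_real x))) = chord x"
  using cmod_one_minus_exp[of 1 x] by (simp add: chord_def)

lemma phi_nonneg: "0 \<le> phi \<rho> d x" by (simp add: phi_def)

text \<open>
Valid on the axes as well, since \<open>0 powr a = 0\<close> and \<open>a / 0 = 0\<close> make both sides vanish there.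
\<close>

lemma farima_density_eq:
  "farima_density \<sigma> (\<alpha>, \<beta>, d1, d2) x y = \<sigma>\<^sup>2 / (4 * pi\<^sup>2) * (1 / phi \<alpha> d1 x * (1 / phi \<beta> d2 y))"
  unfolding farima_density.simps norm_mult cmod_one_minus_exp chord_exp phi_def
  by (simp add: powr_minus inverse_eq_divide power_mult_distrib)

lemma one_minus_cis_lower: "1 - \<bar>\<rho>\<bar> \<le> cmod (1 - of_real \<rho> * cis x)"
  using norm_triangle_ineq2[of 1 "of_real \<rho> * cis x"] by (simp add: norm_mult)

lemma one_minus_cis_upper: "cmod (1 - of_real \<rho> * cis x) \<le> 1 + \<bar>\<rho>\<bar>"
  using norm_triangle_ineq4[of 1 "of_real \<rho> * cis x"] by (simp add: norm_mult)

lemma phi_pos: "\<bar>\<rho>\<bar> < 1 \<Longrightarrow> 0 < chord x \<Longrightarrow> 0 < phi \<rho> d x"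
  using one_minus_cis_lower[of \<rho> x] by (auto simp: phi_def intro!: mult_pos_pos)

lemma phi_measurable: "phi \<rho> d \<in> borel_measurable borel"
  unfolding phi_def cis_conv_exp by measurable

lemma integrable_phi:
  assumes "-1/2 < d" "\<bar>\<rho>\<bar> < 1" shows "integrable J (phi \<rho> d)"
proof (rule Bochner_Integration.integrable_bound)
  show "integrable J (\<lambda>x. chord x powr (2 * d) * 4)"
    using assms by (intro integrable_mult_left integrable_chord_powr) auto
  have "(cmod (1 - of_real \<rho> * cis x))\<^sup>2 \<le> 2\<^sup>2" for x
    using one_minus_cis_upper[of \<rho> x] assms by (intro power_mono) auto
  then show "AE x in J. norm (phi \<rho> d x) \<le> norm (chord x powr (2 * d) * 4)"
    by (auto simp: phi_def intro!: mult_left_mono)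
qed (intro borel_measurable_J phi_measurable)

lemma inverse_phi_le:
  assumes "\<bar>\<rho>\<bar> < 1" shows "1 / phi \<rho> d x \<le> chord x powr (- 2 * d) / (1 - \<bar>\<rho>\<bar>)\<^sup>2"
proof -
  have "(1 - \<bar>\<rho>\<bar>)\<^sup>2 \<le> (cmod (1 - of_real \<rho> * cis x))\<^sup>2"
    using one_minus_cis_lower[of \<rho> x] assms by (intro power_mono) auto
  then have "chord x powr (- 2 * d) / (cmod (1 - of_real \<rho> * cis x))\<^sup>2
      \<le> chord x powr (- 2 * d) / (1 - \<bar>\<rho>\<bar>)\<^sup>2"
    using assms by (intro divide_left_mono) (auto intro!: mult_pos_pos zero_less_power simp:
        zero_less_power2)
  then show ?thesis by (simp add: phi_def powr_minus divide_inverse)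
qed

lemma chord_square: "(chord x)\<^sup>2 = 2 - 2 * cos x"
  by (simp add: chord_def cmod_power2 sin_squared_eq power2_diff)

lemma cmod_one_minus_square: "(cmod (1 - of_real \<rho> * cis x))\<^sup>2 = (1 - \<rho>)\<^sup>2 + \<rho> * (chord x)\<^sup>2"
  unfolding chord_square
  by (simp add: cmod_power2 power2_diff power_mult_distrib sin_squared_eq algebra_simps)

lemma chord_pos_interior: "0 < x \<Longrightarrow> x < pi \<Longrightarrow> 0 < chord x"
  by (intro chord_pos) auto

lemma chord_tendsto_0: "(chord \<longlongrightarrow> 0) (at_right 0)"
proof -
  have "isCont chord 0" using continuous_chord[of UNIV] by (simp add: continuous_on_eq_continuous_at)
  then have "(chord \<longlongrightarrow> chord 0) (at 0)" by (simp add: isCont_def)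
  then show ?thesis by (simp add: chord_def filterlim_at_split)
qed

text \<open>
If \<open>d > d'\<close>, divide by \<open>chord powr (2 d')\<close> and let \<open>x\<close> tend to \<open>0\<close>: the left-hand side tends to
\<open>0\<close> and the right-hand side to the positive number \<open>c (1 - \<rho>')\<^sup>2\<close>.
\<close>

lemma phi_proportional_exponent:
  assumes eq: "\<And>x. 0 < x \<Longrightarrow> x < pi \<Longrightarrow> phi \<rho> d x = c * phi \<rho>' d' x" and c: "0 < c" and "\<bar>\<rho>'\<bar> < 1"
  shows "d \<le> d'"
proof (rule ccontr)
  assume "\<not> d \<le> d'"
  then have e: "0 < 2 * (d - d')" by simp
  have ev: "\<forall>\<^sub>F x in at_right 0. 0 < x \<and> x < pi"
    using eventually_at_right_less[of 0] eventually_at_right_real[OF pi_gt_zero] by eventually_elim auto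
  have "((\<lambda>x. chord x powr (2 * (d - d')) * ((1 - \<rho>)\<^sup>2 + \<rho> * (chord x)\<^sup>2)) \<longlongrightarrow> 0 * ((1 - \<rho>)\<^sup>2
      + \<rho> * 0\<^sup>2)) (at_right 0)"
    by (intro tendsto_intros chord_tendsto_0 tendsto_zero_powrI[OF chord_tendsto_0 tendsto_const _
        e]) auto
  moreover have "\<forall>\<^sub>F x in at_right 0. chord x powr (2 * (d - d')) * ((1 - \<rho>)\<^sup>2 + \<rho> * (chord x)\<^sup>2)
      = c * ((1 - \<rho>')\<^sup>2 + \<rho>' * (chord x)\<^sup>2)"
    using ev
  proof eventually_elim
    case (elim x)
    then have p: "0 < chord x" by (intro chord_pos_interior) auto
    have "chord x powr (2 * d) * ((1 - \<rho>)\<^sup>2 + \<rho> * (chord x)\<^sup>2)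
        = c * (chord x powr (2 * d') * ((1 - \<rho>')\<^sup>2 + \<rho>' * (chord x)\<^sup>2))"
      using eq[of x] elim by (simp add: phi_def cmod_one_minus_square)
    then show ?case using p by (simp add: right_diff_distrib powr_diff field_simps)
  qed
  ultimately have "((\<lambda>x. c * ((1 - \<rho>')\<^sup>2 + \<rho>' * (chord x)\<^sup>2)) \<longlongrightarrow> 0) (at_right 0)"
    using filterlim_cong by (simp add: tendsto_cong)
  moreover have "((\<lambda>x. c * ((1 - \<rho>')\<^sup>2 + \<rho>' * (chord x)\<^sup>2)) \<longlongrightarrow> c * ((1 - \<rho>')\<^sup>2 + \<rho>' * 0\<^sup>2)) (at_right 0)"
    by (intro tendsto_intros chord_tendsto_0)
  ultimately have "c * ((1 - \<rho>')\<^sup>2 + \<rho>' * 0\<^sup>2) = 0"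
    using tendsto_unique[OF trivial_limit_at_right_real] by blast
  then show False using c assms(3) by auto
qed

text \<open>
The memory parameters agree by the behaviour at \<open>0\<close>, used in both directions. What remains is an
identity between two affine functions of the squared chord; comparing coefficients gives
\<open>\<rho> = c \<rho>'\<close> and \<open>(1 - \<rho>)\<^sup>2 = c (1 - \<rho>')\<^sup>2\<close>, hence \<open>(\<rho>' - \<rho>) (1 - \<rho> \<rho>') = 0\<close>.
\<close>

lemma phi_identifiable:
  assumes eq: "\<And>x. 0 < x \<Longrightarrow> x < pi \<Longrightarrow> phi \<rho> d x = c * phi \<rho>' d' x" and c: "0 < c" 
    and \<rho>: "\<bar>\<rho>\<bar> < 1" and \<rho>': "\<bar>\<rho>'\<bar> < 1"
  shows "\<rho> = \<rho>' \<and> d = d'"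
proof -
  have "d \<le> d'" by (rule phi_proportional_exponent[OF eq c \<rho>'])
  moreover have "d' \<le> d"
    by (rule phi_proportional_exponent[where c = "1 / c" and \<rho>' = \<rho> and \<rho> = \<rho>']) (use eq c \<rho> in auto)
  ultimately have d: "d = d'" by simp
  have lin: "(1 - \<rho>)\<^sup>2 + \<rho> * (chord x)\<^sup>2 = c * ((1 - \<rho>')\<^sup>2 + \<rho>' * (chord x)\<^sup>2)" if "0 < x" "x < pi" for x
  proof -
    have "chord x powr (2 * d) * ((1 - \<rho>)\<^sup>2 + \<rho> * (chord x)\<^sup>2)
        = chord x powr (2 * d) * (c * ((1 - \<rho>')\<^sup>2 + \<rho>' * (chord x)\<^sup>2))"
      using eq[OF that] by (simp add: phi_def cmod_one_minus_square d)
    moreover have "chord x powr (2 * d) > 0" using chord_pos_interior[OF that] by simp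
    ultimately show ?thesis by simp
  qed
  have sq: "(chord (pi / 2))\<^sup>2 = 2" "(chord (pi / 3))\<^sup>2 = 1"
    by (simp_all add: chord_square cos_60)
  have a: "\<rho> = c * \<rho>'" and b: "(1 - \<rho>)\<^sup>2 = c * (1 - \<rho>')\<^sup>2"
    using lin[of "pi / 2"] lin[of "pi / 3"] unfolding sq by (simp_all add: algebra_simps)
  have "\<rho>' * (1 - \<rho>)\<^sup>2 = \<rho> * (1 - \<rho>')\<^sup>2" using a b by simp
  then have "(\<rho>' - \<rho>) * (1 - \<rho> * \<rho>') = 0" by (simp add: power2_eq_square algebra_simps)
  moreover have "\<bar>\<rho> * \<rho>'\<bar> < 1" using \<rho> \<rho>' abs_mult_less[of \<rho> 1 \<rho>' 1] by (simp add: abs_mult)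
  ultimately show ?thesis using d by auto
qed

text \<open>
Continuous, zero for \<open>t \<le> 1 / (n + 1)\<close>, and increasing to \<open>1\<close> for every \<open>t > 0\<close>.
\<close>

definition cutoff :: "nat \<Rightarrow> real \<Rightarrow> real" where
  "cutoff n t = min 1 (max 0 (real (Suc n) * t - 1))"

text \<open>
The factor \<open>phi\<close> times the cutoff, as a function on the unit circle. Where the cutoff is not zero
the maximum is just the chord; it keeps the base of the power away from zero, so that the
expression is visibly continuous in all its arguments.
\<close>

definition trunc_phi :: "nat \<Rightarrow> real \<Rightarrow> real \<Rightarrow> complex \<Rightarrow> real" where
  "trunc_phi n \<rho> d z = cutoff n (cmod (1 - z)) * (max (cmod (1 - z)) (1 / real (Suc n)) powr
      (2 * d) * (cmod (1 - of_real \<rho> * z))\<^sup>2)"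

lemma cutoff_bounds: "0 \<le> cutoff n t" "cutoff n t \<le> 1" by (auto simp: cutoff_def)

lemma cutoff_mono: "m \<le> n \<Longrightarrow> 0 \<le> t \<Longrightarrow> cutoff m t \<le> cutoff n t"
  unfolding cutoff_def by (intro min.mono max.mono diff_mono mult_right_mono) auto

lemma cutoff_tendsto: 
  assumes "0 < t" shows "(\<lambda>n. cutoff n t) \<longlonglongrightarrow> 1"
proof (rule tendsto_eventually)
  obtain k where k: "2 / t < real k" using reals_Archimedean2 by blast
  show "\<forall>\<^sub>F n in sequentially. cutoff n t = 1"
    using eventually_ge_at_top[of k]
  proof eventually_elim
    case (elim n)
    have "2 \<le> real k * t" using k assms by (simp add: field_simps)
    also have "\<dots> \<le> real (Suc n) * t" using elim assms by (intro mult_right_mono) auto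
    finally show ?case by (simp add: cutoff_def)
  qed
qed

lemma cutoff_0 [simp]: "cutoff n 0 = 0" by (simp add: cutoff_def)

lemma trunc_phi_cis: "trunc_phi n \<rho> d (cis x) = cutoff n (chord x) * phi \<rho> d x"
proof (cases "cutoff n (chord x) = 0")
  case False
  then have "real (Suc n) * chord x > 1" by (auto simp: cutoff_def max_def split: if_splits)
  then have "1 / real (Suc n) \<le> chord x" by (simp add: field_simps)
  then have "max (chord x) (1 / real (Suc n)) = chord x" by (rule max_absorb1)
  then show ?thesis by (simp add: trunc_phi_def phi_def chord_def[symmetric])
qed (simp add: trunc_phi_def chord_def[symmetric])

definition trunc_inverse_density :: "real \<Rightarrow> nat \<Rightarrow> param \<Rightarrow> complex \<times> complex \<Rightarrow> real" where
  "trunc_inverse_density \<sigma> n \<theta> z = 4 * pi\<^sup>2 / \<sigma>\<^sup>2 * (trunc_phi n (fst \<theta>) (fst (snd (snd \<theta>)))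
      (fst z) * trunc_phi n (fst (snd \<theta>)) (snd (snd (snd \<theta>))) (snd z))"

lemma continuous_trunc_inverse_density:
  "continuous_on UNIV (\<lambda>q. trunc_inverse_density \<sigma> n (fst q) (snd q))"
  unfolding trunc_inverse_density_def trunc_phi_def cutoff_def
  by (intro continuous_intros) (auto simp: max_def)

lemma trunc_inverse_density_torus_point:
  "trunc_inverse_density \<sigma> n (\<alpha>, \<beta>, d1, d2) (torus_point p)
      = 4 * pi\<^sup>2 / \<sigma>\<^sup>2 * (cutoff n (chord (fst p)) * cutoff n (chord (snd p)) * (phi \<alpha> d1
      (fst p) * phi \<beta> d2 (snd p)))"
  by (simp add: trunc_inverse_density_def torus_point_def trunc_phi_cis)

lemma compact_Theta: "compact (Theta r s)"
proof -
  have "Theta r s = {-r..r} \<times> {-r..r} \<times> {-s..s} \<times> {-s..s}" by (auto simp: Theta_def)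
  then show ?thesis by (auto intro!: compact_Times)
qed

lemma uniform_limit_parameter:
  fixes F :: "'p::metric_space \<times> 'z::metric_space \<Rightarrow> real"
  assumes F: "continuous_on (A \<times> B) F" and A: "compact A" and B: "compact B"
    and \<theta>: "\<And>j. \<theta> j \<in> A" "\<theta>' \<in> A" "\<theta> \<longlonglongrightarrow> \<theta>'"
  shows "uniform_limit B (\<lambda>j z. F (\<theta> j, z)) (\<lambda>z. F (\<theta>', z)) sequentially"
proof (rule uniform_limitI)
  fix e :: real assume e: "0 < e"
  have "uniformly_continuous_on (A \<times> B) F"
    by (intro compact_uniformly_continuous F compact_Times A B)
  then obtain \<delta> where \<delta>: "0 < \<delta>" "\<And>x x'. x \<in> A \<times> B \<Longrightarrow> x' \<in> A \<times> B \<Longrightarrow> dist x' x < \<delta> \<Longrightarrow> dist (F x') (F x) < e"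
    using e unfolding uniformly_continuous_on_def by metis
  have "\<forall>\<^sub>F j in sequentially. dist (\<theta> j) \<theta>' < \<delta>" using \<theta>(3) \<delta>(1) by (rule tendstoD)
  then show "\<forall>\<^sub>F j in sequentially. \<forall>z\<in>B. dist (F (\<theta> j, z)) (F (\<theta>', z)) < e"
    by eventually_elim (auto intro!: \<delta>(2) \<theta> simp: dist_Pair_Pair)
qed

section \<open>The limiting contrast and the deterministic consistency argument\<close>

lemma AE_T_off_axes: "AE p in T. 0 < chord (fst p) \<and> 0 < chord (snd p)"
proof -
  have "emeasure lborel ({0::real} \<times> (UNIV::real set))
      = 0" "emeasure lborel ((UNIV::real set) \<times> {0::real}) = 0"
    unfolding lborel_prod[symmetric] by (subst lborel.emeasure_pair_measure_Times; simp)+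
  moreover have "{0::real} \<times> (UNIV::real set) \<in> sets lborel" "(UNIV::real set) \<times> {0::real} \<in> sets lborel"
    by (simp_all add: borel_Times)
  ultimately have n: "{0::real} \<times> (UNIV::real set) \<in> null_sets lborel"
      "(UNIV::real set) \<times> {0::real} \<in> null_sets lborel"
    by auto
  have "AE p in lborel. (fst p :: real) \<noteq> 0 \<and> (snd p :: real) \<noteq> 0"
    using AE_not_in[OF n(1)] AE_not_in[OF n(2)] by eventually_elim auto
  then have "AE p in lborel. p \<in> I2 \<longrightarrow> 0 < chord (fst p) \<and> 0 < chord (snd p)"
    by eventually_elim (auto simp: I2_def intro!: chord_pos)
  then show ?thesis by (subst AE_restrict_space_iff) auto
qed

definition lphi :: "real \<Rightarrow> real \<Rightarrow> real \<Rightarrow> real" where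
  "lphi \<rho> d x = 2 * d * ln (chord x) + 2 * ln (cmod (1 - of_real \<rho> * cis x))"

lemma integrable_lphi: "\<bar>\<rho>\<bar> < 1 \<Longrightarrow> integrable J (lphi \<rho> d)"
  unfolding lphi_def by (intro Bochner_Integration.integrable_add integrable_mult_right
      integrable_ln_chord integrable_ln_cmod)

lemma integral_lphi: "\<bar>\<rho>\<bar> < 1 \<Longrightarrow> integral\<^sup>L J (lphi \<rho> d) = 0"
  unfolding lphi_def by (simp add: integrable_ln_chord integrable_ln_cmod integral_ln_chord
      integral_ln_cmod)

lemma ln_phi: "\<bar>\<rho>\<bar> < 1 \<Longrightarrow> 0 < chord x \<Longrightarrow> ln (phi \<rho> d x) = lphi \<rho> d x"
proof -
  assume "\<bar>\<rho>\<bar> < 1" and c: "0 < chord x"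
  then have "0 < cmod (1 - of_real \<rho> * cis x)"
    using one_minus_cis_lower[of \<rho> x] by linarith
  moreover from c have "0 < chord x powr (2 * d)" by simp
  ultimately show ?thesis
    using c unfolding phi_def lphi_def by (subst ln_mult) (simp_all add: ln_powr ln_realpow)
qed

lemma integral_T_fst_snd:
  fixes g :: "real \<Rightarrow> real"
  assumes "integrable J g"
  shows "integrable T (\<lambda>p. g (fst p))" "integrable T (\<lambda>p. g (snd p))"
    "integral\<^sup>L T (\<lambda>p. g (fst p)) = 2 * pi * integral\<^sup>L J g"
    "integral\<^sup>L T (\<lambda>p. g (snd p)) = 2 * pi * integral\<^sup>L J g"
proof -
  have 1: "integrable J (\<lambda>_. 1::real)" by simp
  show "integrable T (\<lambda>p. g (fst p))" "integrable T (\<lambda>p. g (snd p))"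
    using integrable_T_product[OF assms 1] integrable_T_product[OF 1 assms] by simp_all
  show "integral\<^sup>L T (\<lambda>p. g (fst p)) = 2 * pi * integral\<^sup>L J g"
    "integral\<^sup>L T (\<lambda>p. g (snd p)) = 2 * pi * integral\<^sup>L J g"
    using integral_T_product[OF assms 1] integral_T_product[OF 1 assms]
        by (simp_all add: measure_restrict_space)
qed

text \<open>
Write \<open>u\<close> for the quotient \<open>f(\<theta>\<^sub>0) / f(\<theta>)\<close>, \<open>l\<close> for its logarithm and \<open>c n\<close> for the cutoffs.
Suppose that \<open>\<integral> c n u \<le> 4 \<pi>\<^sup>2\<close> for all \<open>n\<close>. Since \<open>l\<close> has integral zero,
\<open>\<integral> c n (1 + l)\<close> tends to \<open>4 \<pi>\<^sup>2\<close>, so the integrals of the nonnegative functions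
\<open>c n (u - 1 - l)\<close>, which increase with \<open>n\<close>, are all zero. Hence \<open>u = 1\<close> almost everywhere, by
continuity everywhere on the open square \<open>(0, \<pi>)\<^sup>2\<close>, and identifiability of the factors contradicts
\<open>\<theta> \<noteq> \<theta>\<^sub>0\<close>. The cutoffs are there because the contrast, the integral of \<open>u\<close>, can be infinite.
\<close>

lemma contrast_gap:
  fixes \<alpha> \<beta> d1 d2 \<alpha>0 \<beta>0 d10 d20 \<sigma> :: real
  defines "f \<equiv> \<lambda>p. farima_density \<sigma> (\<alpha>0, \<beta>0, d10, d20) (fst p) (snd p)"
  assumes \<sigma>: "\<sigma> \<noteq> 0" and f: "integrable T f"
    and \<rho>: "\<bar>\<alpha>\<bar> < 1" "\<bar>\<beta>\<bar> < 1" "\<bar>\<alpha>0\<bar> < 1" "\<bar>\<beta>0\<bar> < 1"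
    and ne: "(\<alpha>, \<beta>, d1, d2) \<noteq> (\<alpha>0, \<beta>0, d10, d20)"
  shows "\<exists>n. 4 * pi\<^sup>2 < integral\<^sup>L T (\<lambda>p. trunc_inverse_density \<sigma> n (\<alpha>, \<beta>, d1, d2)
      (torus_point p) * f p)"
proof (rule ccontr)
  assume "\<nexists>n. 4 * pi\<^sup>2 < integral\<^sup>L T (\<lambda>p. trunc_inverse_density \<sigma> n (\<alpha>, \<beta>, d1, d2)
      (torus_point p) * f p)"
  then have small: "integral\<^sup>L T (\<lambda>p. trunc_inverse_density \<sigma> n (\<alpha>, \<beta>, d1, d2)
      (torus_point p) * f p) \<le> 4 * pi\<^sup>2" for n
    by (simp add: not_less)
  define a where "a x = phi \<alpha> d1 x / phi \<alpha>0 d10 x" for x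
  define b where "b y = phi \<beta> d2 y / phi \<beta>0 d20 y" for y
  define u where "u p = a (fst p) * b (snd p)" for p
  define l where "l p = (lphi \<alpha> d1 (fst p) - lphi \<alpha>0 d10 (fst p)) + (lphi \<beta> d2
      (snd p) - lphi \<beta>0 d20 (snd p))" for p
  define c where "c n p = cutoff n (chord (fst p)) * cutoff n (chord (snd p))" for n p
  define m where "m p = u p - (1 + l p)" for p
  have cu: "trunc_inverse_density \<sigma> n (\<alpha>, \<beta>, d1, d2) (torus_point p) * f p = c n p * u p" for n p
    unfolding f_def farima_density_eq trunc_inverse_density_torus_point c_def u_def a_def b_def
        using \<sigma> by simp
  have apos: "0 < a x" and aln: "ln (a x) = lphi \<alpha> d1 x - lphi \<alpha>0 d10 x" if "0 < chord x" for x
    using phi_pos[OF \<rho>(1) that, of d1] phi_pos[OF \<rho>(3) that, of d10] that \<rho>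
        by (simp_all add: a_def ln_div ln_phi)
  have bpos: "0 < b x" and bln: "ln (b x) = lphi \<beta> d2 x - lphi \<beta>0 d20 x" if "0 < chord x" for x
    using phi_pos[OF \<rho>(2) that, of d2] phi_pos[OF \<rho>(4) that, of d20] that \<rho>
        by (simp_all add: b_def ln_div ln_phi)
  have upos: "0 < u p" and lnu: "ln (u p) = l p" if "0 < chord (fst p)" "0 < chord (snd p)" for p
    using apos[OF that(1)] bpos[OF that(2)] aln[OF that(1)] bln[OF that(2)]
        by (simp_all add: u_def l_def ln_mult)
  have m0: "0 \<le> m p" if "0 < chord (fst p)" "0 < chord (snd p)" for p
    using ln_le_minus_one[OF upos[OF that]] by (simp add: lnu[OF that] m_def)
  have c01: "0 \<le> c n p" "c n p \<le> 1" for n p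
    unfolding c_def using cutoff_bounds by (auto intro: mult_le_one)
  have cmono: "c k p \<le> c n p" if "k \<le> n" for k n p
    unfolding c_def using that cutoff_bounds by (intro mult_mono cutoff_mono) auto
  have c_zero: "c n p = 0" if "\<not> (0 < chord (fst p) \<and> 0 < chord (snd p))" for n p
  proof -
    have "chord (fst p) = 0 \<or> chord (snd p) = 0"
      using that chord_nonneg[of "fst p"] chord_nonneg[of "snd p"] by linarith
    then show ?thesis by (auto simp: c_def)
  qed
  have cm0: "0 \<le> c n p * m p" for n p
  proof (cases "0 < chord (fst p) \<and> 0 < chord (snd p)")
    case True
    then show ?thesis by (intro mult_nonneg_nonneg c01 m0) auto
  qed (simp add: c_zero)
  have il: "integrable T l" unfolding l_def
    by (intro Bochner_Integration.integrable_add Bochner_Integration.integrable_diff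
        integral_T_fst_snd integrable_lphi \<rho>)
  have vl: "integral\<^sup>L T l = 0"
    unfolding l_def using \<rho> by (simp add: integral_T_fst_snd integrable_lphi integral_lphi)
  have icu: "integrable T (\<lambda>p. c n p * u p)" for n
  proof -
    have "continuous_on UNIV (\<lambda>q. trunc_inverse_density \<sigma> n (\<alpha>, \<beta>, d1, d2) q)"
      by (rule continuous_on_compose2[OF continuous_trunc_inverse_density, of _ "\<lambda>q.
          ((\<alpha>, \<beta>, d1, d2), q)", simplified]) (intro continuous_intros)
    then have "continuous_on UNIV (\<lambda>p. trunc_inverse_density \<sigma> n (\<alpha>, \<beta>, d1, d2) (torus_point p))"
      by (rule continuous_on_compose2[OF _ continuous_torus_point]) auto
    from integrable_T_mult_bounded[OF f this] show ?thesis by (simp add: cu)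
  qed
  have cc: "continuous_on UNIV (c n)" for n
    unfolding c_def cutoff_def by (intro continuous_intros continuous_on_compose2[OF
        continuous_chord[of UNIV]]) auto
  have icl: "integrable T (\<lambda>p. c n p * (1 + l p))" for n
    using integrable_T_mult_bounded[OF Bochner_Integration.integrable_add[OF T.integrable_const[of
        1] il] cc[of n]] by simp
  have icm: "integrable T (\<lambda>p. c n p * m p)" for n
    unfolding m_def right_diff_distrib[of _ "u _"] by (intro Bochner_Integration.integrable_diff icu icl)
  have lim: "(\<lambda>n. integral\<^sup>L T (\<lambda>p. c n p * (1 + l p))) \<longlonglongrightarrow> integral\<^sup>L T (\<lambda>p. 1 + l p)"
  proof (rule integral_dominated_convergence[where w = "\<lambda>p. \<bar>1 + l p\<bar>"])
    show "AE p in T. (\<lambda>n. c n p * (1 + l p)) \<longlonglongrightarrow> 1 + l p"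
      using AE_T_off_axes
    proof eventually_elim
      case (elim p)
      then have "(\<lambda>n. c n p) \<longlonglongrightarrow> 1 * 1" unfolding c_def by (intro tendsto_mult cutoff_tendsto) auto
      from tendsto_mult_right[OF this, of "1 + l p"] show ?case by simp
    qed
    show "AE p in T. norm (c n p * (1 + l p)) \<le> \<bar>1 + l p\<bar>" for n
      using c01[of n] by (auto simp: abs_mult intro!: mult_left_le_one_le)
  qed (use il icl in \<open>auto intro: borel_measurable_integrable\<close>)
  have tot: "integral\<^sup>L T (\<lambda>p. 1 + l p) = 4 * pi\<^sup>2"
    using il by (simp add: vl measure_T)
  have zero: "integral\<^sup>L T (\<lambda>p. c k p * m p) = 0" for k
  proof (rule antisym)
    show "0 \<le> integral\<^sup>L T (\<lambda>p. c k p * m p)" by (intro integral_nonneg_AE AE_I2 cm0)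
    have "integral\<^sup>L T (\<lambda>p. c k p * m p) \<le> 4 * pi\<^sup>2 - integral\<^sup>L T (\<lambda>p. c n p * (1 + l p))" if "k
        \<le> n" for n
    proof -
      have "c k p * m p \<le> c n p * m p" for p
      proof (cases "0 < chord (fst p) \<and> 0 < chord (snd p)")
        case True
        then show ?thesis by (intro mult_right_mono cmono that m0) auto
      qed (simp add: c_zero)
      then have "integral\<^sup>L T (\<lambda>p. c k p * m p) \<le> integral\<^sup>L T (\<lambda>p. c n p * m p)"
        by (intro integral_mono icm)
      also have "\<dots> = integral\<^sup>L T (\<lambda>p. c n p * u p) - integral\<^sup>L T (\<lambda>p. c n p * (1 + l p))"
        unfolding m_def right_diff_distrib[of _ "u _"]
            by (intro Bochner_Integration.integral_diff icu icl)
      finally show ?thesis using small[of n] unfolding cu by simp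
    qed
    then have ev: "\<forall>\<^sub>F n in sequentially. integral\<^sup>L T (\<lambda>p. c k p * m p)
        \<le> 4 * pi\<^sup>2 - integral\<^sup>L T (\<lambda>p. c n p * (1 + l p))"
      by (rule eventually_sequentiallyI)
    have "(\<lambda>n. 4 * pi\<^sup>2 - integral\<^sup>L T (\<lambda>p. c n p * (1 + l p))) \<longlonglongrightarrow> 0"
      using tendsto_diff[OF tendsto_const lim, of "4 * pi\<^sup>2"] by (simp add: tot)
    from tendsto_lowerbound[OF this ev] show "integral\<^sup>L T (\<lambda>p. c k p * m p) \<le> 0" by simp
  qed
  have "AE p in T. \<forall>k. c k p * m p = 0"
    unfolding AE_all_countable
  proof
    fix k
    have "AE p in T. 0 \<le> c k p * m p" by (intro AE_I2 cm0)
    from integral_nonneg_eq_0_iff_AE[OF icm this] show "AE p in T. c k p * m p = 0"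
        using zero[of k] by simp
  qed
  then have "AE p in T. u p = 1"
    using AE_T_off_axes
  proof eventually_elim
    case (elim p)
    then have "(\<lambda>n. c n p) \<longlonglongrightarrow> 1 * 1" unfolding c_def by (intro tendsto_mult cutoff_tendsto) auto
    then have "\<forall>\<^sub>F n in sequentially. 0 < c n p" by (intro order_tendstoD) auto
    from eventually_happens'[OF sequentially_bot this] obtain n where "0 < c n p" by (rule exE)
    moreover have "c n p * m p = 0" using elim(1) by (rule spec)
    ultimately have "m p = 0" by simp
    then have "ln (u p) = u p - 1" using lnu[of p] elim by (simp add: m_def)
    moreover have "0 < u p" using elim by (intro upos) auto
    ultimately show ?case by (intro ln_eq_minus_one)
  qed
  then have ae: "AE p in lborel. p \<in> I2 \<longrightarrow> u p = 1"
    by (subst (asm) AE_restrict_space_iff) auto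
  define D where "D = {0<..<pi} \<times> {0<..<pi}"
  have oD: "open D" unfolding D_def by (intro open_Times) auto
  have cphi: "continuous_on {0<..<pi} (phi \<rho>' d')" for \<rho>' d'
  proof -
    have "chord x \<noteq> 0" if "x \<in> {0<..<pi}" for x using chord_pos_interior[of x] that by simp
    then show ?thesis
      unfolding phi_def by (intro continuous_intros continuous_on_powr) auto
  qed
  have nz: "\<forall>x\<in>{0<..<pi}. phi \<rho>' d' x \<noteq> 0" if "\<bar>\<rho>'\<bar> < 1" for \<rho>' d'
  proof
    fix x assume "x \<in> {0<..<pi}"
    then have "0 < phi \<rho>' d' x" by (intro phi_pos that chord_pos_interior) auto
    then show "phi \<rho>' d' x \<noteq> 0" by simp
  qed
  have ca: "continuous_on {0<..<pi} a" and cb: "continuous_on {0<..<pi} b"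
    unfolding a_def b_def by (intro continuous_on_divide cphi nz \<rho>)+
  have cu': "continuous_on D u"
    unfolding u_def D_def
    by (intro continuous_on_mult continuous_on_compose2[OF ca] continuous_on_compose2[OF cb]
        continuous_intros) auto
  define V where "V = D \<inter> u -` (- {1})"
  have oV: "open V" unfolding V_def by (intro continuous_open_preimage cu' oD) auto
  have Ve: "V = {}"
  proof (rule ccontr)
    assume "V \<noteq> {}"
    then have nn: "\<not> negligible V" using oV open_not_negligible by blast
    have "D \<subseteq> I2" by (auto simp: D_def I2_def)
    then have "AE p in lborel. p \<notin> V" 
      by (intro eventually_mono[OF ae]) (auto simp: V_def)
    then have "V \<in> null_sets lborel" using oV by (subst AE_iff_null_sets) auto
    then have "V \<in> null_sets lebesgue" by (rule null_sets_completionI)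
    with nn show False by (simp add: negligible_iff_null_sets)
  qed
  have one: "a x * b y = 1" if "0 < x" "x < pi" "0 < y" "y < pi" for x y
  proof -
    have "(x, y) \<in> D" using that by (simp add: D_def)
    moreover have "(x, y) \<notin> V" using Ve by simp
    ultimately show ?thesis by (simp add: V_def u_def)
  qed
  have h: "0 < pi / 2" "pi / 2 < pi" by auto
  have "phi \<alpha> d1 x = (1 / b (pi / 2)) * phi \<alpha>0 d10 x" if "0 < x" "x < pi" for x
    using one[OF that h] bpos[OF chord_pos_interior[OF h]] phi_pos[OF \<rho>(3) chord_pos_interior[OF
        that], of d10]
    by (simp add: a_def field_simps)
  from phi_identifiable[OF this _ \<rho>(1,3)] have A: "\<alpha> = \<alpha>0 \<and> d1 = d10"
    using bpos[OF chord_pos_interior[OF h]] by simp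
  have "phi \<beta> d2 x = (1 / a (pi / 2)) * phi \<beta>0 d20 x" if "0 < x" "x < pi" for x
    using one[OF h that] apos[OF chord_pos_interior[OF h]] phi_pos[OF \<rho>(4) chord_pos_interior[OF
        that], of d20]
    by (simp add: b_def field_simps)
  from phi_identifiable[OF this _ \<rho>(2,4)] have B: "\<beta> = \<beta>0 \<and> d2 = d20"
    using apos[OF chord_pos_interior[OF h]] by simp
  show False using A B ne by simp
qed

definition whittle_objective :: "real \<Rightarrow> (real \<times> real \<Rightarrow> real) \<Rightarrow> param \<Rightarrow> real" where
  "whittle_objective \<sigma> I \<theta> = integral\<^sup>L T (\<lambda>p. I p / farima_density \<sigma> \<theta> (fst p) (snd p))"

lemma whittle_integrable:
  assumes I: "continuous_on UNIV I" and r: "r < 1" and s: "s < 1/2" and \<theta>: "\<theta> \<in> Theta r s"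
  shows "integrable T (\<lambda>p. I p / farima_density \<sigma> \<theta> (fst p) (snd p))"
proof -
  obtain \<alpha> \<beta> d1 d2 where t: "\<theta> = (\<alpha>, \<beta>, d1, d2)" by (cases \<theta>)
  have "integrable T (\<lambda>p. phi \<alpha> d1 (fst p) * phi \<beta> d2 (snd p))"
    using \<theta> r s by (intro integrable_T_product integrable_phi) (auto simp: t Theta_def)
  from integrable_mult_left[OF integrable_T_mult_bounded[OF this I], of "4 * pi\<^sup>2 / \<sigma>\<^sup>2"] show ?thesis
    unfolding t farima_density_eq by (simp add: mult_ac)
qed

lemma trunc_inverse_density_le_whittle:
  assumes I: "continuous_on UNIV I" "\<And>p. 0 \<le> I p" and r: "r < 1" and s: "s < 1/2" and \<theta>: "\<theta> \<in> Theta r s"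
  shows "integral\<^sup>L T (\<lambda>p. trunc_inverse_density \<sigma> n \<theta> (torus_point p) * I p) \<le> whittle_objective \<sigma> I \<theta>"
  unfolding whittle_objective_def
proof (rule integral_mono')
  show "integrable T (\<lambda>p. I p / farima_density \<sigma> \<theta> (fst p) (snd p))" by (rule whittle_integrable) fact+
  obtain \<alpha> \<beta> d1 d2 where t: "\<theta> = (\<alpha>, \<beta>, d1, d2)" by (cases \<theta>)
  fix p
  let ?P = "phi \<alpha> d1 (fst p) * phi \<beta> d2 (snd p)"
  have P: "0 \<le> ?P" by (simp add: phi_nonneg)
  have e: "I p / farima_density \<sigma> \<theta> (fst p) (snd p) = 4 * pi\<^sup>2 / \<sigma>\<^sup>2 * ?P * I p"
    unfolding t farima_density_eq by simp
  show "0 \<le> I p / farima_density \<sigma> \<theta> (fst p) (snd p)"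
    unfolding e using P I by (auto intro!: mult_nonneg_nonneg divide_nonneg_nonneg phi_nonneg)
  have "cutoff n (chord (fst p)) * cutoff n (chord (snd p)) * ?P \<le> 1 * ?P"
    using cutoff_bounds by (intro mult_right_mono P mult_le_one)
  then have "4 * pi\<^sup>2 / \<sigma>\<^sup>2 * (cutoff n (chord (fst p)) * cutoff n (chord (snd p)) * ?P) * I p
      \<le> 4 * pi\<^sup>2 / \<sigma>\<^sup>2 * ?P * I p"
    using I by (intro mult_right_mono mult_left_mono) auto
  then show "trunc_inverse_density \<sigma> n \<theta> (torus_point p) * I p
      \<le> I p / farima_density \<sigma> \<theta> (fst p) (snd p)"
    unfolding e unfolding t trunc_inverse_density_torus_point .
qed

text \<open>
Otherwise a subsequence of the estimates, all at distance at least \<open>e\<close> from \<open>\<theta>\<^sub>0\<close>, converges to some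
\<open>\<theta> \<noteq> \<theta>\<^sub>0\<close> in the compact parameter set. Along it the objective at the estimate is at least the
integral of the periodogram against the truncated reciprocal density, with a limit above
\<open>4 \<pi>\<^sup>2 \<kappa>\<close>, while the objective at \<open>\<theta>\<^sub>0\<close> tends to \<open>4 \<pi>\<^sup>2 \<kappa>\<close>.
\<close>

lemma (in weak_limit) whittle_consistency:
  fixes \<alpha>0 \<beta>0 d10 d20 \<sigma> r s :: real and hat :: "nat \<Rightarrow> param"
  defines "\<theta>0 \<equiv> (\<alpha>0, \<beta>0, d10, d20)"
  assumes f: "f = (\<lambda>p. farima_density \<sigma> \<theta>0 (fst p) (snd p))" and \<sigma>: "\<sigma> \<noteq> 0" and pos: "0 < \<kappa>"
    and I: "\<And>N. continuous_on UNIV (I N)"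
    and d: "0 < d10" "0 < d20" and r: "r < 1" and s: "s < 1/2" and \<theta>0: "\<theta>0 \<in> Theta r s"
    and hat: "\<And>N. 1 \<le> N \<Longrightarrow> hat N \<in> Theta r s"
    and min: "\<And>N. 1 \<le> N \<Longrightarrow> whittle_objective \<sigma> (I N) (hat N) \<le> whittle_objective \<sigma> (I N) \<theta>0"
  shows "hat \<longlonglongrightarrow> \<theta>0"
proof (rule ccontr)
  assume "\<not> hat \<longlonglongrightarrow> \<theta>0"
  then obtain e where e: "0 < e" "\<not> (\<forall>\<^sub>F N in sequentially. dist (hat N) \<theta>0 < e)"
    unfolding tendsto_iff by blast
  define S where "S = {N. 1 \<le> N \<and> e \<le> dist (hat N) \<theta>0}"
  have "infinite S"
    unfolding infinite_nat_iff_unbounded_le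
  proof
    fix m
    show "\<exists>n\<ge>m. n \<in> S"
    proof (rule ccontr)
      assume "\<not> (\<exists>n\<ge>m. n \<in> S)"
      then have "n \<notin> S" if "max 1 m \<le> n" for n using that by auto
      then have "\<forall>n\<ge>max 1 m. dist (hat n) \<theta>0 < e" by (simp add: S_def not_le)
      then show False using e(2) unfolding eventually_sequentially by blast
    qed
  qed
  then obtain r1 :: "nat \<Rightarrow> nat" where r1: "strict_mono r1" "\<And>j. r1 j \<in> S"
    using infinite_enumerate by blast
  have "\<forall>j. (hat \<circ> r1) j \<in> Theta r s" using r1(2) hat by (auto simp: S_def)
  with compact_Theta[unfolded compact_def] obtain \<theta> r2 where
    \<theta>: "\<theta> \<in> Theta r s" and r2: "strict_mono r2" and lim: "((hat \<circ> r1) \<circ> r2) \<longlonglongrightarrow> \<theta>"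
    by metis
  define k where "k = r1 \<circ> r2"
  have k: "strict_mono k" unfolding k_def using r1(1) r2 by (rule strict_mono_o)
  have k1: "1 \<le> k j" "hat (k j) \<in> Theta r s" "e \<le> dist (hat (k j)) \<theta>0" for j
    using r1(2)[of "r2 j"] hat by (auto simp: S_def k_def)
  have lim': "(\<lambda>j. hat (k j)) \<longlonglongrightarrow> \<theta>" using lim by (simp add: k_def o_def)
  have "e \<le> dist \<theta> \<theta>0"
    by (rule tendsto_lowerbound[OF tendsto_dist[OF lim' tendsto_const]]) (use k1 in auto)
  then have ne: "\<theta> \<noteq> \<theta>0" using e by auto
  obtain \<alpha> \<beta> d1 d2 where t: "\<theta> = (\<alpha>, \<beta>, d1, d2)" by (cases \<theta>)
  have \<rho>: "\<bar>\<alpha>\<bar> < 1" "\<bar>\<beta>\<bar> < 1" "\<bar>\<alpha>0\<bar> < 1" "\<bar>\<beta>0\<bar> < 1"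
    using \<theta> \<theta>0 r by (auto simp: t \<theta>0_def Theta_def)
  obtain n where n: "4 * pi\<^sup>2 < integral\<^sup>L T (\<lambda>p. trunc_inverse_density \<sigma> n \<theta> (torus_point p) * f p)"
    using contrast_gap[OF \<sigma> f_integrable[unfolded f \<theta>0_def] \<rho> ne[unfolded t \<theta>0_def]]
    unfolding f \<theta>0_def t by (rule exE)
  have cd: "continuous_on torus (trunc_inverse_density \<sigma> n \<theta>')" for \<theta>'
    by (rule continuous_on_compose2[OF continuous_trunc_inverse_density, of _ "\<lambda>q.
        (\<theta>', q)", simplified]) (intro continuous_intros)
  have "uniform_limit torus (\<lambda>j z. trunc_inverse_density \<sigma> n (hat (k j)) z)
      (trunc_inverse_density \<sigma> n \<theta>) sequentially"
    using uniform_limit_parameter[OF continuous_on_subset[OF continuous_trunc_inverse_density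
        subset_UNIV] compact_Theta compact_torus, of "\<lambda>j. hat (k j)" r s \<theta> \<sigma> n]
      k1 \<theta> lim' by simp
  then have lo: "(\<lambda>j. integral\<^sup>L T (\<lambda>p. trunc_inverse_density \<sigma> n (hat (k j)) (torus_point p) * I
      (k j) p)) \<longlonglongrightarrow> \<kappa> * integral\<^sup>L T (\<lambda>p. trunc_inverse_density \<sigma> n \<theta> (torus_point p) * f p)"
    by (intro continuous_limit_subseq cd k)
  \<comment> \<open>The reciprocal density at \<open>\<theta>\<^sub>0\<close>, continuous on the torus because \<open>d10\<close> and \<open>d20\<close> are positive.\<close>
  define G where "G z = 4 * pi\<^sup>2 / \<sigma>\<^sup>2 * ((cmod (1 - fst z) powr (2 * d10) * (cmod
      (1 - of_real \<alpha>0 * fst z))\<^sup>2) *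
     (cmod (1 - snd z) powr (2 * d20) * (cmod (1 - of_real \<beta>0 * snd z))\<^sup>2))" for z :: "complex \<times> complex"
  have Gc: "continuous_on torus G"
  proof -
    have "continuous_on torus (\<lambda>z. cmod (1 - fst z) powr (2 * d10))"
      "continuous_on torus (\<lambda>z. cmod (1 - snd z) powr (2 * d20))"
      using d by (intro continuous_on_powr' continuous_intros ballI; simp)+
    then show ?thesis unfolding G_def
      by (intro continuous_on_mult continuous_on_const continuous_on_power continuous_on_norm
          continuous_on_diff
          continuous_on_fst continuous_on_snd continuous_on_id)
  qed
  have Gt: "G (torus_point p) = 4 * pi\<^sup>2 / \<sigma>\<^sup>2 * (phi \<alpha>0 d10 (fst p) * phi \<beta>0 d20 (snd p))" for p
    by (simp add: G_def torus_point_def phi_def chord_def)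
  have GI: "whittle_objective \<sigma> (I N) \<theta>0 = integral\<^sup>L T (\<lambda>p. G (torus_point p) * I N p)" for N
    unfolding whittle_objective_def Gt \<theta>0_def farima_density_eq by (simp add: mult_ac)
  have "integral\<^sup>L T (\<lambda>p. G (torus_point p) * f p) = integral\<^sup>L T (\<lambda>p. 1)"
  proof (rule integral_cong_AE)
    show "AE p in T. G (torus_point p) * f p = 1"
      using AE_T_off_axes
    proof eventually_elim
      case (elim p)
      then show ?case using phi_pos[OF \<rho>(3), of "fst p" d10] phi_pos[OF \<rho>(4), of "snd p" d20] \<sigma>
        unfolding Gt f \<theta>0_def farima_density_eq by simp
    qed
    show "(\<lambda>p. G (torus_point p) * f p) \<in> borel_measurable T"
      by (intro borel_measurable_integrable integrable_mult_torus f_integrable Gc)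
  qed simp
  then have "integral\<^sup>L T (\<lambda>p. G (torus_point p) * f p) = 4 * pi\<^sup>2" by (simp add: measure_T)
  then have hi: "(\<lambda>j. whittle_objective \<sigma> (I (k j)) \<theta>0) \<longlonglongrightarrow> \<kappa> * (4 * pi\<^sup>2)"
    using LIMSEQ_subseq_LIMSEQ[OF continuous_limit[OF Gc] k] by (simp add: GI o_def)
  have "\<kappa> * integral\<^sup>L T (\<lambda>p. trunc_inverse_density \<sigma> n \<theta> (torus_point p) * f p) \<le> \<kappa> * (4 * pi\<^sup>2)"
  proof (rule LIMSEQ_le[OF lo hi], intro exI[of _ 0] allI impI)
    fix j
    have "integral\<^sup>L T (\<lambda>p. trunc_inverse_density \<sigma> n (hat (k j)) (torus_point p) * I (k j) p)
        \<le> whittle_objective \<sigma> (I (k j)) (hat (k j))"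
      by (rule trunc_inverse_density_le_whittle[OF I I_nonneg r s k1(2)])
    also have "\<dots> \<le> whittle_objective \<sigma> (I (k j)) \<theta>0" by (rule min[OF k1(1)])
    finally show "integral\<^sup>L T (\<lambda>p. trunc_inverse_density \<sigma> n (hat (k j)) (torus_point p) * I
        (k j) p) \<le> whittle_objective \<sigma> (I (k j)) \<theta>0" .
  qed
  then show False using n pos by simp
qed

section \<open>Almost sure convergence of the periodogram and consistency\<close>

lemma (in prob_space) centred_gaussian_of_process:
  assumes meas: "\<And>u. Z u \<in> borel_measurable M" and int: "\<And>u. integrable M (Z u)"
    and mean: "\<And>u. expectation (Z u) = \<mu>" and gauss: "gaussian_process M Z"
  shows "centred_gaussian M (\<lambda>u \<omega>. Z u \<omega> - \<mu>)"
proof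
  show "(\<lambda>\<omega>. Z u \<omega> - \<mu>) \<in> borel_measurable M" for u using meas[of u] by measurable
  fix U assume "lincomb (\<lambda>u \<omega>. Z u \<omega> - \<mu>) U"
  then obtain F c where F: "finite F" "U = (\<lambda>\<omega>. \<Sum>u\<in>F. c u * (Z u \<omega> - \<mu>))" unfolding lincomb_def
      by (elim exE conjE)
  define V where "V \<omega> = (\<Sum>u\<in>F. c u * Z u \<omega>)" for \<omega>
  have V: "gaussian_rv M V" using gauss F(1) unfolding gaussian_process_def V_def[abs_def] by simp
  have "expectation V = (\<Sum>u\<in>F. c u * \<mu>)" unfolding V_def[abs_def] by (simp add: int mean)
  then have U: "U = (\<lambda>\<omega>. V \<omega> - expectation V)" 
    unfolding F(2) V_def by (simp add: right_diff_distrib sum_subtractf)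
  show "integrable M (\<lambda>\<omega>. U \<omega> ^ 4)"
    and "expectation (\<lambda>\<omega>. U \<omega> ^ 4) = 3 * (expectation (\<lambda>\<omega>. (U \<omega>)\<^sup>2))\<^sup>2"
    unfolding U by (rule gaussian_fourth_moment[OF V])+
qed

lemma has_spectral_density_T:
  assumes "has_spectral_density M X h"
  shows "integrable T (\<lambda>p. h (fst p) (snd p))"
    and "complex_of_real (autocov M X (fst g) (snd g))
        = integral\<^sup>L T (\<lambda>p. chi g p * of_real (h (fst p) (snd p)))"
proof -
  show "integrable T (\<lambda>p. h (fst p) (snd p))"
    using assms unfolding has_spectral_density_def set_integrable_def
    by (simp add: integrable_restrict_space case_prod_unfold)
  have "complex_of_real (autocov M X (fst g) (snd g)) = set_lebesgue_integral lborel I2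
      (\<lambda>(x, y). exp (\<i> * complex_of_real (of_int (fst g) * x + of_int
          (snd g) * y)) * complex_of_real (h x y))"
    using assms unfolding has_spectral_density_def by (elim conjE allE)
  then show "complex_of_real (autocov M X (fst g) (snd g))
      = integral\<^sup>L T (\<lambda>p. chi g p * of_real (h (fst p) (snd p)))"
    unfolding set_lebesgue_integral_def by (subst integral_restrict_space)
        (simp_all add: case_prod_unfold chi_def cis_conv_exp)
qed

lemma sigma2_N_eq_whittle_objective: "sigma2_N X \<sigma> N \<omega> \<theta>
    = whittle_objective \<sigma> (\<lambda>p. periodogram X N \<omega> (fst p) (snd p)) \<theta>"
  unfolding sigma2_N_def whittle_objective_def set_lebesgue_integral_def
  by (subst integral_restrict_space) (simp_all add: case_prod_unfold)

lemma farima_density_le: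
  assumes "\<bar>\<alpha>\<bar> < 1" "\<bar>\<beta>\<bar> < 1"
  shows "farima_density \<sigma> (\<alpha>, \<beta>, d1, d2) x y
    \<le> \<sigma>\<^sup>2 / (4 * pi\<^sup>2) / ((1 - \<bar>\<alpha>\<bar>)\<^sup>2 * (1 - \<bar>\<beta>\<bar>)\<^sup>2) * (chord x powr (- 2 * d1) * chord y powr
        (- 2 * d2))"
proof -
  have "1 / phi \<alpha> d1 x * (1 / phi \<beta> d2 y) \<le> chord x powr (- 2 * d1) / (1 - \<bar>\<alpha>\<bar>)\<^sup>2 * (chord y powr
      (- 2 * d2) / (1 - \<bar>\<beta>\<bar>)\<^sup>2)"
    using assms by (intro mult_mono inverse_phi_le) (auto simp: phi_nonneg)
  from mult_left_mono[OF this, of "\<sigma>\<^sup>2 / (4 * pi\<^sup>2)"] show ?thesis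
    unfolding farima_density_eq by simp
qed

text \<open>
The exceptional null set does not depend on the lag \<open>h\<close>, because there are countably many lags.
\<close>

lemma AE_periodogram_moments:
  fixes X :: "int \<Rightarrow> int \<Rightarrow> 'a \<Rightarrow> real" and \<sigma> \<alpha> \<beta> d1 d2 :: real
  defines "f \<equiv> \<lambda>p. farima_density \<sigma> (\<alpha>, \<beta>, d1, d2) (fst p) (snd p)"
  assumes M: "prob_space M" and stat: "stationary M X" and gauss: "gaussian_process M (\<lambda>(i, j). X i j)"
    and \<sigma>: "\<sigma>\<^sup>2 > 0" and \<rho>: "\<bar>\<alpha>\<bar> < 1" "\<bar>\<beta>\<bar> < 1" and d: "0 < d1" "d1 < 1/2" "0 < d2" "d2 < 1/2"
    and sd: "has_spectral_density M X (farima_density \<sigma> (\<alpha>, \<beta>, d1, d2))"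
  shows "AE \<omega> in M. \<forall>h. (\<lambda>N. integral\<^sup>L T (\<lambda>p. chi h p * of_real (periodogram X N \<omega> (fst p) (snd p))))
     \<longlonglongrightarrow> of_real (4 * pi\<^sup>2) * integral\<^sup>L T (\<lambda>p. chi h p * of_real (f p))"
proof -
  interpret prob_space M by fact
  obtain \<mu> where \<mu>: "\<And>s t. expectation (X s t) = \<mu>" using stat unfolding stationary_def by blast
  define Z where "Z u = X (fst u) (snd u)" for u
  define Y where "Y u \<omega> = Z u \<omega> - \<mu>" for u \<omega>
  define \<gamma> where "\<gamma> h = autocov M X (fst h) (snd h)" for h
  have Zm: "Z u \<in> borel_measurable M" and Z2: "integrable M (\<lambda>\<omega>. (Z u \<omega>)\<^sup>2)" for u
    using stat unfolding stationary_def Z_def by auto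
  have Zi: "integrable M (Z u)" for u by (rule square_integrable_imp_integrable[OF Zm Z2])
  have ZX: "Z = (\<lambda>(i, j). X i j)" by (simp add: Z_def fun_eq_iff)
  have cg: "centred_gaussian M Y"
    unfolding Y_def using centred_gaussian_of_process[OF Zm Zi _ gauss[folded ZX], of \<mu>] \<mu>
        by (simp add: Z_def)
  interpret centred_gaussian M Y by (rule cg)
  have cov: "expectation (\<lambda>\<omega>. Y u \<omega> * Y v \<omega>) = \<gamma> (u - v)" for u v
  proof -
    have "covar M (X (fst v + fst (u - v)) (snd v + snd (u - v))) (X (fst v) (snd v))
        = autocov M X (fst (u - v)) (snd (u - v))"
      using stat unfolding stationary_def by blast
    then show ?thesis by (simp add: covar_def \<mu> \<gamma>_def Y_def Z_def)
  qed
  define K where "K = \<sigma>\<^sup>2 / (4 * pi\<^sup>2) / ((1 - \<bar>\<alpha>\<bar>)\<^sup>2 * (1 - \<bar>\<beta>\<bar>)\<^sup>2)"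
  have K: "0 < K" unfolding K_def using \<sigma> \<rho> by (intro divide_pos_pos mult_pos_pos) auto
  have fi: "integrable T f" unfolding f_def by (rule has_spectral_density_T[OF sd])
  have f0: "0 \<le> f p" for p unfolding f_def farima_density_eq by (simp add: phi_nonneg)
  have fK: "f p \<le> K * (chord (fst p) powr (- 2 * d1) * chord (snd p) powr (- 2 * d2))" for p
    unfolding f_def K_def by (rule farima_density_le[OF \<rho>])
  have \<gamma>f: "of_real (\<gamma> h) = integral\<^sup>L T (\<lambda>p. chi h p * of_real (f p))" for h
    unfolding \<gamma>_def f_def by (rule has_spectral_density_T[OF sd])
  obtain C \<eta> where C: "0 < \<eta>" "\<And>N h. 1 \<le> N \<Longrightarrow> (\<Sum>u\<in>grid N. \<Sum>v\<in>grid N. (\<gamma> (u - v + h))\<^sup>2)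
      \<le> C * real N powr (4 - \<eta>)"
    using spectral_l2_rate[OF fi d K f0 fK \<gamma>f] by blast
  interpret gaussian_field M Y \<gamma> C \<eta>
    by unfold_locales (use cov C in auto)
  have sq: "AE \<omega> in M. (\<lambda>N. (\<Sum>u\<in>grid N. (Y u \<omega>)\<^sup>2) / (real N)\<^sup>2) \<longlonglongrightarrow> \<gamma> 0"
    using strong_law_squares[of 0 0 0] by simp
  have pr: "AE \<omega> in M. \<forall>h. (\<lambda>N. (\<Sum>u\<in>overlap N h. Y u \<omega> * Y (u + h) \<omega>) / (real N)\<^sup>2) \<longlonglongrightarrow> \<gamma> h"
    unfolding AE_all_countable using sample_products by blast
  show ?thesis using sample_mean_null sq pr
  proof eventually_elim
    case (elim \<omega>)
    show ?case
    proof
      fix h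
      let ?m = "\<lambda>N. (\<Sum>u\<in>grid N. Y u \<omega>) / (real N)\<^sup>2"
      have "(\<lambda>N. (\<Sum>u\<in>overlap N h. (Y u \<omega> - ?m N) * (Y (u + h) \<omega> - ?m N)) / (real N)\<^sup>2) \<longlonglongrightarrow> \<gamma> h"
        by (rule tendsto_sample_autocovariance[OF elim(1,2) spec[OF elim(3)]])
      then have l: "(\<lambda>N. complex_of_real (4 * pi\<^sup>2 * ((\<Sum>u\<in>overlap N h. (Y u \<omega> - ?m N) * (Y (u
          + h) \<omega> - ?m N)) / (real N)\<^sup>2))) \<longlonglongrightarrow> of_real (4 * pi\<^sup>2 * \<gamma> h)"
        by (intro tendsto_of_real tendsto_mult_left)
      have ev: "\<forall>\<^sub>F N in sequentially. complex_of_real (4 * pi\<^sup>2 * ((\<Sum>u\<in>overlap N h.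
          (Y u \<omega> - ?m N) * (Y (u + h) \<omega> - ?m N)) / (real N)\<^sup>2))
         = integral\<^sup>L T (\<lambda>p. chi h p * of_real (periodogram X N \<omega> (fst p) (snd p)))"
        by (rule eventually_sequentiallyI[of 1]) (simp only: integral_chi_periodogram[of _ h X _
            \<mu>] Y_def Z_def)
      show "(\<lambda>N. integral\<^sup>L T (\<lambda>p. chi h p * of_real (periodogram X N \<omega> (fst p) (snd p))))
         \<longlonglongrightarrow> of_real (4 * pi\<^sup>2) * integral\<^sup>L T (\<lambda>p. chi h p * of_real (f p))"
        using Lim_transform_eventually[OF l ev] unfolding of_real_mult \<gamma>f .
    qed
  qed
qed

theorem theorem1p1:
  fixes M :: "'a measure"
    and X :: "int \<Rightarrow> int \<Rightarrow> 'a \<Rightarrow> real"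
    and \<sigma> r s \<alpha>0 \<beta>0 d10 d20 :: real
    and \<theta>hat :: "nat \<Rightarrow> 'a \<Rightarrow> real \<times> real \<times> real \<times> real"
  assumes "prob_space M"
    and "stationary M X"
    and "gaussian_process M (\<lambda>(i, j). X i j)"
    and "\<sigma>\<^sup>2 > 0"
    and "\<bar>\<alpha>0\<bar> < 1" and "\<bar>\<beta>0\<bar> < 1"
    and "0 < d10" and "d10 < 1/2" and "0 < d20" and "d20 < 1/2"
    and "has_spectral_density M X (farima_density \<sigma> (\<alpha>0, \<beta>0, d10, d20))"
    and "0 < r" and "r < 1" and "0 < s" and "s < 1/2"
    and "(\<alpha>0, \<beta>0, d10, d20) \<in> Theta r s"
    and "\<And>N \<omega>. N \<ge> 1 \<Longrightarrow> \<omega> \<in> space M \<Longrightarrow>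
           is_arg_min (sigma2_N X \<sigma> N \<omega>) (\<lambda>\<theta>. \<theta> \<in> Theta r s) (\<theta>hat N \<omega>)"
  shows "AE \<omega> in M. (\<lambda>N. \<theta>hat N \<omega>) \<longlonglongrightarrow> (\<alpha>0, \<beta>0, d10, d20)"
proof -
  let ?f = "\<lambda>p. farima_density \<sigma> (\<alpha>0, \<beta>0, d10, d20) (fst p) (snd p)"
  have "AE \<omega> in M. \<forall>h. (\<lambda>N. integral\<^sup>L T (\<lambda>p. chi h p * of_real (periodogram X N \<omega> (fst p) (snd p))))
     \<longlonglongrightarrow> of_real (4 * pi\<^sup>2) * integral\<^sup>L T (\<lambda>p. chi h p * of_real (?f p))"
    by (rule AE_periodogram_moments) fact+
  then show ?thesis using AE_space
  proof eventually_elim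
    case (elim \<omega>)
    interpret weak_limit "\<lambda>N p. periodogram X N \<omega> (fst p) (snd p)" ?f "4 * pi\<^sup>2"
    proof
      show "integrable T (\<lambda>p. periodogram X N \<omega> (fst p) (snd p))" for N
        by (intro continuous_integrable_T continuous_periodogram)
      show "integrable T ?f" by (rule has_spectral_density_T) fact
      show "0 \<le> ?f p" for p unfolding farima_density_eq by (simp add: phi_nonneg)
      show "(\<lambda>N. integral\<^sup>L T (\<lambda>p. chi h p * of_real (periodogram X N \<omega> (fst p) (snd p))))
          \<longlonglongrightarrow> of_real (4 * pi\<^sup>2) * integral\<^sup>L T (\<lambda>p. chi h p * of_real (?f p))" for h
        using elim(1) by (rule spec)
    qed (simp_all add: periodogram_nonneg)
    have am: "\<theta>hat N \<omega> \<in> Theta r s \<and> (\<forall>\<theta>\<in>Theta r s. \<not> sigma2_N X \<sigma> N \<omega> \<theta> < sigma2_N X \<sigma> N \<omega> (\<theta>hat N \<omega>))"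
      if "1 \<le> N" for N
      using assms(17)[OF that elim(2)] unfolding is_arg_min_def by blast
    show ?case
    proof (rule whittle_consistency)
      show "\<theta>hat N \<omega> \<in> Theta r s" if "1 \<le> N" for N using am[OF that] ..
      show "whittle_objective \<sigma> (\<lambda>p. periodogram X N \<omega> (fst p) (snd p)) (\<theta>hat N \<omega>)
        \<le> whittle_objective \<sigma> (\<lambda>p. periodogram X N \<omega> (fst p) (snd p)) (\<alpha>0, \<beta>0, d10, d20)" if "1
            \<le> N" for N
        using am[OF that] assms(16) unfolding sigma2_N_eq_whittle_objective not_less
            by (elim conjE bspec)
      show "continuous_on UNIV (\<lambda>p. periodogram X N \<omega> (fst p) (snd p))" for N
          by (rule continuous_periodogram)
    qed (use assms in simp_all)
  qed
qed

end
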